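(* Let $r \ge 2$ be an integer, let $\alpha > 0$ be a real number, and let $p = p(n)$ satisfy $1/n \ll p = 1-\Omega(1)$. Then the following hold. (i) If $d = d(n)$ is a sequence of nonnegative integers with $d \ll \sqrt{np}$, then with high probability the binomial random graph $G_{n,p}$ admits a $(d,r,\alpha)$-core. (ii) There exists a constant $C = C(\alpha) > 0$ (depending only on $\alpha$) such that, for every $d = d(n) \ge C\sqrt{np}$, with high probability no set of at least $\alpha n$ vertices of $G_{n,p}$ is entirely contained in a single part of every $r$-cut of $G_{n,p}$ with deficit at most $d$ (where "contained in a single part of every $r$-cut" means that, for every such $r$-cut, all vertices of the set lie in the same part of that cut).
   Context: An $r$-cut in a graph $G$ is a partition of its vertex set $V(G)$ into $r$ subsets (parts may be empty). The size of an $r$-cut is the number of edges of $G$ with endpoints in different parts. Let $b_r(G)$ be the maximum size of an $r$-cut of $G$. The deficit of an $r$-cut in $G$ is $b_r(G)$ minus the size of the cut. For integers $d \ge 0$, $r \ge 2$ and real $\alpha>0$, a graph $G$ admits a $(d,r,\alpha)$-core if there exist $r$ pairwise-disjoint sets of vertices $S_1,\dotsc,S_r$, each of size exceeding $(1/r-\alpha)\cdot|V(G)|$, that are contained in different parts of every $r$-cut of $G$ with deficit at most $d$ (i.e., for every $r$-cut with deficit at most $d$, each $S_i$ is contained in one part and distinct $S_i$ are contained in distinct parts). $G_{n,p}$ is the random graph on $n$ vertices in which each pair of vertices is an edge independently with probability $p$. "With high probability" means with probability tending to $1$ as $n\to\infty$. For functions of $n$, $f \ll g$ means $f/g \to 0$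 as $n \to \infty$; $p = 1-\Omega(1)$ means that $1-p$ is bounded below by a positive constant for all large $n$. *)

theory Defs
  imports "HOL-Probability.Probability" "HOL-Library.Ramsey" "HOL-Library.Landau_Symbols"
begin

text \<open>
  A finite simple graph is given by a finite vertex set \<open>V\<close> and an edge set
  \<open>E \<subseteq> nsets V 2\<close>, that is, a set of two-element subsets of \<open>V\<close>.
  An \<open>r\<close>-cut is a family of (possibly empty) parts \<open>P 0, \<dots>, P (r - 1)\<close>;
  the values of \<open>P\<close> at indices \<open>\<ge> r\<close> are irrelevant.
\<close>

definition is_cut :: "nat \<Rightarrow> 'a set \<Rightarrow> (nat \<Rightarrow> 'a set) \<Rightarrow> bool" where
  "is_cut r V P \<longleftrightarrow> disjoint_family_on P {..<r} \<and> (\<Union>i<r. P i) = V"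

definition cut_size :: "nat \<Rightarrow> 'a set set \<Rightarrow> (nat \<Rightarrow> 'a set) \<Rightarrow> nat" where
  "cut_size r E P =
     card {e \<in> E. \<exists>i<r. \<exists>j<r. i \<noteq> j \<and> (\<exists>u \<in> P i. \<exists>v \<in> P j. e = {u, v})}"

definition max_cut :: "nat \<Rightarrow> 'a set \<Rightarrow> 'a set set \<Rightarrow> nat" where
  "max_cut r V E = Max {cut_size r E P | P. is_cut r V P}"

text \<open>
  For a finite graph, the subtraction on \<^typ>\<open>nat\<close> below never truncates when \<open>P\<close> is an \<open>r\<close>-cut.
\<close>

definition deficit :: "nat \<Rightarrow> 'a set \<Rightarrow> 'a set set \<Rightarrow> (nat \<Rightarrow> 'a set) \<Rightarrow> nat" where
  "deficit r V E P = max_cut r V E - cut_size r E P"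

text \<open>
  The map \<open>\<sigma>\<close> says which part of the cut contains which \<open>S i\<close>; since parts are labelled, it
  depends on the cut.
\<close>

definition admits_core :: "nat \<Rightarrow> nat \<Rightarrow> real \<Rightarrow> 'a set \<Rightarrow> 'a set set \<Rightarrow> bool" where
  "admits_core d r \<alpha> V E \<longleftrightarrow>
     (\<exists>S :: nat \<Rightarrow> 'a set.
        disjoint_family_on S {..<r} \<and>
        (\<forall>i<r. S i \<subseteq> V \<and> real (card (S i)) > (1 / real r - \<alpha>) * real (card V)) \<and>
        (\<forall>P. is_cut r V P \<and> deficit r V E P \<le> d \<longrightarrow>
           (\<exists>\<sigma>. inj_on \<sigma> {..<r} \<and> (\<forall>i<r. \<sigma> i < r \<and> S i \<subseteq> P (\<sigma> i)))))"

definition in_single_part :: "nat \<Rightarrow> nat \<Rightarrow> 'a set \<Rightarrow> 'a set set \<Rightarrow> 'a set \<Rightarrow> bool" where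
  "in_single_part d r V E S \<longleftrightarrow>
     (\<forall>P. is_cut r V P \<and> deficit r V E P \<le> d \<longrightarrow> (\<exists>i<r. S \<subseteq> P i))"

text \<open>
  The edge set of the binomial random graph on the vertex set \<open>{..<n}\<close>: one independent
  Bernoulli variable per pair of vertices. This is meaningful for \<open>0 \<le> p \<le> 1\<close>.
\<close>

definition gnp :: "nat \<Rightarrow> real \<Rightarrow> nat set set pmf" where
  "gnp n p = map_pmf (\<lambda>f. {e \<in> nsets {..<n} 2. f e})
               (Pi_pmf (nsets {..<n} 2) False (\<lambda>_. bernoulli_pmf p))"

definition whp_gnp :: "(nat \<Rightarrow> real) \<Rightarrow> (nat \<Rightarrow> nat set \<Rightarrow> nat set set \<Rightarrow> bool) \<Rightarrow> bool" where
  "whp_gnp p Q \<longleftrightarrow>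
     (\<lambda>n. measure_pmf.prob (gnp n (p n)) {E. Q n {..<n} E}) \<longlonglongrightarrow> 1"

text \<open>
  The relation \<open>1/n \<ll> p\<close> is stated with \<open>o\<close>, which forces \<open>p n\<close> to be eventually nonzero;
  a limit of quotients would not, because division by zero yields zero.
\<close>

definition admissible_prob :: "(nat \<Rightarrow> real) \<Rightarrow> bool" where
  "admissible_prob p \<longleftrightarrow>
     (\<forall>n. 0 \<le> p n \<and> p n \<le> 1) \<and>
     (\<lambda>n. 1 / real n) \<in> o(p) \<and>
     (\<exists>c>0. \<forall>\<^sub>F n in sequentially. 1 - p n \<ge> c)"

end

theory Submission
  imports Defs
begin

text \<open>
  Write \<open>b(G)\<close> for the maximum size of an \<open>r\<close>-cut, fix for every graph \<open>G\<close> one maximum cut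
  \<open>opt G\<close>, and put \<open>x = sqrt (n p)\<close>. Uniformly over all pairs of vertex sets, edge counts in
  \<open>G(n,p)\<close> deviate from their means by \<open>O(n x)\<close> (lemma \<open>prob_not_jumbled\<close>).

  Part (ii) needs only this and local optimality. Let \<open>S\<close> lie in the part \<open>P i\<close> of a maximum cut,
  and let \<open>j \<noteq> i\<close>. Since no vertex of \<open>P j\<close> gains by moving to \<open>P i\<close>, the part \<open>P j\<close> cannot be
  much larger than \<open>P i\<close>; so the average loss over \<open>v \<in> S\<close> of moving \<open>v\<close> alone to \<open>P j\<close> is
  \<open>O(x)\<close>, and some such move yields a cut of small deficit that splits \<open>S\<close>
  (lemma \<open>not_in_single_part\<close>).

  Part (i) is proved by resampling edges, which leaves the law of the graph, and hence the expectation
  of \<open>b\<close>, unchanged.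

  Macroscopic stability (lemma \<open>macro_stability\<close>). Resample each pair with probability \<open>\<tau> / n\<close>, for a
  small constant \<open>\<tau>\<close>. If \<open>P = opt G\<close> and some cut \<open>Q\<close> of deficit at most \<open>\<tau> x\<close> separates a very
  different set of pairs, then resampling makes the sizes of \<open>P\<close> and \<open>Q\<close> drift apart by random
  fluctuations of order \<open>sqrt \<tau> x\<close>. So the larger of the two exceeds \<open>b(G)\<close> on average by an amount of
  that order, up to the deficit of \<open>Q\<close> and a drift of order \<open>\<tau> x\<close> towards the mean. As the expectation
  of \<open>b\<close> does not change, this is unlikely: typically all cuts of deficit at most \<open>\<tau> x\<close> agree with \<open>P\<close>
  up to few pairs.

  Noise stability (lemma \<open>opt_noise_stability\<close>). Let \<open>F\<close> and \<open>H\<close> differ by resampling each pair at one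
  vertex \<open>v\<close> with a small constant probability \<open>\<epsilon>\<close>. For a typical \<open>v\<close> the cut \<open>opt F\<close> has
  deficit \<open>O(\<epsilon> x)\<close> in \<open>H\<close>, so by the previous step it agrees with \<open>opt H\<close> up to few pairs. The point is
  that \<open>opt F\<close> is independent of the resampled pairs of \<open>H\<close>.

  Microscopic stability (lemmas \<open>addition_inequality\<close>, \<open>sum_gain_le\<close>, \<open>loose_gain\<close>). Given \<open>F\<close>,
  the edges of \<open>H\<close> from \<open>v\<close> to the \<open>j\<close>-th part of \<open>opt F\<close> at non-edges of \<open>F\<close> are independent indicators,
  and adding of the order of \<open>\<epsilon> \<mu> x\<close> random ones among them, for a small constant \<open>\<mu>\<close>, hardly changes
  their law: the standard deviation of their number is of order \<open>sqrt \<epsilon> x\<close>.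
  Adding them raises \<open>b\<close> by nearly their full number, less \<open>d\<close>, as soon as one cut of deficit at most \<open>d\<close>
  puts \<open>v\<close> away from that part. On the other hand, summed over all \<open>j\<close> the expected increase is at most the number
  of added edges that \<open>opt H\<close> separates, which is about a fraction \<open>1 - 1/r\<close> of all of them. Hence for most
  \<open>v\<close> there is a part that no cut of deficit at most \<open>d\<close> can avoid. Such
  vertices \<open>v\<close> are tight, all others loose: for tight \<open>v\<close>, the part containing \<open>v\<close> is almost the same set
  in all cuts of deficit at most \<open>d\<close>. Removing the loose vertices from the parts of \<open>opt H\<close> leaves the core
  (lemma \<open>core_of_few_loose\<close>).

  All expectations are finite sums over the subsets of a finite set, so that conditioning amounts to
  nesting such sums.
\<close>

section \<open>Product Bernoulli measures\<close>

text \<open>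
  The probability that a random subset of \<open>D\<close>, containing each \<open>e \<in> D\<close> independently with
  probability \<open>q e\<close>, equals \<open>E\<close>; only the trace of \<open>E\<close> on \<open>D\<close> matters.
\<close>

definition bern_weight :: "'e set \<Rightarrow> ('e \<Rightarrow> real) \<Rightarrow> 'e set \<Rightarrow> real" where
  "bern_weight D q E = (\<Prod>e\<in>D. if e \<in> E then q e else 1 - q e)"

text \<open>
  The expectation of \<open>h E\<close> for such a random subset \<open>E\<close> of \<open>D\<close>.
\<close>

definition bern_ex :: "'e set \<Rightarrow> ('e \<Rightarrow> real) \<Rightarrow> ('e set \<Rightarrow> real) \<Rightarrow> real" where
  "bern_ex D q h = (\<Sum>E\<in>Pow D. bern_weight D q E * h E)"

lemma bern_weight_nonneg: "(\<And>e. e \<in> D \<Longrightarrow> 0 \<le> q e \<and> q e \<le> 1) \<Longrightarrow> 0 \<le> bern_weight D q E"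
  unfolding bern_weight_def by (intro prod_nonneg) auto

lemma bern_ex_empty [simp]: "bern_ex {} q h = h {}"
  by (simp add: bern_ex_def bern_weight_def)

lemma bern_weight_insert:
  assumes "finite D" "x \<notin> D"
  shows "bern_weight (insert x D) q E = (if x \<in> E then q x else 1 - q x) * bern_weight D q E"
  using assms by (simp add: bern_weight_def)

lemma bern_weight_insert_set:
  assumes "x \<notin> D"
  shows "bern_weight D q (insert x E) = bern_weight D q E"
  unfolding bern_weight_def using assms by (intro prod.cong) auto

text \<open>
  Conditioning on one element. The identities for products, unions and thinnings below follow from it by
  induction.
\<close>

lemma bern_ex_insert:
  assumes "finite D" "x \<notin> D"
  shows "bern_ex (insert x D) q h = q x * bern_ex D q (\<lambda>E. h (insert x E)) + (1 - q x) * bern_ex D q h"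
proof -
  have "bern_ex (insert x D) q h = (\<Sum>E\<in>Pow D. bern_weight (insert x D) q E * h E)
      + (\<Sum>E\<in>insert x ` Pow D. bern_weight (insert x D) q E * h E)"
    unfolding bern_ex_def Pow_insert using assms by (intro sum.union_disjoint) auto
  also have "(\<Sum>E\<in>insert x ` Pow D. bern_weight (insert x D) q E * h E)
      = (\<Sum>E\<in>Pow D. bern_weight (insert x D) q (insert x E) * h (insert x E))"
    using assms by (intro sum.reindex_cong[of "insert x"]) (auto intro!: inj_onI)
  also have "\<dots> = q x * bern_ex D q (\<lambda>E. h (insert x E))"
    using assms by (simp add: bern_ex_def bern_weight_insert bern_weight_insert_set sum_distrib_left mult.assoc)
  also have "(\<Sum>E\<in>Pow D. bern_weight (insert x D) q E * h E) = (1 - q x) * bern_ex D q h"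
    unfolding bern_ex_def sum_distrib_left using assms
    by (intro sum.cong) (auto simp: bern_weight_insert mult.assoc)
  finally show ?thesis by simp
qed

lemma bern_ex_cong:
  assumes "\<And>e. e \<in> D \<Longrightarrow> q e = q' e" "\<And>E. E \<subseteq> D \<Longrightarrow> h E = h' E"
  shows "bern_ex D q h = bern_ex D q' h'"
proof -
  have "bern_weight D q E = bern_weight D q' E" for E
    unfolding bern_weight_def using assms(1) by (intro prod.cong) auto
  then show ?thesis
    unfolding bern_ex_def using assms(2) by (intro sum.cong) auto
qed

lemma bern_ex_add: "bern_ex D q (\<lambda>E. g E + h E) = bern_ex D q g + bern_ex D q h"
  by (simp add: bern_ex_def sum.distrib algebra_simps)

lemma bern_ex_diff: "bern_ex D q (\<lambda>E. g E - h E) = bern_ex D q g - bern_ex D q h"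
  by (simp add: bern_ex_def sum_subtractf algebra_simps)

lemma bern_ex_cmult: "bern_ex D q (\<lambda>E. a * h E) = a * bern_ex D q h"
  by (simp add: bern_ex_def sum_distrib_left algebra_simps)

lemma bern_ex_cdivide: "bern_ex D q (\<lambda>E. h E / a) = bern_ex D q h / a"
  by (simp add: bern_ex_def sum_divide_distrib)

lemma bern_ex_sum: "bern_ex D q (\<lambda>E. \<Sum>i\<in>I. h i E) = (\<Sum>i\<in>I. bern_ex D q (h i))"
  unfolding bern_ex_def sum_distrib_left by (rule sum.swap)

lemma bern_ex_prod:
  assumes "finite D"
  shows "bern_ex D q (\<lambda>E. \<Prod>e\<in>D. h e (e \<in> E)) = (\<Prod>e\<in>D. q e * h e True + (1 - q e) * h e False)"
  using assms
proof (induction D)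
  case (insert x D)
  have "bern_ex (insert x D) q (\<lambda>E. \<Prod>e\<in>insert x D. h e (e \<in> E))
     = q x * bern_ex D q (\<lambda>E. h x True * (\<Prod>e\<in>D. h e (e \<in> E)))
       + (1 - q x) * bern_ex D q (\<lambda>E. h x False * (\<Prod>e\<in>D. h e (e \<in> E)))"
    unfolding bern_ex_insert[OF insert.hyps]
  proof (intro arg_cong2[where f = "(+)"] arg_cong2[where f = "(*)"] bern_ex_cong refl)
    fix E assume "E \<subseteq> D"
    have "h e (e \<in> insert x E) = h e (e \<in> E)" if "e \<in> D" for e
      using insert.hyps that by (cases "e = x") auto
    then have "(\<Prod>e\<in>D. h e (e \<in> insert x E)) = (\<Prod>e\<in>D. h e (e \<in> E))"
      by (intro prod.cong refl)
    then show "(\<Prod>e\<in>insert x D. h e (e \<in> insert x E)) = h x True * (\<Prod>e\<in>D. h e (e \<in> E))"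
      using insert.hyps by simp
  next
    fix E assume "E \<subseteq> D"
    then have "x \<notin> E" using insert.hyps by auto
    then show "(\<Prod>e\<in>insert x D. h e (e \<in> E)) = h x False * (\<Prod>e\<in>D. h e (e \<in> E))"
      using insert.hyps by simp
  qed
  then show ?case
    using insert by (simp add: bern_ex_cmult algebra_simps)
qed simp

lemma bern_ex_const:
  assumes "finite D"
  shows "bern_ex D q (\<lambda>_. a) = a"
  using assms by (induction D) (auto simp: bern_ex_insert algebra_simps)

lemma sum_bern_weight:
  assumes "finite D"
  shows "(\<Sum>E\<in>Pow D. bern_weight D q E) = 1"
  using bern_ex_const[OF assms, of q 1] by (simp add: bern_ex_def)

lemma bern_ex_mono:
  assumes "\<And>e. e \<in> D \<Longrightarrow> 0 \<le> q e \<and> q e \<le> 1" "\<And>E. E \<subseteq> D \<Longrightarrow> g E \<le> h E"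
  shows "bern_ex D q g \<le> bern_ex D q h"
  unfolding bern_ex_def using assms by (intro sum_mono mult_left_mono bern_weight_nonneg) auto

lemma bern_ex_nonneg:
  assumes "\<And>e. e \<in> D \<Longrightarrow> 0 \<le> q e \<and> q e \<le> 1" "\<And>E. E \<subseteq> D \<Longrightarrow> 0 \<le> h E"
  shows "0 \<le> bern_ex D q h"
  unfolding bern_ex_def using assms by (intro sum_nonneg mult_nonneg_nonneg bern_weight_nonneg) auto

lemma bern_ex_of_bool_mem:
  assumes "finite D" "e \<in> D"
  shows "bern_ex D q (\<lambda>E. of_bool (e \<in> E)) = q e"
proof -
  have "bern_ex D q (\<lambda>E. of_bool (e \<in> E)) = bern_ex D q (\<lambda>E. \<Prod>x\<in>D. if x = e then of_bool (x \<in> E) else 1)"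
    using assms by (intro bern_ex_cong) (auto simp: prod.delta)
  also have "\<dots> = (\<Prod>x\<in>D. q x * (if x = e then 1 else 1) + (1 - q x) * (if x = e then 0 else 1))"
    using bern_ex_prod[OF assms(1), of q "\<lambda>x b. if x = e then of_bool b else 1"] by simp
  also have "\<dots> = (\<Prod>x\<in>D. if x = e then q x else 1)"
    by (intro prod.cong) auto
  finally show ?thesis using assms by (simp add: prod.delta)
qed

lemma card_Int_sum: "finite Y \<Longrightarrow> real (card (E \<inter> Y)) = (\<Sum>e\<in>Y. of_bool (e \<in> E))"
  by (simp add: sum_of_bool_eq Int_commute)

lemma card_Diff_sum:
  assumes "finite Y"
  shows "real (card (Y - E)) = (\<Sum>e\<in>Y. 1 - of_bool (e \<in> E))"
proof -
  have "card Y = card (Y - E) + card (E \<inter> Y)"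
    using assms card_Int_Diff[of Y E] by (simp add: Int_commute)
  then show ?thesis using assms by (simp only: sum_subtractf card_Int_sum[OF assms, symmetric]) simp
qed

lemma bern_ex_card_Int:
  assumes "finite D" "Y \<subseteq> D"
  shows "bern_ex D q (\<lambda>E. real (card (E \<inter> Y))) = sum q Y"
proof -
  have "finite Y" using assms finite_subset by auto
  then show ?thesis
    using assms by (simp only: card_Int_sum bern_ex_sum) (auto intro!: sum.cong bern_ex_of_bool_mem)
qed

lemma bern_ex_card_Diff:
  assumes "finite D" "Y \<subseteq> D"
  shows "bern_ex D q (\<lambda>E. real (card (Y - E))) = (\<Sum>e\<in>Y. 1 - q e)"
proof -
  have "finite Y" using assms finite_subset by auto
  then show ?thesis
    using assms by (simp only: card_Diff_sum bern_ex_sum bern_ex_diff bern_ex_const)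
      (auto simp: bern_ex_of_bool_mem intro!: sum.cong)
qed

text \<open>
  The union of independent Bernoulli sets is a Bernoulli set.
\<close>

lemma bern_ex_union:
  assumes "finite D"
  shows "bern_ex D q (\<lambda>G. bern_ex D k (\<lambda>T. h (G \<union> T))) = bern_ex D (\<lambda>e. 1 - (1 - q e) * (1 - k e)) h"
  using assms
proof (induction D arbitrary: h)
  case (insert x D)
  show ?case
    unfolding bern_ex_insert[OF insert.hyps] bern_ex_add bern_ex_cmult
    using insert.IH[of h] insert.IH[of "\<lambda>E. h (insert x E)"]
    by (simp add: algebra_simps)
qed simp

text \<open>
  Thinning: deleting an independent Bernoulli set from a Bernoulli set.
\<close>

lemma bern_ex_minus:
  assumes "finite D"
  shows "bern_ex D q (\<lambda>H. bern_ex D k (\<lambda>T. h (H - T))) = bern_ex D (\<lambda>e. q e * (1 - k e)) h"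
  using assms
proof (induction D arbitrary: h)
  case (insert x D)
  have 1: "bern_ex D q (\<lambda>H. bern_ex D k (\<lambda>T. h (insert x H - T))) = bern_ex D q (\<lambda>H. bern_ex D k (\<lambda>T. h (insert x (H - T))))"
    using insert.hyps by (intro bern_ex_cong refl) (auto intro!: arg_cong[of _ _ h])
  have 2: "bern_ex D q (\<lambda>H. bern_ex D k (\<lambda>T. h (H - insert x T))) = bern_ex D q (\<lambda>H. bern_ex D k (\<lambda>T. h (H - T)))"
    using insert.hyps by (intro bern_ex_cong refl) (auto intro!: arg_cong[of _ _ h])
  show ?case
    unfolding bern_ex_insert[OF insert.hyps] bern_ex_add bern_ex_cmult
    using insert.IH[of h] insert.IH[of "\<lambda>E. h (insert x E)"] 1 2
    by (simp add: algebra_simps)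
qed simp

section \<open>Hellinger comparison of product measures\<close>

lemma sqrt_prod: "sqrt (\<Prod>x\<in>A. f x) = (\<Prod>x\<in>A. sqrt (f x))"
  by (induction A rule: infinite_finite_induct) (auto simp: real_sqrt_mult)

text \<open>
  Lowering the probabilities on \<open>S\<close> by a factor \<open>1 - \<rho>\<close> changes the expectation of a function with
  values between \<open>0\<close> and \<open>M\<close> by little: the \<open>L1\<close> distance of the two laws is controlled by the Hellinger
  distance, which factorises over the coordinates. No lower bound on the probabilities is needed.
\<close>

lemma hellinger_bound:
  fixes a \<rho> :: real
  assumes fin: "finite D" and SD: "S \<subseteq> D"
    and q: "\<And>e. e \<in> D \<Longrightarrow> 0 \<le> q e \<and> q e \<le> 1"
    and qS: "\<And>e. e \<in> S \<Longrightarrow> q e \<le> a" and a: "a \<le> 1/2"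
    and eq: "\<And>e. e \<in> D - S \<Longrightarrow> q' e = q e"
    and eqS: "\<And>e. e \<in> S \<Longrightarrow> q' e = q e * (1 - \<rho>)" and rho: "0 \<le> \<rho>" "\<rho> \<le> 1"
    and h: "\<And>E. E \<subseteq> D \<Longrightarrow> 0 \<le> h E \<and> h E \<le> M"
  shows "bern_ex D q h - M * \<rho> * sqrt (8 * real (card S) * a) \<le> bern_ex D q' h"
proof -
  have q': "0 \<le> q' e \<and> q' e \<le> 1" if "e \<in> D" for e
    using q[OF that] eq[of e] eqS[of e] that rho
    by (cases "e \<in> S") (auto intro: mult_le_one)
  have finS: "finite S" using fin SD finite_subset by auto
  define u where "u E = sqrt (bern_weight D q E)" for E
  define w where "w E = sqrt (bern_weight D q' E)" for E
  have bq: "bern_weight D q E \<ge> 0" "bern_weight D q' E \<ge> 0" for E using q q' by (auto intro!: bern_weight_nonneg)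
  have M: "M \<ge> 0" using h[of "{}"] by auto
  have uw: "(u E)\<^sup>2 = bern_weight D q E" "(w E)\<^sup>2 = bern_weight D q' E" "0 \<le> u E" "0 \<le> w E" for E
    using bq by (auto simp: u_def w_def)
  let ?P = "Pow D"
  define bc where "bc e = sqrt (q e * q' e) + sqrt ((1 - q e) * (1 - q' e))" for e
  have BC: "(\<Sum>E\<in>?P. u E * w E) = (\<Prod>e\<in>D. bc e)"
  proof -
    have s: "(\<Sum>E\<in>Pow D. \<Prod>e\<in>D. if e \<in> E then f e else g e) = (\<Prod>e\<in>D. f e + g e)"
      for f g :: "'a \<Rightarrow> real"
    proof -
      have "(\<Sum>E\<in>Pow D. \<Prod>e\<in>D. if e \<in> E then f e else g e) = (\<Sum>E\<in>Pow D. prod f E * prod g (D - E))"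
      proof (intro sum.cong refl)
        fix E assume "E \<in> Pow D"
        then have "D \<inter> {x. x \<in> E} = E" "D \<inter> - {x. x \<in> E} = D - E" by auto
        then show "(\<Prod>e\<in>D. if e \<in> E then f e else g e) = prod f E * prod g (D - E)"
          using fin by (simp add: prod.If_cases)
      qed
      then show ?thesis using prod_add[OF fin, of f g] by simp
    qed
    have "u E * w E = (\<Prod>e\<in>D. if e \<in> E then sqrt (q e * q' e) else sqrt ((1 - q e) * (1 - q' e)))" for E
      unfolding u_def w_def bern_weight_def real_sqrt_mult[symmetric] prod.distrib[symmetric]
      by (subst sqrt_prod) (intro prod.cong, auto)
    then show ?thesis unfolding bc_def using s by simp
  qed
  have bc1: "bc e = 1" if "e \<in> D - S" for e
    using that eq[OF that] q[of e] by (simp add: bc_def)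
  have bcS: "bc e \<ge> 1 - a * \<rho>\<^sup>2 \<and> bc e \<ge> 0" if "e \<in> S" for e
  proof -
    have eD: "e \<in> D" using that SD by auto
    define x where "x = q e"
    have x: "0 \<le> x" "x \<le> a" "x \<le> 1/2" using q[OF eD] qS[OF that] a by (auto simp: x_def)
    define y where "y = x * (1 - \<rho>)"
    have y: "0 \<le> y" "y \<le> x" using x rho by (auto simp: y_def mult_left_le)
    have s1: "sqrt (x * y) \<ge> y"
      using y x by (intro real_le_rsqrt) (auto simp: power2_eq_square mult_right_mono)
    have h1: "sqrt (x * y) = (x + y - (sqrt x - sqrt y)\<^sup>2) / 2"
      using x y by (simp add: power2_diff real_sqrt_mult)
    have h2: "sqrt ((1-x) * (1-y)) = ((1-x) + (1-y) - (sqrt (1-x) - sqrt (1-y))\<^sup>2) / 2"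
      using x y by (simp add: power2_diff real_sqrt_mult)
    have d1: "(sqrt x - sqrt y)\<^sup>2 \<le> x * \<rho>\<^sup>2"
    proof -
      have "1 - \<rho> \<le> sqrt (1 - \<rho>)" using rho
        by (intro real_le_rsqrt) (auto simp: power2_eq_square mult_left_le)
      moreover have "sqrt (1 - \<rho>) \<le> 1" using rho by simp
      moreover have "(sqrt x - sqrt y)\<^sup>2 = x * (1 - sqrt (1 - \<rho>))\<^sup>2"
      proof -
        have "sqrt x - sqrt y = sqrt x * (1 - sqrt (1 - \<rho>))"
          unfolding y_def real_sqrt_mult by (simp add: right_diff_distrib)
        then show ?thesis using x by (simp add: power_mult_distrib)
      qed
      ultimately show ?thesis using x by (auto intro!: mult_left_mono power_mono)
    qed
    have d2: "(sqrt (1-x) - sqrt (1-y))\<^sup>2 \<le> x * \<rho>\<^sup>2"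
    proof -
      have p: "(sqrt (1-x) + sqrt (1-y))\<^sup>2 \<ge> 1"
      proof -
        have half: "sqrt z \<ge> 1/2" if "z \<ge> 1/2" for z :: real
          by (rule real_le_rsqrt) (use that in \<open>simp add: power2_eq_square\<close>)
        have "sqrt (1-x) \<ge> 1/2" "sqrt (1-y) \<ge> 1/2"
          using x y half[of "1-x"] half[of "1-y"] by linarith+
        then have "(1::real)\<^sup>2 \<le> (sqrt (1-x) + sqrt (1-y))\<^sup>2" by (intro power_mono) auto
        then show ?thesis by simp
      qed
      have yx: "y - x = - (x * \<rho>)" by (simp add: y_def algebra_simps)
      have "(sqrt (1-x) - sqrt (1-y)) * (sqrt (1-x) + sqrt (1-y)) = y - x"
      proof -
        have "(A - B) * (A + B) = A\<^sup>2 - B\<^sup>2" for A B :: real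
          by (simp add: power2_eq_square algebra_simps)
        then show ?thesis using x y by simp
      qed
      then have "(sqrt (1-x) - sqrt (1-y))\<^sup>2 * (sqrt (1-x) + sqrt (1-y))\<^sup>2 = (x*\<rho>)\<^sup>2"
        unfolding power_mult_distrib[symmetric] using yx by (simp only: power2_minus)
      moreover have "(sqrt (1-x) - sqrt (1-y))\<^sup>2 * 1 \<le> (sqrt (1-x) - sqrt (1-y))\<^sup>2 * (sqrt (1-x) + sqrt (1-y))\<^sup>2"
        using p by (intro mult_left_mono) auto
      ultimately have "(sqrt (1-x) - sqrt (1-y))\<^sup>2 \<le> x * (x * \<rho>\<^sup>2)"
        by (simp add: power2_eq_square mult_ac)
      also have "\<dots> \<le> 1 * (x * \<rho>\<^sup>2)" using x by (intro mult_right_mono) auto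
      finally show ?thesis by simp
    qed
    have "bc e = sqrt (x * y) + sqrt ((1-x) * (1-y))"
      using eqS[OF that] by (simp add: bc_def x_def y_def)
    moreover have "b \<ge> 1 - K" if "b = s + s'" "s = (x + y - u) / 2" "s' = ((1-x) + (1-y) - u') / 2"
        "u \<le> K" "u' \<le> K" for b s s' u u' K :: real
      using that by (simp add: field_simps)
    ultimately have "bc e \<ge> 1 - x * \<rho>\<^sup>2" using h1 h2 d1 d2 by blast
    moreover have "x * \<rho>\<^sup>2 \<le> a * \<rho>\<^sup>2" using x by (intro mult_right_mono) auto
    moreover have "bc e \<ge> 0" unfolding bc_def using q[OF eD] q'[OF eD] by simp
    ultimately show ?thesis by auto
  qed
  have BClow: "(\<Prod>e\<in>D. bc e) \<ge> 1 - real (card S) * (a * \<rho>\<^sup>2)"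
  proof -
    have "(\<Prod>e\<in>D. bc e) = (\<Prod>e\<in>S. bc e)"
      using SD fin bc1 by (intro prod.mono_neutral_right) auto
    moreover have "(\<Prod>e\<in>S. bc e) \<ge> 1 - real (card S) * (a * \<rho>\<^sup>2)"
    proof (cases "S = {}")
      case False
      then obtain e where "e \<in> S" by auto
      then have a0: "0 \<le> a" using q[of e] qS[of e] SD by force
      have ar: "a * \<rho>\<^sup>2 \<le> 1" using rho a a0 by (intro mult_le_one) (auto simp: power_le_one)
      have "1 + real (card S) * (- (a * \<rho>\<^sup>2)) \<le> (1 + (- (a * \<rho>\<^sup>2))) ^ card S"
        using ar by (intro Bernoulli_inequality) auto
      also have "\<dots> = (\<Prod>e\<in>S. 1 - a * \<rho>\<^sup>2)" by simp
      also have "\<dots> \<le> (\<Prod>e\<in>S. bc e)" using bcS ar by (intro prod_mono) auto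
      finally show ?thesis by simp
    qed simp
    ultimately show ?thesis by simp
  qed
  have su: "(\<Sum>E\<in>?P. (u E)\<^sup>2) = 1" "(\<Sum>E\<in>?P. (w E)\<^sup>2) = 1"
    using sum_bern_weight[OF fin] by (auto simp: uw)
  have A1: "(\<Sum>E\<in>?P. (u E - w E)\<^sup>2) \<le> 2 * (real (card S) * (a * \<rho>\<^sup>2))"
    using BC BClow su by (simp add: power2_diff sum.distrib sum_subtractf sum_distrib_left[symmetric] mult.assoc)
  have A2: "(\<Sum>E\<in>?P. (u E + w E)\<^sup>2) \<le> 4"
  proof -
    have "(\<Sum>E\<in>?P. (u E + w E)\<^sup>2) \<le> (\<Sum>E\<in>?P. 2 * (u E)\<^sup>2 + 2 * (w E)\<^sup>2)"
    proof (intro sum_mono)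
      fix E show "(u E + w E)\<^sup>2 \<le> 2 * (u E)\<^sup>2 + 2 * (w E)\<^sup>2"
        using zero_le_power2[of "u E - w E"] by (simp add: power2_sum power2_diff)
    qed
    also have "\<dots> = 4" using su by (simp add: sum.distrib sum_distrib_left[symmetric])
    finally show ?thesis .
  qed
  have A0: "0 \<le> 2 * (real (card S) * (a * \<rho>\<^sup>2))"
    by (rule order_trans[OF sum_nonneg A1]) simp
  have "(\<Sum>E\<in>?P. \<bar>u E - w E\<bar> * (u E + w E))\<^sup>2 \<le> (\<Sum>E\<in>?P. \<bar>u E - w E\<bar>\<^sup>2) * (\<Sum>E\<in>?P. (u E + w E)\<^sup>2)"
    by (rule Cauchy_Schwarz_ineq_sum)
  also have "\<dots> \<le> (2 * (real (card S) * (a * \<rho>\<^sup>2))) * 4"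
    using A1 A2 A0 by (intro mult_mono sum_nonneg) auto
  finally have "(\<Sum>E\<in>?P. \<bar>u E - w E\<bar> * (u E + w E)) \<le> sqrt ((2 * (real (card S) * (a * \<rho>\<^sup>2))) * 4)"
    by (rule real_le_rsqrt)
  also have "(2 * (real (card S) * (a * \<rho>\<^sup>2))) * 4 = \<rho>\<^sup>2 * (8 * real (card S) * a)" by simp
  also have "sqrt \<dots> = \<rho> * sqrt (8 * real (card S) * a)" using rho by (simp only: real_sqrt_mult real_sqrt_abs abs_of_nonneg)
  finally have TV: "(\<Sum>E\<in>?P. \<bar>u E - w E\<bar> * (u E + w E)) \<le> \<rho> * sqrt (8 * real (card S) * a)" .
  have "bern_ex D q h - bern_ex D q' h = (\<Sum>E\<in>?P. (bern_weight D q E - bern_weight D q' E) * h E)"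
    by (simp add: bern_ex_def sum_subtractf algebra_simps)
  also have "\<dots> \<le> (\<Sum>E\<in>?P. \<bar>u E - w E\<bar> * (u E + w E) * M)"
  proof (intro sum_mono)
    fix E assume "E \<in> ?P"
    then have hE: "0 \<le> h E" "h E \<le> M" using h by auto
    have "(bern_weight D q E - bern_weight D q' E) = (u E - w E) * (u E + w E)"
      by (simp add: uw(1,2)[symmetric] power2_eq_square algebra_simps)
    also have "\<dots> \<le> \<bar>u E - w E\<bar> * (u E + w E)" using uw by (intro mult_right_mono) auto
    finally have "(bern_weight D q E - bern_weight D q' E) * h E \<le> \<bar>u E - w E\<bar> * (u E + w E) * h E"
      using hE by (intro mult_right_mono)
    also have "\<dots> \<le> \<bar>u E - w E\<bar> * (u E + w E) * M"
      using hE uw by (intro mult_left_mono) auto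
    finally show "(bern_weight D q E - bern_weight D q' E) * h E \<le> \<dots>" .
  qed
  also have "\<dots> \<le> M * (\<rho> * sqrt (8 * real (card S) * a))"
    unfolding sum_distrib_right[symmetric] using TV M by (simp add: mult.commute mult_left_mono)
  finally show ?thesis by simp
qed

section \<open>Resampling\<close>

text \<open>
  The conditional probability that \<open>e\<close> belongs to the new set when, starting from \<open>E\<close>, each element
  \<open>e\<close> is redrawn from the Bernoulli law of parameter \<open>p\<close> with probability \<open>s e\<close>, and kept otherwise.
\<close>

definition resampled :: "real \<Rightarrow> ('e \<Rightarrow> real) \<Rightarrow> 'e set \<Rightarrow> 'e \<Rightarrow> real" where
  "resampled p s E e = s e * p + (1 - s e) * of_bool (e \<in> E)"

lemma resampled_range:
  assumes "0 \<le> p" "p \<le> 1" "0 \<le> s e" "s e \<le> 1"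
  shows "0 \<le> resampled p s E e \<and> resampled p s E e \<le> 1"
proof -
  have "s e * p \<le> s e" using assms by (simp add: mult_left_le)
  moreover have "0 \<le> s e * p" using assms by simp
  ultimately show ?thesis using assms unfolding resampled_def by (cases "e \<in> E") auto
qed

text \<open>
  The pair of old and new set is exchangeable if the old set has constant parameter \<open>p\<close>.
\<close>

lemma resampled_reversible:
  "bern_ex D (\<lambda>_. p) (\<lambda>E. bern_ex D (resampled p s E) (h E)) = bern_ex D (\<lambda>_. p) (\<lambda>E. bern_ex D (resampled p s E) (\<lambda>E'. h E' E))"
proof -
  have sym: "bern_weight D (\<lambda>_. p) E * bern_weight D (resampled p s E) E' = bern_weight D (\<lambda>_. p) E' * bern_weight D (resampled p s E') E" for E E'
    unfolding bern_weight_def prod.distrib[symmetric]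
    by (intro prod.cong) (auto simp: resampled_def algebra_simps)
  have "bern_ex D (\<lambda>_. p) (\<lambda>E. bern_ex D (resampled p s E) (h E))
      = (\<Sum>E\<in>Pow D. \<Sum>E'\<in>Pow D. bern_weight D (\<lambda>_. p) E * bern_weight D (resampled p s E) E' * h E E')"
    by (simp add: bern_ex_def sum_distrib_left mult.assoc)
  also have "\<dots> = (\<Sum>E'\<in>Pow D. \<Sum>E\<in>Pow D. bern_weight D (\<lambda>_. p) E' * bern_weight D (resampled p s E') E * h E E')"
    by (subst sum.swap) (simp add: sym)
  also have "\<dots> = bern_ex D (\<lambda>_. p) (\<lambda>E. bern_ex D (resampled p s E) (\<lambda>E'. h E' E))"
    by (simp add: bern_ex_def sum_distrib_left mult.assoc)
  finally show ?thesis .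
qed

lemma resampled_invariant:
  assumes "finite D"
  shows "bern_ex D (\<lambda>_. p) (\<lambda>E. bern_ex D (resampled p s E) h) = bern_ex D (\<lambda>_. p) h"
  by (subst resampled_reversible) (simp add: bern_ex_const[OF assms])

section \<open>Concentration of weighted sums\<close>

lemma exp_le_quadratic:
  fixes x :: real
  assumes "\<bar>x\<bar> \<le> 1"
  shows "exp x \<le> 1 + x + x\<^sup>2"
proof (cases "x \<ge> 0")
  case True
  then show ?thesis using assms exp_bound[of x] by auto
next
  case False
  define y where "y = - x"
  have y: "0 \<le> y" "y \<le> 1" using False assms by (auto simp: y_def)
  have "1 + y \<le> exp y" by (rule exp_ge_add_one_self)
  have "1 \<le> (1 - y + y\<^sup>2) * (1 + y)"
    using y by (simp add: algebra_simps power2_eq_square)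
  also have "\<dots> \<le> (1 - y + y\<^sup>2) * exp y"
    using y by (intro mult_left_mono exp_ge_add_one_self) auto
  finally have "1 / exp y \<le> 1 - y + y\<^sup>2"
    by (simp add: divide_le_eq)
  then show ?thesis by (simp add: y_def exp_minus field_simps)
qed

lemma bern_ex_exp_deviation:
  assumes fin: "finite D" and p: "0 \<le> p" "p \<le> 1" and x: "\<And>e. e \<in> D \<Longrightarrow> \<bar>x e\<bar> \<le> 1"
  shows "bern_ex D (\<lambda>_. p) (\<lambda>E. exp (\<Sum>e\<in>D. x e * (of_bool (e \<in> E) - p))) \<le> exp (p * (\<Sum>e\<in>D. (x e)\<^sup>2))"
proof -
  have "bern_ex D (\<lambda>_. p) (\<lambda>E. exp (\<Sum>e\<in>D. x e * (of_bool (e \<in> E) - p)))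
      = (\<Prod>e\<in>D. p * exp (x e * (1 - p)) + (1 - p) * exp (x e * (0 - p)))"
    unfolding exp_sum[OF fin]
    using bern_ex_prod[OF fin, of "\<lambda>_. p" "\<lambda>e b. exp (x e * (of_bool b - p))"] by simp
  also have "\<dots> \<le> (\<Prod>e\<in>D. exp (p * (x e)\<^sup>2))"
  proof (intro prod_mono conjI)
    fix e assume "e \<in> D"
    show "0 \<le> p * exp (x e * (1 - p)) + (1 - p) * exp (x e * (0 - p))"
      using p by (intro add_nonneg_nonneg) auto
    have "p * exp (x e * (1 - p)) + (1 - p) * exp (x e * (0 - p))
        = exp (- (p * x e)) * (1 + p * (exp (x e) - 1))"
      by (simp add: algebra_simps exp_diff exp_minus divide_simps)
    also have "\<dots> \<le> exp (- (p * x e)) * exp (p * (exp (x e) - 1))"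
      by (intro mult_left_mono exp_ge_add_one_self) auto
    also have "\<dots> = exp (p * (exp (x e) - 1 - x e))"
      by (simp add: exp_add[symmetric] algebra_simps)
    also have "\<dots> \<le> exp (p * (x e)\<^sup>2)"
      using exp_le_quadratic[OF x[OF \<open>e \<in> D\<close>]] p by (simp add: mult_left_mono)
    finally show "p * exp (x e * (1 - p)) + (1 - p) * exp (x e * (0 - p)) \<le> exp (p * (x e)\<^sup>2)" .
  qed
  also have "\<dots> = exp (p * (\<Sum>e\<in>D. (x e)\<^sup>2))"
    by (simp add: exp_sum[OF fin] sum_distrib_left)
  finally show ?thesis .
qed

text \<open>
  The centred weighted number of elements of \<open>E\<close>, with weights \<open>w\<close>.
\<close>

definition deviation :: "'e set \<Rightarrow> real \<Rightarrow> ('e \<Rightarrow> real) \<Rightarrow> 'e set \<Rightarrow> real" where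
  "deviation D p w E = (\<Sum>e\<in>D. w e * (of_bool (e \<in> E) - p))"

lemma bern_ex_exp_abs_deviation:
  assumes fin: "finite D" and p: "0 \<le> p" "p \<le> 1" and \<theta>: "\<theta> \<ge> 0"
    and w: "\<And>i e. i \<in> I \<Longrightarrow> e \<in> D \<Longrightarrow> \<bar>\<theta> * w i e\<bar> \<le> 1"
    and b: "\<And>i. i \<in> I \<Longrightarrow> p * (\<Sum>e\<in>D. (\<theta> * w i e)\<^sup>2) \<le> b"
  shows "bern_ex D (\<lambda>_. p) (\<lambda>E. \<Sum>i\<in>I. exp (\<theta> * \<bar>deviation D p (w i) E\<bar>)) \<le> 2 * real (card I) * exp b"
proof -
  have "bern_ex D (\<lambda>_. p) (\<lambda>E. exp (\<theta> * \<bar>deviation D p (w i) E\<bar>)) \<le> 2 * exp b" if i: "i \<in> I" for i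
  proof -
    have "bern_ex D (\<lambda>_. p) (\<lambda>E. exp (\<theta> * \<bar>deviation D p (w i) E\<bar>))
       \<le> bern_ex D (\<lambda>_. p) (\<lambda>E. exp (\<Sum>e\<in>D. (\<theta> * w i e) * (of_bool (e \<in> E) - p))
              + exp (\<Sum>e\<in>D. (- (\<theta> * w i e)) * (of_bool (e \<in> E) - p)))"
    proof (intro bern_ex_mono)
      fix E
      have "(\<Sum>e\<in>D. (\<theta> * w i e) * (of_bool (e \<in> E) - p)) = \<theta> * deviation D p (w i) E"
        "(\<Sum>e\<in>D. (- (\<theta> * w i e)) * (of_bool (e \<in> E) - p)) = - (\<theta> * deviation D p (w i) E)"
        by (simp_all add: deviation_def sum_distrib_left sum_negf mult.assoc)
      then show "exp (\<theta> * \<bar>deviation D p (w i) E\<bar>) \<le> exp (\<Sum>e\<in>D. (\<theta> * w i e) * (of_bool (e \<in> E) - p))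
              + exp (\<Sum>e\<in>D. (- (\<theta> * w i e)) * (of_bool (e \<in> E) - p))"
        by (cases "deviation D p (w i) E \<ge> 0") (auto simp: add_increasing add_increasing2)
    qed (use p in auto)
    also have "\<dots> \<le> exp b + exp b"
    proof (subst bern_ex_add, intro add_mono)
      have "bern_ex D (\<lambda>_. p) (\<lambda>E. exp (\<Sum>e\<in>D. (\<theta> * w i e) * (of_bool (e \<in> E) - p))) \<le> exp (p * (\<Sum>e\<in>D. (\<theta> * w i e)\<^sup>2))"
        using fin p w[OF i] by (intro bern_ex_exp_deviation) auto
      then show "bern_ex D (\<lambda>_. p) (\<lambda>E. exp (\<Sum>e\<in>D. (\<theta> * w i e) * (of_bool (e \<in> E) - p))) \<le> exp b"
        using b[OF i] by (meson exp_le_cancel_iff order_trans)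
      have "bern_ex D (\<lambda>_. p) (\<lambda>E. exp (\<Sum>e\<in>D. (- (\<theta> * w i e)) * (of_bool (e \<in> E) - p))) \<le> exp (p * (\<Sum>e\<in>D. (- (\<theta> * w i e))\<^sup>2))"
        using fin p w[OF i] by (intro bern_ex_exp_deviation) auto
      then show "bern_ex D (\<lambda>_. p) (\<lambda>E. exp (\<Sum>e\<in>D. (- (\<theta> * w i e)) * (of_bool (e \<in> E) - p))) \<le> exp b"
        using b[OF i] by (simp only: power2_minus) (meson exp_le_cancel_iff order_trans)
    qed
    finally show ?thesis by simp
  qed
  then have "(\<Sum>i\<in>I. bern_ex D (\<lambda>_. p) (\<lambda>E. exp (\<theta> * \<bar>deviation D p (w i) E\<bar>))) \<le> (\<Sum>i\<in>I. 2 * exp b)"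
    by (intro sum_mono)
  then show ?thesis by (simp add: bern_ex_sum mult_ac)
qed

lemma deviation_tail:
  assumes fin: "finite D" "finite I" and p: "0 \<le> p" "p \<le> 1" and \<theta>: "\<theta> \<ge> 0"
    and w: "\<And>i e. i \<in> I \<Longrightarrow> e \<in> D \<Longrightarrow> \<bar>\<theta> * w i e\<bar> \<le> 1"
    and b: "\<And>i. i \<in> I \<Longrightarrow> p * (\<Sum>e\<in>D. (\<theta> * w i e)\<^sup>2) \<le> b"
  shows "bern_ex D (\<lambda>_. p) (\<lambda>E. of_bool (\<exists>i\<in>I. \<bar>deviation D p (w i) E\<bar> \<ge> t))
           \<le> 2 * real (card I) * exp (b - \<theta> * t)"
proof -
  have "bern_ex D (\<lambda>_. p) (\<lambda>E. of_bool (\<exists>i\<in>I. \<bar>deviation D p (w i) E\<bar> \<ge> t))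
     \<le> bern_ex D (\<lambda>_. p) (\<lambda>E. exp (- (\<theta> * t)) * (\<Sum>i\<in>I. exp (\<theta> * \<bar>deviation D p (w i) E\<bar>)))"
  proof (intro bern_ex_mono)
    fix E
    show "of_bool (\<exists>i\<in>I. \<bar>deviation D p (w i) E\<bar> \<ge> t)
        \<le> exp (- (\<theta> * t)) * (\<Sum>i\<in>I. exp (\<theta> * \<bar>deviation D p (w i) E\<bar>))"
    proof (cases "\<exists>i\<in>I. \<bar>deviation D p (w i) E\<bar> \<ge> t")
      case True
      then obtain i where i: "i \<in> I" "\<bar>deviation D p (w i) E\<bar> \<ge> t" by auto
      have "1 = exp (- (\<theta> * t)) * exp (\<theta> * t)" by (simp add: exp_minus)
      also have "\<dots> \<le> exp (- (\<theta> * t)) * exp (\<theta> * \<bar>deviation D p (w i) E\<bar>)"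
        using i \<theta> by (intro mult_left_mono) (auto intro: mult_left_mono)
      also have "\<dots> \<le> exp (- (\<theta> * t)) * (\<Sum>i\<in>I. exp (\<theta> * \<bar>deviation D p (w i) E\<bar>))"
        using i fin by (intro mult_left_mono member_le_sum) auto
      finally show ?thesis using True by simp
    next
      case False
      then show ?thesis by (auto intro!: mult_nonneg_nonneg sum_nonneg)
    qed
  qed (use p in auto)
  also have "\<dots> = exp (- (\<theta> * t)) * bern_ex D (\<lambda>_. p) (\<lambda>E. \<Sum>i\<in>I. exp (\<theta> * \<bar>deviation D p (w i) E\<bar>))"
    by (rule bern_ex_cmult)
  also have "\<dots> \<le> exp (- (\<theta> * t)) * (2 * real (card I) * exp b)"
    using assms by (intro mult_left_mono bern_ex_exp_abs_deviation) auto
  finally show ?thesis by (simp add: exp_diff exp_minus field_simps)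
qed

text \<open>
  Since \<open>1 + u \<le> exp u\<close>, a bound \<open>exp y\<close> on the expectation of \<open>exp (\<theta> M)\<close> bounds the
  expectation of \<open>\<theta> M\<close> by \<open>y\<close>.
\<close>

lemma deviation_expectation:
  assumes fin: "finite D" "finite I" "I \<noteq> {}" and p: "0 \<le> p" "p \<le> 1" and \<theta>: "\<theta> > 0"
    and w: "\<And>i e. i \<in> I \<Longrightarrow> e \<in> D \<Longrightarrow> \<bar>\<theta> * w i e\<bar> \<le> 1"
    and b: "\<And>i. i \<in> I \<Longrightarrow> p * (\<Sum>e\<in>D. (\<theta> * w i e)\<^sup>2) \<le> b"
  shows "bern_ex D (\<lambda>_. p) (\<lambda>E. Max ((\<lambda>i. \<bar>deviation D p (w i) E\<bar>) ` I)) \<le> (ln (2 * real (card I)) + b) / \<theta>"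
proof -
  define y where "y = ln (2 * real (card I)) + b"
  have cI: "card I > 0" using fin by (simp add: card_gt_0_iff)
  have ey: "exp y = 2 * real (card I) * exp b" using cI by (simp add: y_def exp_add)
  have "\<theta> * bern_ex D (\<lambda>_. p) (\<lambda>E. Max ((\<lambda>i. \<bar>deviation D p (w i) E\<bar>) ` I))
      \<le> bern_ex D (\<lambda>_. p) (\<lambda>E. (y - 1) + exp (- y) * (\<Sum>i\<in>I. exp (\<theta> * \<bar>deviation D p (w i) E\<bar>)))"
    unfolding bern_ex_cmult[symmetric]
  proof (intro bern_ex_mono)
    fix E
    define M where "M = Max ((\<lambda>i. \<bar>deviation D p (w i) E\<bar>) ` I)"
    have "M \<in> (\<lambda>i. \<bar>deviation D p (w i) E\<bar>) ` I" unfolding M_def using fin by (intro Max_in) auto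
    then obtain i where i: "i \<in> I" "M = \<bar>deviation D p (w i) E\<bar>" by auto
    have "1 + (\<theta> * M - y) \<le> exp (\<theta> * M - y)" by (rule exp_ge_add_one_self)
    also have "\<dots> = exp (- y) * exp (\<theta> * \<bar>deviation D p (w i) E\<bar>)"
      by (simp add: i exp_add[symmetric])
    also have "\<dots> \<le> exp (- y) * (\<Sum>i\<in>I. exp (\<theta> * \<bar>deviation D p (w i) E\<bar>))"
      using i fin by (intro mult_left_mono member_le_sum) auto
    finally show "\<theta> * Max ((\<lambda>i. \<bar>deviation D p (w i) E\<bar>) ` I)
        \<le> (y - 1) + exp (- y) * (\<Sum>i\<in>I. exp (\<theta> * \<bar>deviation D p (w i) E\<bar>))"
      by (simp add: M_def)
  qed (use p in auto)
  also have "\<dots> = (y - 1) + exp (- y) * bern_ex D (\<lambda>_. p) (\<lambda>E. \<Sum>i\<in>I. exp (\<theta> * \<bar>deviation D p (w i) E\<bar>))"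
    by (simp add: bern_ex_add bern_ex_const[OF fin(1)] bern_ex_cmult)
  also have "\<dots> \<le> (y - 1) + exp (- y) * exp y"
    unfolding ey using assms by (intro add_left_mono mult_left_mono bern_ex_exp_abs_deviation) auto
  also have "\<dots> = y" by (simp add: exp_minus)
  finally show ?thesis using \<theta> by (simp add: y_def pos_le_divide_eq mult.commute)
qed

section \<open>Anticoncentration of sums of independent indicators\<close>

lemma cos_upper_bound:
  fixes x :: real
  assumes "\<bar>x\<bar> \<le> 1"
  shows "1 - cos x \<ge> x\<^sup>2 / 4"
proof -
  have main: "1 - cos x \<ge> x\<^sup>2 / 4" if x: "0 < x" "x \<le> 1" for x :: real
  proof -
    obtain t where t: "0 < t" "t < x"
      "cos x = (\<Sum>m<2. cos_coeff m * x ^ m) + cos (t + 1/2 * real 2 * pi) / fact 2 * x ^ 2"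
      using Maclaurin_cos_expansion2[of x 2] x by auto
    have "cos t \<ge> 1/2"
      using t x cos_monotone_0_pi_le[of t "pi/3"] pi_gt3 by (simp add: cos_60)
    then have "cos t * x\<^sup>2 \<ge> 1/2 * x\<^sup>2" by (intro mult_right_mono) auto
    moreover have "cos x = 1 - cos t / 2 * x\<^sup>2"
      using t(3) by (simp add: lessThan_nat_numeral cos_coeff_def)
    ultimately show ?thesis by simp
  qed
  consider "x = 0" | "0 < x" | "x < 0" by linarith
  then show ?thesis
    using main[of x] main[of "-x"] assms by cases auto
qed

text \<open>
  The characteristic function of a Bernoulli variable of parameter \<open>q\<close>.
\<close>

lemma norm_bernoulli_char:
  assumes "0 \<le> q" "q \<le> (1::real)" "\<bar>x\<bar> \<le> 1"
  shows "norm (complex_of_real q * cis x + complex_of_real (1 - q)) \<le> exp (- (q * (1 - q) * x\<^sup>2 / 4))"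
proof -
  have "(norm (complex_of_real q * cis x + complex_of_real (1 - q)))\<^sup>2
      = (q * cos x + (1 - q))\<^sup>2 + (q * sin x)\<^sup>2"
    by (simp add: cmod_power2)
  also have "\<dots> = 1 - 2 * q * (1 - q) * (1 - cos x)"
  proof -
    have "(q * sin x)\<^sup>2 = q\<^sup>2 * (1 - (cos x)\<^sup>2)" by (simp add: power_mult_distrib sin_squared_eq)
    then show ?thesis by (simp add: power2_eq_square algebra_simps)
  qed
  also have "\<dots> \<le> 1 - 2 * q * (1 - q) * (x\<^sup>2 / 4)"
    using assms cos_upper_bound[of x] by (intro diff_left_mono mult_left_mono) auto
  also have "\<dots> \<le> exp (- (2 * q * (1 - q) * (x\<^sup>2 / 4)))"
    using exp_ge_add_one_self[of "- (2 * q * (1 - q) * (x\<^sup>2 / 4))"] by simp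
  also have "\<dots> = (exp (- (q * (1 - q) * x\<^sup>2 / 4)))\<^sup>2"
    by (simp add: power2_eq_square exp_add[symmetric])
  finally show ?thesis by (rule power2_le_imp_le) auto
qed

lemma cis_sum: "cis (\<Sum>x\<in>A. f x) = (\<Prod>x\<in>A. cis (f x))"
  by (induction A rule: infinite_finite_induct) (auto simp: cis_mult[symmetric])

text \<open>
  A signed sum \<open>Z\<close> of independent indicators of total variance at least \<open>v \<ge> 1\<close>, shifted by an arbitrary
  constant, has mean absolute value at least \<open>sqrt v / 5\<close>. This follows from
  \<open>\<bar>t Z\<bar> \<ge> 1 - cos (t Z)\<close>, as the expectation of \<open>cos (t Z)\<close> is at most the modulus of a product of
  characteristic functions; so the means of the summands play no role.
\<close>

lemma bern_ex_abs_lower: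
  fixes a :: "'e \<Rightarrow> real"
  assumes fin: "finite D" and q: "\<And>e. e \<in> D \<Longrightarrow> 0 \<le> q e \<and> q e \<le> 1"
    and YD: "Y \<subseteq> D" and a: "\<And>e. e \<in> D \<Longrightarrow> \<bar>a e\<bar> = of_bool (e \<in> Y)"
    and v: "v \<ge> 1" "v \<le> (\<Sum>e\<in>Y. q e * (1 - q e))"
  shows "sqrt v / 5 \<le> bern_ex D q (\<lambda>E. \<bar>(\<Sum>e\<in>D. a e * of_bool (e \<in> E)) + z\<bar>)"
proof -
  define t where "t = 1 / sqrt v"
  have t: "0 < t" "t \<le> 1" "t\<^sup>2 * v = 1" using v by (auto simp: t_def power_divide)
  define S where "S E = (\<Sum>e\<in>D. a e * of_bool (e \<in> E)) + z" for E
  define \<Phi> where "\<Phi> = (\<Sum>E\<in>Pow D. complex_of_real (bern_weight D q E) * cis (t * S E))"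
  have "\<Phi> = cis (t * z) * (\<Prod>e\<in>D. complex_of_real (q e) * cis (t * a e) + complex_of_real (1 - q e))"
  proof -
    have "complex_of_real (bern_weight D q E) * cis (t * S E)
        = cis (t * z) * ((\<Prod>e\<in>E. complex_of_real (q e) * cis (t * a e)) * (\<Prod>e\<in>D - E. complex_of_real (1 - q e)))"
      if "E \<subseteq> D" for E
    proof -
      have DE: "D \<inter> E = E" "D \<inter> - E = D - E" using that by auto
      have "S E = sum a E + z" unfolding S_def using fin that
        by (simp add: sum.If_cases of_bool_def if_distrib DE Int_absorb1 cong: if_cong)
      then have "cis (t * S E) = cis (t * z) * (\<Prod>e\<in>E. cis (t * a e))"
        by (simp add: distrib_left cis_mult[symmetric] sum_distrib_left cis_sum)
      moreover have "bern_weight D q E = (\<Prod>e\<in>E. q e) * (\<Prod>e\<in>D - E. 1 - q e)"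
        unfolding bern_weight_def using fin by (simp add: prod.If_cases DE)
      ultimately show ?thesis by (simp add: prod.distrib mult_ac)
    qed
    then have "\<Phi> = cis (t * z) * (\<Sum>E\<in>Pow D. (\<Prod>e\<in>E. complex_of_real (q e) * cis (t * a e)) * (\<Prod>e\<in>D - E. complex_of_real (1 - q e)))"
      unfolding \<Phi>_def sum_distrib_left by (intro sum.cong) auto
    then show ?thesis using prod_add[OF fin] by metis
  qed
  then have "norm \<Phi> = (\<Prod>e\<in>D. norm (complex_of_real (q e) * cis (t * a e) + complex_of_real (1 - q e)))"
    by (simp add: norm_mult prod_norm)
  also have "\<dots> \<le> (\<Prod>e\<in>D. exp (- (q e * (1 - q e) * (t * a e)\<^sup>2 / 4)))"
  proof (intro prod_mono conjI norm_bernoulli_char)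
    fix e assume "e \<in> D"
    then show "\<bar>t * a e\<bar> \<le> 1" using t a[of e] by (auto simp: abs_mult)
  qed (use q in auto)
  also have "\<dots> = exp (\<Sum>e\<in>D. - (q e * (1 - q e) * (t * a e)\<^sup>2 / 4))"
    by (simp add: exp_sum[OF fin])
  also have "(\<Sum>e\<in>D. - (q e * (1 - q e) * (t * a e)\<^sup>2 / 4)) = (\<Sum>e\<in>Y. - (q e * (1 - q e) * t\<^sup>2 / 4))"
  proof (rule sum.mono_neutral_cong_right[OF fin YD])
    have a2: "(a e)\<^sup>2 = of_bool (e \<in> Y)" if "e \<in> D" for e
      using a[OF that] power2_abs[of "a e"] by (cases "e \<in> Y") auto
    show "\<forall>i\<in>D - Y. - (q i * (1 - q i) * (t * a i)\<^sup>2 / 4) = 0"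
      using a2 by (auto simp: power_mult_distrib)
    show "- (q x * (1 - q x) * (t * a x)\<^sup>2 / 4) = - (q x * (1 - q x) * t\<^sup>2 / 4)" if "x \<in> Y" for x
      using a2[of x] that YD by (auto simp: power_mult_distrib)
  qed
  also have "\<dots> = - (t\<^sup>2 * (\<Sum>e\<in>Y. q e * (1 - q e)) / 4)"
    by (simp add: sum_distrib_left sum_negf sum_divide_distrib mult_ac)
  also have "\<dots> \<le> - (t\<^sup>2 * v / 4)" using v by (simp add: mult_left_mono)
  also have "\<dots> = - (1/4)" using t by simp
  finally have "norm \<Phi> \<le> exp (- (1/4))" by simp
  also have "\<dots> \<le> 4/5"
    using exp_ge_add_one_self[of "1/4"] by (simp add: exp_minus field_simps)
  finally have n\<Phi>: "norm \<Phi> \<le> 4/5" .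
  have "Re \<Phi> = bern_ex D q (\<lambda>E. cos (t * S E))" by (simp add: \<Phi>_def bern_ex_def)
  then have "bern_ex D q (\<lambda>E. cos (t * S E)) \<le> 4/5"
    using n\<Phi> complex_Re_le_cmod[of \<Phi>] by simp
  then have "1/5 \<le> bern_ex D q (\<lambda>E. 1 - cos (t * S E))"
    by (simp add: bern_ex_diff bern_ex_const[OF fin])
  also have "\<dots> \<le> bern_ex D q (\<lambda>E. t * \<bar>S E\<bar>)"
  proof (intro bern_ex_mono q)
    fix E
    define y where "y = t * S E"
    have "1 - cos y = 2 * (sin (y/2))\<^sup>2" using cos_double_sin[of "y/2"] by simp
    also have "\<dots> = 2 * (\<bar>sin (y/2)\<bar> * \<bar>sin (y/2)\<bar>)" by (simp add: power2_eq_square abs_mult[symmetric])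
    also have "\<dots> \<le> 2 * (\<bar>y/2\<bar> * 1)"
      by (intro mult_left_mono mult_mono abs_sin_x_le_abs_x) auto
    finally show "1 - cos (t * S E) \<le> t * \<bar>S E\<bar>" using t by (simp add: y_def abs_mult)
  qed auto
  also have "\<dots> = t * bern_ex D q (\<lambda>E. \<bar>S E\<bar>)" by (rule bern_ex_cmult)
  finally have "1/5 \<le> t * bern_ex D q (\<lambda>E. \<bar>S E\<bar>)" .
  then show ?thesis using v by (simp add: t_def S_def field_simps)
qed

section \<open>Stability of near-maximizers in a set system\<close>

text \<open>
  A finite family of subsets \<open>A i\<close> of \<open>D\<close>. For cuts, \<open>D\<close> is the set of pairs of vertices, and
  \<open>A i\<close> is the set of pairs that the cut \<open>i\<close> separates.
\<close>

locale set_system =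
  fixes D :: "'e set" and I :: "'i set" and A :: "'i \<Rightarrow> 'e set"
  assumes finD: "finite D" and finI: "finite I" and I_ne: "I \<noteq> {}"
    and A_sub: "\<And>i. i \<in> I \<Longrightarrow> A i \<subseteq> D"
begin

text \<open>
  The analogue of the maximum size of a cut of \<open>E\<close>.
\<close>

definition max_size :: "'e set \<Rightarrow> nat" where
  "max_size E = Max ((\<lambda>i. card (E \<inter> A i)) ` I)"

text \<open>
  A fixed choice of a maximizer, as a function of \<open>E\<close> alone.
\<close>

definition opt :: "'e set \<Rightarrow> 'i" where
  "opt E = (SOME i. i \<in> I \<and> card (E \<inter> A i) = max_size E)"

text \<open>
  The index \<open>i\<close> has deficit at most \<open>d\<close>.
\<close>

definition near :: "real \<Rightarrow> 'e set \<Rightarrow> 'i \<Rightarrow> bool" where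
  "near d E i \<longleftrightarrow> i \<in> I \<and> real (max_size E) \<le> real (card (E \<inter> A i)) + d"

text \<open>
  The largest deviation of the number of elements of \<open>E\<close> in a member of the family from its mean.
\<close>

definition disc :: "real \<Rightarrow> 'e set \<Rightarrow> real" where
  "disc p E = Max ((\<lambda>i. \<bar>real (card (E \<inter> A i)) - p * real (card (A i))\<bar>) ` I)"

text \<open>
  Some index of deficit at most \<open>d\<close> differs from the chosen maximizer in at least \<open>m\<close> elements.
\<close>

definition far :: "real \<Rightarrow> real \<Rightarrow> 'e set \<Rightarrow> bool" where
  "far d m E \<longleftrightarrow> (\<exists>i. near d E i \<and> real (card (sym_diff (A i) (A (opt E)))) \<ge> m)"

lemma finA: "i \<in> I \<Longrightarrow> finite (A i)"
  using A_sub finD finite_subset by blast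

lemma max_size_ge: "i \<in> I \<Longrightarrow> card (E \<inter> A i) \<le> max_size E"
  unfolding max_size_def using finI by (intro Max_ge) auto

lemma opt: "opt E \<in> I \<and> card (E \<inter> A (opt E)) = max_size E"
proof -
  have "max_size E \<in> (\<lambda>i. card (E \<inter> A i)) ` I"
    unfolding max_size_def using finI I_ne by (intro Max_in) auto
  then obtain i where "i \<in> I \<and> card (E \<inter> A i) = max_size E" by auto
  then show ?thesis unfolding opt_def by (rule someI)
qed

lemma near_opt: "d \<ge> 0 \<Longrightarrow> near d E (opt E)"
  using opt[of E] by (simp add: near_def)

lemma near_mono: "near d E i \<Longrightarrow> d \<le> d' \<Longrightarrow> near d' E i"
  by (auto simp: near_def)

lemma disc_ge: "i \<in> I \<Longrightarrow> \<bar>real (card (E \<inter> A i)) - p * real (card (A i))\<bar> \<le> disc p E"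
  unfolding disc_def using finI by (intro Max_ge) auto

lemma disc_nonneg: "0 \<le> disc p E"
  using opt disc_ge by (meson abs_ge_zero order_trans)

lemma card_deviation:
  assumes "i \<in> I"
  shows "real (card (E \<inter> A i)) - p * real (card (A i)) = deviation D p (\<lambda>e. of_bool (e \<in> A i)) E"
proof -
  have "deviation D p (\<lambda>e. of_bool (e \<in> A i)) E = (\<Sum>e\<in>A i. of_bool (e \<in> E) - p)"
    unfolding deviation_def using A_sub[OF assms] finD
    by (intro sum.mono_neutral_cong_right) auto
  then show ?thesis using finA[OF assms] by (simp only: sum_subtractf card_Int_sum) simp
qed

lemma bern_ex_disc_le:
  assumes p: "0 < p" "p \<le> 1" and \<theta>: "0 < \<theta>" "\<theta> \<le> 1"
  shows "bern_ex D (\<lambda>_. p) (disc p) \<le> (ln (2 * real (card I)) + p * \<theta>\<^sup>2 * real (card D)) / \<theta>"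
proof -
  have "disc p = (\<lambda>E. Max ((\<lambda>i. \<bar>deviation D p (\<lambda>e. of_bool (e \<in> A i)) E\<bar>) ` I))"
    unfolding disc_def by (intro ext arg_cong[where f = Max] image_cong) (auto simp: card_deviation)
  then show ?thesis
  proof (simp only:, intro deviation_expectation)
    fix i assume i: "i \<in> I"
    have "(\<Sum>e\<in>D. (\<theta> * of_bool (e \<in> A i))\<^sup>2) \<le> (\<Sum>e\<in>D. \<theta>\<^sup>2)"
      by (intro sum_mono) (auto simp: power_mult_distrib)
    then show "p * (\<Sum>e\<in>D. (\<theta> * of_bool (e \<in> A i))\<^sup>2) \<le> p * \<theta>\<^sup>2 * real (card D)"
      using p by (simp add: mult.assoc mult.commute[of "\<theta>\<^sup>2"])
  qed (use finD finI I_ne p \<theta> in auto)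
qed

text \<open>
  Resampling every element with probability \<open>s\<close> leaves the expectation of the maximum unchanged. If
  \<open>far d m E\<close> holds, then resampling moves the sizes of two members of deficit at most \<open>d\<close> relative to
  each other by a sum of independent terms of standard deviation at least \<open>sqrt (s p c m / 2)\<close>, and the
  larger of the two beats the old maximum on average, up to the deficit \<open>d\<close> and the drift
  \<open>s * disc p E\<close> towards the mean.
\<close>

lemma macro_stability:
  assumes p: "0 \<le> p" "p \<le> 1 - c" and c: "0 < c" and s: "0 \<le> s" "s \<le> 1/2" and d: "d \<ge> 0"
    and m: "s * p * c * m / 2 \<ge> 1"
  shows "bern_ex D (\<lambda>_. p) (\<lambda>E. of_bool (far d m E)) * (sqrt (s * p * c * m / 2) / 5)
      \<le> 2 * d + 2 * s * bern_ex D (\<lambda>_. p) (disc p)"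
proof -
  define v where "v = s * p * c * m / 2"
  have v: "v \<ge> 1" using m by (simp add: v_def)
  have p1: "p \<le> 1" "c \<le> 1" using p c by auto
  define F where "F E = bern_ex D (resampled p (\<lambda>_. s) E)" for E
  have qr: "0 \<le> resampled p (\<lambda>_. s) E e \<and> resampled p (\<lambda>_. s) E e \<le> 1" for E :: "'e set" and e
    using p p1 s by (intro resampled_range) auto
  \<comment> \<open>The larger of two numbers is half of their sum plus half of their distance.\<close>
  have key: "of_bool (far d m E) * (sqrt v / 5) \<le> 2 * (F E (\<lambda>E'. real (max_size E')) - real (max_size E)) + 2 * s * disc p E + 2 * d"
    if ED: "E \<subseteq> D" for E
  proof -
    have "\<exists>Q. near d E Q \<and> (far d m E \<longrightarrow> real (card (sym_diff (A Q) (A (opt E)))) \<ge> m)"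
      using near_opt[OF d, of E] unfolding far_def by blast
    then obtain Q where Q: "near d E Q" "far d m E \<longrightarrow> real (card (sym_diff (A Q) (A (opt E)))) \<ge> m" by blast
    define P where "P = opt E"
    have PI: "P \<in> I" "card (E \<inter> A P) = max_size E" using opt[of E] by (auto simp: P_def)
    have QI: "Q \<in> I" "real (max_size E) \<le> real (card (E \<inter> A Q)) + d" using Q by (auto simp: near_def)
    define x where "x i E' = real (card (E' \<inter> A i)) - real (card (E \<inter> A i))" for i E'
    have Fx: "F E (x i) \<ge> - (s * disc p E)" if "i \<in> I" for i
    proof -
      have "F E (x i) = sum (resampled p (\<lambda>_. s) E) (A i) - real (card (E \<inter> A i))"
        unfolding F_def x_def using A_sub[OF that] finD by (simp add: bern_ex_diff bern_ex_card_Int bern_ex_const)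
      also have "sum (resampled p (\<lambda>_. s) E) (A i) = s * p * real (card (A i)) + (1 - s) * real (card (E \<inter> A i))"
        unfolding resampled_def card_Int_sum[OF finA[OF that]] by (simp add: sum.distrib sum_distrib_left del: sum_of_bool_eq)
      finally have "F E (x i) = - (s * (real (card (E \<inter> A i)) - p * real (card (A i))))"
        by (simp add: algebra_simps)
      moreover have "s * (real (card (E \<inter> A i)) - p * real (card (A i))) \<le> s * disc p E"
        using disc_ge[OF that, of E p] s by (intro mult_left_mono) auto
      ultimately show ?thesis by simp
    qed
    have Fabs: "of_bool (far d m E) * (sqrt v / 5) \<le> F E (\<lambda>E'. \<bar>x P E' - x Q E'\<bar>)"
    proof (cases "far d m E")
      case True
      define Y where "Y = sym_diff (A Q) (A P)"
      define a where "a e = of_bool (e \<in> A P) - (of_bool (e \<in> A Q) :: real)" for e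
      define z where "z = real (card (E \<inter> A Q)) - real (card (E \<inter> A P))"
      have Ysub: "Y \<subseteq> D" using A_sub PI QI by (auto simp: Y_def)
      have x: "x P E' - x Q E' = (\<Sum>e\<in>D. a e * of_bool (e \<in> E')) + z" for E'
      proof -
        have r: "real (card (E' \<inter> A i)) = (\<Sum>e\<in>D. of_bool (e \<in> A i) * of_bool (e \<in> E'))" if "i \<in> I" for i
          unfolding card_Int_sum[OF finA[OF that]] using A_sub[OF that] finD
          by (intro sum.mono_neutral_cong_left) auto
        show ?thesis unfolding x_def z_def r[OF PI(1)] r[OF QI(1)]
          by (simp add: a_def left_diff_distrib sum_subtractf)
      qed
      have "sqrt v / 5 \<le> bern_ex D (resampled p (\<lambda>_. s) E) (\<lambda>E'. \<bar>(\<Sum>e\<in>D. a e * of_bool (e \<in> E')) + z\<bar>)"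
      proof (rule bern_ex_abs_lower[OF finD qr Ysub])
        show "\<bar>a e\<bar> = of_bool (e \<in> Y)" for e by (auto simp: a_def Y_def)
        show "1 \<le> v" by fact
        have "resampled p (\<lambda>_. s) E e * (1 - resampled p (\<lambda>_. s) E e) \<ge> s * p * c / 2" for e
        proof -
          have cp: "c * p \<le> 1 - p" using p c p1 mult_left_le[of p c] by linarith
          have sp: "0 \<le> s * p" "s * p \<le> 1/2" "0 \<le> s * (1 - p)" "s * (1 - p) \<le> 1/2"
            using s p p1 mult_mono[of s "1/2" p 1] mult_mono[of s "1/2" "1-p" 1] by auto
          have e1: "s * p * c / 2 \<le> s * p * (1/2)"
            using mult_left_mono[of c 1 "s * p"] p1 sp by simp
          have e2: "s * p * c / 2 \<le> s * (1 - p) * (1/2)"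
            using mult_left_mono[OF cp s(1)] by (simp add: mult_ac)
          show ?thesis
          proof (cases "e \<in> E")
            case True
            have "s * (1 - p) * (1/2) \<le> s * (1 - p) * (1 - s * (1 - p))"
              using sp by (intro mult_left_mono) auto
            also have "\<dots> = resampled p (\<lambda>_. s) E e * (1 - resampled p (\<lambda>_. s) E e)"
              using True by (simp add: resampled_def algebra_simps)
            finally show ?thesis using e2 by linarith
          next
            case False
            have "s * p * (1/2) \<le> s * p * (1 - s * p)"
              using sp by (intro mult_left_mono) auto
            also have "\<dots> = resampled p (\<lambda>_. s) E e * (1 - resampled p (\<lambda>_. s) E e)"
              using False by (simp add: resampled_def)
            finally show ?thesis using e1 by linarith
          qed
        qed
        then have "(\<Sum>e\<in>Y. s * p * c / 2) \<le> (\<Sum>e\<in>Y. resampled p (\<lambda>_. s) E e * (1 - resampled p (\<lambda>_. s) E e))"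
          by (intro sum_mono)
        moreover have "v \<le> real (card Y) * (s * p * c / 2)"
        proof -
          have "m \<le> real (card Y)" using Q True by (simp add: Y_def P_def)
          moreover have "0 \<le> s * p * c / 2" using s p c by simp
          ultimately have "m * (s * p * c / 2) \<le> real (card Y) * (s * p * c / 2)" by (intro mult_right_mono)
          then show ?thesis by (simp add: v_def mult_ac)
        qed
        ultimately show "v \<le> (\<Sum>e\<in>Y. resampled p (\<lambda>_. s) E e * (1 - resampled p (\<lambda>_. s) E e))" by simp
      qed
      then show ?thesis using True by (simp add: F_def x)
    next
      case False
      have "0 \<le> F E (\<lambda>E'. \<bar>x P E' - x Q E'\<bar>)"
        unfolding F_def by (rule bern_ex_nonneg) (use qr in auto)
      then show ?thesis using False by simp
    qed
    have "F E (\<lambda>E'. x P E' + x Q E' + \<bar>x P E' - x Q E'\<bar> - 2 * d) \<le> F E (\<lambda>E'. 2 * (real (max_size E') - real (max_size E)))"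
      unfolding F_def
    proof (intro bern_ex_mono qr)
      fix E'
      have "x P E' \<le> real (max_size E') - real (max_size E)" using max_size_ge[OF PI(1), of E'] PI by (simp add: x_def)
      moreover have "x Q E' - d \<le> real (max_size E') - real (max_size E)" using max_size_ge[OF QI(1), of E'] QI by (simp add: x_def)
      moreover have "u + w + \<bar>u - w\<bar> - 2 * d \<le> 2 * M" if "u \<le> M" "w - d \<le> M" for u w M :: real
        using that d by (simp add: abs_if)
      ultimately show "x P E' + x Q E' + \<bar>x P E' - x Q E'\<bar> - 2 * d \<le> 2 * (real (max_size E') - real (max_size E))"
        by blast
    qed
    moreover have "F E (\<lambda>E'. x P E' + x Q E' + \<bar>x P E' - x Q E'\<bar> - 2 * d)
        = F E (x P) + F E (x Q) + F E (\<lambda>E'. \<bar>x P E' - x Q E'\<bar>) - 2 * d"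
      unfolding F_def by (simp only: bern_ex_add bern_ex_diff bern_ex_const[OF finD])
    moreover have "F E (\<lambda>E'. 2 * (real (max_size E') - real (max_size E))) = 2 * (F E (\<lambda>E'. real (max_size E')) - real (max_size E))"
      unfolding F_def by (simp only: bern_ex_cmult bern_ex_diff bern_ex_const[OF finD])
    ultimately show ?thesis using Fabs Fx[OF PI(1)] Fx[OF QI(1)] by linarith
  qed
  have "bern_ex D (\<lambda>_. p) (\<lambda>E. of_bool (far d m E) * (sqrt v / 5))
     \<le> bern_ex D (\<lambda>_. p) (\<lambda>E. 2 * (F E (\<lambda>E'. real (max_size E')) - real (max_size E)) + 2 * s * disc p E + 2 * d)"
    using p p1 key by (intro bern_ex_mono) auto
  also have "\<dots> = 2 * (bern_ex D (\<lambda>_. p) (\<lambda>E. F E (\<lambda>E'. real (max_size E'))) - bern_ex D (\<lambda>_. p) (\<lambda>E. real (max_size E)))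
      + 2 * s * bern_ex D (\<lambda>_. p) (disc p) + 2 * d"
    by (simp only: bern_ex_add bern_ex_diff bern_ex_cmult bern_ex_const[OF finD])
  also have "bern_ex D (\<lambda>_. p) (\<lambda>E. F E (\<lambda>E'. real (max_size E'))) = bern_ex D (\<lambda>_. p) (\<lambda>E. real (max_size E))"
    unfolding F_def by (rule resampled_invariant[OF finD])
  finally have "bern_ex D (\<lambda>_. p) (\<lambda>E. of_bool (far d m E) * (sqrt v / 5)) \<le> 2 * d + 2 * s * bern_ex D (\<lambda>_. p) (disc p)"
    by (simp only: diff_self mult_zero_right add_0 add.commute)
  moreover have "bern_ex D (\<lambda>_. p) (\<lambda>E. of_bool (far d m E) * (sqrt v / 5)) = bern_ex D (\<lambda>_. p) (\<lambda>E. of_bool (far d m E)) * (sqrt v / 5)"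
    unfolding mult.commute[of _ "sqrt v / 5"] by (rule bern_ex_cmult)
  ultimately show ?thesis by (simp only: v_def)
qed

text \<open>
  The expected deficit of the old maximizer after resampling the elements of \<open>R\<close> with probability
  \<open>\<epsilon>\<close>.
\<close>

lemma opt_noise_stability:
  assumes "R \<subseteq> D"
  shows "bern_ex D (\<lambda>_. p) (\<lambda>E. bern_ex D (resampled p (\<lambda>e. \<epsilon> * of_bool (e \<in> R)) E)
            (\<lambda>E'. real (max_size E') - real (card (E' \<inter> A (opt E)))))
    = \<epsilon> * bern_ex D (\<lambda>_. p) (\<lambda>E. real (card (E \<inter> (R \<inter> A (opt E)))) - p * real (card (R \<inter> A (opt E))))"
proof -
  let ?s = "\<lambda>e. \<epsilon> * of_bool (e \<in> R)"
  have "bern_ex D (resampled p ?s E) (\<lambda>E'. real (card (E' \<inter> A (opt E))))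
      = real (max_size E) - \<epsilon> * (real (card (E \<inter> (R \<inter> A (opt E)))) - p * real (card (R \<inter> A (opt E))))" for E
  proof -
    let ?P = "A (opt E)"
    have P: "?P \<subseteq> D" "finite ?P" "card (E \<inter> ?P) = max_size E" using opt[of E] A_sub finA by auto
    have fR: "finite (R \<inter> ?P)" using P by auto
    have "bern_ex D (resampled p ?s E) (\<lambda>E'. real (card (E' \<inter> ?P))) = sum (resampled p ?s E) ?P"
      using P finD by (simp add: bern_ex_card_Int)
    also have "\<dots> = (\<Sum>e\<in>?P. of_bool (e \<in> E)) - \<epsilon> * (\<Sum>e\<in>?P. of_bool (e \<in> R) * (of_bool (e \<in> E) - p))"
      unfolding sum_distrib_left sum_subtractf[symmetric]
      by (intro sum.cong) (auto simp: resampled_def algebra_simps)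
    also have "(\<Sum>e\<in>?P. of_bool (e \<in> R) * (of_bool (e \<in> E) - p)) = (\<Sum>e\<in>R \<inter> ?P. of_bool (e \<in> E) - p)"
      using P by (intro sum.mono_neutral_cong_right) auto
    also have "\<dots> = real (card (E \<inter> (R \<inter> ?P))) - p * real (card (R \<inter> ?P))"
      using card_Int_sum[OF fR, of E] by (simp only: sum_subtractf) simp
    also have "(\<Sum>e\<in>?P. of_bool (e \<in> E)) = real (max_size E)"
      using card_Int_sum[OF P(2), of E] P(3) by simp
    finally show ?thesis .
  qed
  then show ?thesis
    by (simp only: bern_ex_diff resampled_invariant[OF finD] bern_ex_cmult)
qed

end

context set_system
begin

text \<open>
  The largest number of elements of \<open>S - G\<close> in one member of the family of deficit at most \<open>d\<close>.
  In the application \<open>S\<close> is a set of pairs at one vertex \<open>v\<close>, and \<open>miss d S G\<close> tells how far a cut of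
  small deficit can place \<open>v\<close> away from the other ends of these pairs.
\<close>

definition miss :: "real \<Rightarrow> 'e set \<Rightarrow> 'e set \<Rightarrow> nat" where
  "miss d S G = Max ((\<lambda>i. card (S \<inter> A i - G)) ` {i. near d G i})"

lemma finite_near: "finite {i. near d G i}"
  by (rule finite_subset[OF _ finI]) (auto simp: near_def)

lemma miss_ge: "near d G i \<Longrightarrow> card (S \<inter> A i - G) \<le> miss d S G"
  unfolding miss_def using finite_near by (intro Max_ge) auto

lemma miss_attained:
  assumes "d \<ge> 0"
  obtains i where "near d G i" "miss d S G = card (S \<inter> A i - G)"
proof -
  have "miss d S G \<in> (\<lambda>i. card (S \<inter> A i - G)) ` {i. near d G i}"
    unfolding miss_def using finite_near near_opt[OF assms] by (intro Max_in) auto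
  then show ?thesis using that by auto
qed

lemma miss_le_card:
  assumes "d \<ge> 0" "finite S"
  shows "miss d S G \<le> card S"
proof -
  obtain i where "miss d S G = card (S \<inter> A i - G)" using miss_attained[OF assms(1)] .
  then show ?thesis using assms by (auto intro: card_mono)
qed

text \<open>
  Let \<open>H\<close> have parameter \<open>a\<close> on \<open>S\<close>, and let \<open>G\<close> arise from \<open>H\<close> by deleting each element of \<open>S\<close> with
  probability \<open>\<rho>\<close>. Equivalently, \<open>H\<close> arises from \<open>G\<close> by adding each element of \<open>S - G\<close> independently with
  probability \<open>\<kappa>\<close>. Deleting costs the maximum at most the deleted part of \<open>A (opt H)\<close>; adding
  gains the added part of any member of deficit at most \<open>d\<close> in \<open>G\<close>, up to \<open>d\<close>. The laws of
  \<open>G\<close> and \<open>H\<close> are close, so the gain may be evaluated at \<open>H\<close>.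
\<close>

lemma addition_inequality:
  fixes a \<rho> d :: real
  assumes SD: "S \<subseteq> D" and q: "\<And>e. e \<in> D \<Longrightarrow> 0 \<le> q e \<and> q e \<le> 1" and qS: "\<And>e. e \<in> S \<Longrightarrow> q e = a"
    and a: "0 \<le> a" "a \<le> 1/2" and rho: "0 \<le> \<rho>" "\<rho> \<le> 1" and d: "d \<ge> 0"
    and \<kappa>: "\<kappa> = a * \<rho> / (1 - a * (1 - \<rho>))"
  shows "\<kappa> * (bern_ex D q (\<lambda>H. real (miss d S H)) - real (card S) * \<rho> * sqrt (8 * real (card S) * a))
     \<le> d + \<rho> * bern_ex D q (\<lambda>H. real (card (H \<inter> (S \<inter> A (opt H)))))"
proof -
  have finS: "finite S" using SD finD finite_subset by blast
  define q' where "q' e = (if e \<in> S then q e * (1 - \<rho>) else q e)" for e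
  define k where "k e = \<kappa> * of_bool (e \<in> S)" for e
  define l where "l e = \<rho> * of_bool (e \<in> S)" for e
  have ar: "0 \<le> a * (1 - \<rho>)" "a * (1 - \<rho>) \<le> 1/2" "0 \<le> a * \<rho>"
    using a rho mult_mono[of a "1/2" "1 - \<rho>" 1] by auto
  have \<kappa>1: "\<kappa> * (1 - a * (1 - \<rho>)) = a * \<rho>" unfolding \<kappa> using ar by simp
  have \<kappa>0: "0 \<le> \<kappa>" unfolding \<kappa> using ar by (intro divide_nonneg_nonneg) auto
  have \<kappa>2: "\<kappa> \<le> 1"
  proof -
    have "a * \<rho> \<le> 1 - a * (1 - \<rho>)" using a by (simp add: algebra_simps)
    then show ?thesis unfolding \<kappa> using ar by (simp add: divide_le_eq)
  qed
  have q': "0 \<le> q' e \<and> q' e \<le> 1" if "e \<in> D" for e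
    using q[OF that] rho by (auto simp: q'_def intro: mult_le_one)
  have k: "0 \<le> k e \<and> k e \<le> 1" for e using \<kappa>0 \<kappa>2 by (auto simp: k_def)
  have l: "0 \<le> l e \<and> l e \<le> 1" for e using rho by (auto simp: l_def)
  have up: "bern_ex D q h = bern_ex D q' (\<lambda>G. bern_ex D k (\<lambda>T. h (G \<union> T)))" for h
  proof -
    have "q e = 1 - (1 - q' e) * (1 - k e)" for e
    proof (cases "e \<in> S")
      case True
      then show ?thesis using qS[OF True] \<kappa>1 by (simp add: q'_def k_def algebra_simps)
    qed (simp add: q'_def k_def)
    then show ?thesis unfolding bern_ex_union[OF finD] by (intro bern_ex_cong) auto
  qed
  have down: "bern_ex D q' h = bern_ex D q (\<lambda>H. bern_ex D l (\<lambda>T. h (H - T)))" for h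
    unfolding bern_ex_minus[OF finD] by (intro bern_ex_cong) (auto simp: q'_def l_def)
  have "bern_ex D q' (\<lambda>G. real (max_size G) - d + \<kappa> * real (miss d S G)) \<le> bern_ex D q (\<lambda>H. real (max_size H))"
    unfolding up
  proof (intro bern_ex_mono q')
    fix G assume G: "G \<subseteq> D"
    have finG: "finite G" using G finD finite_subset by blast
    obtain i where i: "near d G i" "miss d S G = card (S \<inter> A i - G)" using miss_attained[OF d] .
    have iI: "i \<in> I" "real (max_size G) \<le> real (card (G \<inter> A i)) + d" using i by (auto simp: near_def)
    define Y where "Y = S \<inter> A i - G"
    have Y: "Y \<subseteq> D" "finite Y" using SD finS by (auto simp: Y_def)
    have "sum k Y = (\<Sum>e\<in>Y. \<kappa>)" by (intro sum.cong) (auto simp: k_def Y_def)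
    then have "\<kappa> * real (miss d S G) = sum k Y"
      unfolding i(2) Y_def[symmetric] by simp
    also have "\<dots> = bern_ex D k (\<lambda>T. real (card (T \<inter> Y)))" using Y finD by (simp add: bern_ex_card_Int)
    finally have "real (max_size G) - d + \<kappa> * real (miss d S G) = bern_ex D k (\<lambda>T. (real (max_size G) - d) + real (card (T \<inter> Y)))"
      by (simp add: bern_ex_add bern_ex_const[OF finD])
    also have "\<dots> \<le> bern_ex D k (\<lambda>T. real (max_size (G \<union> T)))"
    proof (intro bern_ex_mono k)
      fix T assume "T \<subseteq> D"
      then have finT: "finite T" using finD finite_subset by blast
      have "card (G \<inter> A i) + card (T \<inter> Y) = card ((G \<inter> A i) \<union> (T \<inter> Y))"
        using finG Y by (intro card_Un_disjoint[symmetric]) (auto simp: Y_def)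
      also have "\<dots> \<le> card ((G \<union> T) \<inter> A i)"
        using finG finT by (intro card_mono) (auto simp: Y_def)
      also have "\<dots> \<le> max_size (G \<union> T)" by (rule max_size_ge[OF iI(1)])
      finally show "(real (max_size G) - d) + real (card (T \<inter> Y)) \<le> real (max_size (G \<union> T))" using iI(2) by linarith
    qed
    finally show "real (max_size G) - d + \<kappa> * real (miss d S G) \<le> bern_ex D k (\<lambda>T. real (max_size (G \<union> T)))" .
  qed
  then have 1: "bern_ex D q' (\<lambda>G. real (max_size G)) - d + \<kappa> * bern_ex D q' (\<lambda>G. real (miss d S G)) \<le> bern_ex D q (\<lambda>H. real (max_size H))"
    by (simp add: bern_ex_add bern_ex_diff bern_ex_const[OF finD] bern_ex_cmult)
  have "bern_ex D q (\<lambda>H. real (max_size H) - \<rho> * real (card (H \<inter> (S \<inter> A (opt H))))) \<le> bern_ex D q' (\<lambda>G. real (max_size G))"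
    unfolding down
  proof (intro bern_ex_mono q)
    fix H assume H: "H \<subseteq> D"
    have finH: "finite H" using H finD finite_subset by blast
    define Y where "Y = H \<inter> A (opt H)"
    have Y: "Y \<subseteq> D" "finite Y" using H finH by (auto simp: Y_def)
    have "sum l Y = \<rho> * real (card (Y \<inter> S))"
      unfolding l_def sum_distrib_left[symmetric] using Y by simp
    also have "Y \<inter> S = H \<inter> (S \<inter> A (opt H))" by (auto simp: Y_def)
    finally have "real (max_size H) - \<rho> * real (card (H \<inter> (S \<inter> A (opt H)))) = bern_ex D l (\<lambda>T. real (max_size H) - real (card (T \<inter> Y)))"
      using Y finD by (simp add: bern_ex_diff bern_ex_const bern_ex_card_Int)
    also have "\<dots> \<le> bern_ex D l (\<lambda>T. real (max_size (H - T)))"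
    proof (intro bern_ex_mono l)
      fix T assume "T \<subseteq> D"
      have "card Y \<le> card ((H - T) \<inter> A (opt H) \<union> T \<inter> Y)"
        using finH Y by (intro card_mono) (auto simp: Y_def)
      also have "\<dots> \<le> card ((H - T) \<inter> A (opt H)) + card (T \<inter> Y)" by (rule card_Un_le)
      also have "card ((H - T) \<inter> A (opt H)) \<le> max_size (H - T)" using opt by (intro max_size_ge) auto
      finally have "card Y \<le> max_size (H - T) + card (T \<inter> Y)" by simp
      moreover have "card Y = max_size H" using opt[of H] by (simp add: Y_def)
      ultimately show "real (max_size H) - real (card (T \<inter> Y)) \<le> real (max_size (H - T))" by linarith
    qed
    finally show "real (max_size H) - \<rho> * real (card (H \<inter> (S \<inter> A (opt H)))) \<le> bern_ex D l (\<lambda>T. real (max_size (H - T)))" .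
  qed
  then have 2: "bern_ex D q (\<lambda>H. real (max_size H)) - \<rho> * bern_ex D q (\<lambda>H. real (card (H \<inter> (S \<inter> A (opt H))))) \<le> bern_ex D q' (\<lambda>G. real (max_size G))"
    by (simp add: bern_ex_diff bern_ex_cmult)
  \<comment> \<open>The gain is known at \<open>G\<close>; closeness of the laws transfers it to \<open>H\<close>.\<close>
  have 3: "bern_ex D q (\<lambda>H. real (miss d S H)) - real (card S) * \<rho> * sqrt (8 * real (card S) * a) \<le> bern_ex D q' (\<lambda>H. real (miss d S H))"
    by (rule hellinger_bound[OF finD SD q])
      (use a rho qS miss_le_card[OF d finS] in \<open>auto simp: q'_def\<close>)
  have "\<kappa> * (bern_ex D q (\<lambda>H. real (miss d S H)) - real (card S) * \<rho> * sqrt (8 * real (card S) * a))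
      \<le> \<kappa> * bern_ex D q' (\<lambda>H. real (miss d S H))"
    using \<kappa>0 3 by (intro mult_left_mono)
  then show ?thesis using 1 2 by linarith
qed

end

section \<open>The random graph and its cuts\<close>

text \<open>
  The random graph as a Bernoulli set of pairs.
\<close>

lemma prob_gnp:
  assumes p: "0 \<le> p" "p \<le> 1"
  shows "measure_pmf.prob (gnp n p) {E. Q E} = bern_ex (nsets {..<n} 2) (\<lambda>_. p) (\<lambda>E. of_bool (Q E))"
proof -
  let ?D = "nsets {..<n} 2"
  have fin: "finite ?D" by (simp add: finite_imp_finite_nsets)
  have pmfE: "pmf (gnp n p) E = bern_weight ?D (\<lambda>_. p) E" if "E \<subseteq> ?D" for E
  proof -
    have "pmf (gnp n p) E
        = measure_pmf.prob (Pi_pmf ?D False (\<lambda>_. bernoulli_pmf p)) ((\<lambda>f. {e \<in> ?D. f e}) -` {E})"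
      by (simp add: gnp_def pmf_map)
    also have "(\<lambda>f. {e \<in> ?D. f e}) -` {E} = Pi ?D (\<lambda>e. {e \<in> E})"
      using that by (auto simp: Pi_def)
    also have "measure_pmf.prob (Pi_pmf ?D False (\<lambda>_. bernoulli_pmf p)) \<dots>
        = (\<Prod>e\<in>?D. measure_pmf.prob (bernoulli_pmf p) {e \<in> E})"
      using fin by (rule measure_Pi_pmf_Pi)
    also have "\<dots> = bern_weight ?D (\<lambda>_. p) E"
      unfolding bern_weight_def using p by (intro prod.cong refl) (auto simp: measure_pmf_single)
    finally show ?thesis .
  qed
  have out: "pmf (gnp n p) E = 0" if "\<not> E \<subseteq> ?D" for E
  proof -
    have "set_pmf (gnp n p) \<subseteq> Pow ?D" by (auto simp: gnp_def)
    then show ?thesis using that by (auto simp: set_pmf_eq)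
  qed
  have "measure_pmf.prob (gnp n p) {E. Q E} = measure_pmf.prob (gnp n p) {E \<in> Pow ?D. Q E}"
    by (rule measure_prob_cong_0) (auto intro: out)
  also have "\<dots> = (\<Sum>E\<in>{E \<in> Pow ?D. Q E}. pmf (gnp n p) E)"
    using fin by (intro measure_measure_pmf_finite) auto
  also have "\<dots> = (\<Sum>E\<in>{E \<in> Pow ?D. Q E}. bern_weight ?D (\<lambda>_. p) E)"
    by (intro sum.cong) (auto simp: pmfE)
  also have "\<dots> = bern_ex ?D (\<lambda>_. p) (\<lambda>E. of_bool (Q E))"
    unfolding bern_ex_def using fin by (intro sum.mono_neutral_cong_left) auto
  finally show ?thesis .
qed

definition pairs :: "nat \<Rightarrow> nat set set" where
  "pairs n = nsets {..<n} 2"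

abbreviation gnp_ex :: "nat \<Rightarrow> real \<Rightarrow> (nat set set \<Rightarrow> real) \<Rightarrow> real" where
  "gnp_ex n p \<equiv> bern_ex (pairs n) (\<lambda>_. p)"

text \<open>
  Cuts are encoded as colourings of \<open>{..<n}\<close> with \<open>r\<close> colours, made extensional so that there are
  finitely many.
\<close>

definition colourings :: "nat \<Rightarrow> nat \<Rightarrow> (nat \<Rightarrow> nat) set" where
  "colourings n r = {..<n} \<rightarrow>\<^sub>E {..<r}"

text \<open>
  The pairs separated by a colouring.
\<close>

definition cut_pairs :: "nat \<Rightarrow> (nat \<Rightarrow> nat) \<Rightarrow> nat set set" where
  "cut_pairs n c = {e \<in> pairs n. \<exists>u\<in>e. \<exists>w\<in>e. c u \<noteq> c w}"

text \<open>
  The part of the cut consisting of the vertices of colour \<open>i\<close>.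
\<close>

definition block :: "nat \<Rightarrow> (nat \<Rightarrow> nat) \<Rightarrow> nat \<Rightarrow> nat set" where
  "block n c i = {v \<in> {..<n}. c v = i}"

text \<open>
  The pairs that contain \<open>v\<close>.
\<close>

definition star :: "nat \<Rightarrow> nat \<Rightarrow> nat set set" where
  "star n v = {e \<in> pairs n. v \<in> e}"

text \<open>
  The number of neighbours of \<open>v\<close> in \<open>X\<close>.
\<close>

definition deg_to :: "nat set set \<Rightarrow> nat \<Rightarrow> nat set \<Rightarrow> nat" where
  "deg_to E v X = card {y \<in> X. {v, y} \<in> E}"

text \<open>
  The number of ordered pairs \<open>(x, y)\<close> in \<open>X \<times> Y\<close> that form an edge; an edge inside \<open>X \<inter> Y\<close> counts
  twice.
\<close>

definition edges_between :: "nat set set \<Rightarrow> nat set \<Rightarrow> nat set \<Rightarrow> real" where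
  "edges_between E X Y = (\<Sum>x\<in>X. real (deg_to E x Y))"

lemma finite_pairs [simp]: "finite (pairs n)"
  by (simp add: pairs_def finite_imp_finite_nsets)

lemma pair_mem_pairs [simp]: "{x, y} \<in> pairs n \<longleftrightarrow> x < n \<and> y < n \<and> x \<noteq> y"
  by (simp add: pairs_def)

lemma pairs_cases:
  assumes "e \<in> pairs n"
  obtains x y where "e = {x, y}" "x < n" "y < n" "x \<noteq> y"
  using assms unfolding pairs_def by (elim nsets2_E) auto

lemma star_cases:
  assumes "e \<in> star n v"
  obtains y where "e = {v, y}" "v < n" "y < n" "v \<noteq> y"
proof -
  from assms obtain a b where ab: "e = {a, b}" "a < n" "b < n" "a \<noteq> b" "v \<in> {a, b}"
    unfolding star_def by (auto elim!: pairs_cases)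
  show ?thesis
  proof (cases "v = a")
    case True
    show ?thesis by (rule that[of b]) (use ab True in simp_all)
  next
    case False
    then have "v = b" using ab by simp
    then show ?thesis by (intro that[of a]) (use ab in \<open>simp_all add: insert_commute\<close>)
  qed
qed

lemma card_pairs: "real (card (pairs n)) \<le> real n ^ 2 / 2"
proof -
  have "card (pairs n) = n choose 2" by (simp only: pairs_def binomial_eq_nsets atLeast0LessThan)
  then have "2 * card (pairs n) \<le> n * (n - 1)" by (simp add: choose_two)
  also have "\<dots> \<le> n * n" by simp
  finally have "real (2 * card (pairs n)) \<le> real (n * n)" by (rule of_nat_mono)
  then show ?thesis by (simp add: power2_eq_square)
qed

lemma mem_cut_pairs: "{x, y} \<in> cut_pairs n c \<longleftrightarrow> x < n \<and> y < n \<and> c x \<noteq> c y"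
  unfolding cut_pairs_def by auto

lemma finite_block [simp]: "finite (block n c i)"
  by (simp add: block_def)

lemma block_subset: "block n c i \<subseteq> {..<n}"
  by (auto simp: block_def)

lemma sum_card_star:
  assumes "F \<subseteq> pairs n"
  shows "(\<Sum>v<n. card (F \<inter> star n v)) = 2 * card F"
proof -
  have fin: "finite F" using assms finite_subset finite_pairs by blast
  have "(\<Sum>v<n. card (F \<inter> star n v)) = (\<Sum>v<n. \<Sum>e\<in>F. if v \<in> e then 1 else 0)"
  proof (intro sum.cong refl)
    fix v
    have "F \<inter> star n v = F \<inter> {e. v \<in> e}" using assms by (auto simp: star_def)
    then show "card (F \<inter> star n v) = (\<Sum>e\<in>F. if v \<in> e then 1 else 0)"
      using fin by (simp add: sum.If_cases)
  qed
  also have "\<dots> = (\<Sum>e\<in>F. \<Sum>v<n. if v \<in> e then 1 else 0)" by (rule sum.swap)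
  also have "\<dots> = (\<Sum>e\<in>F. 2)"
  proof (intro sum.cong refl)
    fix e assume "e \<in> F"
    then obtain x y where xy: "e = {x, y}" "x < n" "y < n" "x \<noteq> y" using assms pairs_cases by blast
    have "(\<Sum>v<n. if v \<in> e then 1 else 0) = card ({..<n} \<inter> {v. v \<in> e})" by (simp add: sum.If_cases)
    also have "{..<n} \<inter> {v. v \<in> e} = {x, y}" using xy by auto
    finally show "(\<Sum>v<n. if v \<in> e then 1 else 0) = (2::nat)" using xy by simp
  qed
  finally show ?thesis by simp
qed

lemma card_star_image:
  assumes "Y \<subseteq> {..<n} - {v}"
  shows "card ((\<lambda>y. {v, y}) ` Y) = card Y"
  using assms by (intro card_image inj_onI) (auto simp: doubleton_eq_iff)

lemma card_star_filter:
  assumes "v < n"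
  shows "card {e \<in> star n v. Q e} = card {y \<in> {..<n}. y \<noteq> v \<and> Q {v, y}}"
proof -
  have "{e \<in> star n v. Q e} = (\<lambda>y. {v, y}) ` {y \<in> {..<n}. y \<noteq> v \<and> Q {v, y}}"
    using assms by (auto elim!: star_cases) (auto simp: star_def)
  then show ?thesis by (simp only:) (rule card_star_image, auto)
qed

lemma deg_to_Un:
  assumes "finite X" "finite Y" "X \<inter> Y = {}"
  shows "deg_to E v (X \<union> Y) = deg_to E v X + deg_to E v Y"
proof -
  have "{y \<in> X \<union> Y. {v, y} \<in> E} = {y \<in> X. {v, y} \<in> E} \<union> {y \<in> Y. {v, y} \<in> E}" by auto
  then show ?thesis unfolding deg_to_def using assms by (simp add: card_Un_disjoint disjoint_iff)
qed

locale cuts =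
  fixes n r :: nat
  assumes r: "r \<ge> 2"

sublocale cuts \<subseteq> set_system "pairs n" "colourings n r" "cut_pairs n"
proof
  show "finite (colourings n r)" by (simp add: colourings_def finite_PiE)
  show "colourings n r \<noteq> {}" using r by (auto simp: colourings_def PiE_eq_empty_iff lessThan_empty_iff)
qed (auto simp: cut_pairs_def)

context cuts
begin

lemma card_colourings: "card (colourings n r) = r ^ n"
  by (simp add: colourings_def card_PiE)

lemma colouring_less: "c \<in> colourings n r \<Longrightarrow> v < n \<Longrightarrow> c v < r"
  by (auto simp: colourings_def)

lemma card_cut_star:
  assumes E: "E \<subseteq> pairs n" and v: "v < n"
  shows "card (E \<inter> (star n v \<inter> cut_pairs n c)) + deg_to E v (block n c (c v)) = deg_to E v {..<n}"
proof -
  have ne: "y \<noteq> v" if "{v, y} \<in> E" for y using that E pair_mem_pairs by blast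
  have "E \<inter> (star n v \<inter> cut_pairs n c) = {e \<in> star n v. e \<in> E \<and> e \<in> cut_pairs n c}" by auto
  then have "card (E \<inter> (star n v \<inter> cut_pairs n c)) = card {y \<in> {..<n}. y \<noteq> v \<and> {v, y} \<in> E \<and> {v, y} \<in> cut_pairs n c}"
    by (simp only: card_star_filter[OF v])
  also have "{y \<in> {..<n}. y \<noteq> v \<and> {v, y} \<in> E \<and> {v, y} \<in> cut_pairs n c} = {y \<in> {..<n} - block n c (c v). {v, y} \<in> E}"
    using v ne by (auto simp: mem_cut_pairs block_def)
  also have "card \<dots> = deg_to E v ({..<n} - block n c (c v))" by (simp add: deg_to_def)
  finally have "card (E \<inter> (star n v \<inter> cut_pairs n c)) + deg_to E v (block n c (c v))
    = deg_to E v (({..<n} - block n c (c v)) \<union> block n c (c v))"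
    by (subst deg_to_Un) auto
  also have "({..<n} - block n c (c v)) \<union> block n c (c v) = {..<n}" by (auto simp: block_def)
  finally show ?thesis .
qed

lemma recolour:
  assumes c: "c \<in> colourings n r" and v: "v < n" and j: "j < r" "j \<noteq> c v" and E: "E \<subseteq> pairs n"
  shows "c(v := j) \<in> colourings n r"
    and "card (E \<inter> cut_pairs n (c(v := j))) + deg_to E v (block n c j)
       = card (E \<inter> cut_pairs n c) + deg_to E v (block n c (c v))"
proof -
  let ?c' = "c(v := j)"
  show "?c' \<in> colourings n r" using c v j by (auto simp: colourings_def PiE_iff extensional_def)
  have finE: "finite E" using E finite_subset finite_pairs by blast
  have ne: "y \<noteq> v" if "{v, y} \<in> E" for y using that E pair_mem_pairs by blast
  have split: "card (E \<inter> cut_pairs n f) = card (E \<inter> (star n v \<inter> cut_pairs n f)) + card (E \<inter> cut_pairs n f - star n v)" for f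
  proof -
    have "E \<inter> cut_pairs n f = (E \<inter> (star n v \<inter> cut_pairs n f)) \<union> (E \<inter> cut_pairs n f - star n v)" by auto
    then show ?thesis using finE by (metis (no_types, lifting) card_Un_disjoint finite_Int finite_Diff
          Diff_disjoint Int_Diff Int_assoc Int_commute Int_left_commute card_Int_Diff)
  qed
  have off: "E \<inter> cut_pairs n ?c' - star n v = E \<inter> cut_pairs n c - star n v"
    using E by (auto simp: cut_pairs_def star_def)
  have p': "deg_to E v (block n ?c' (?c' v)) = deg_to E v (block n c j)"
    unfolding deg_to_def using ne ne[of v] j by (intro arg_cong[of _ _ card]) (auto simp: block_def)
  show "card (E \<inter> cut_pairs n ?c') + deg_to E v (block n c j) = card (E \<inter> cut_pairs n c) + deg_to E v (block n c (c v))"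
    using card_cut_star[OF E v, of ?c'] card_cut_star[OF E v, of c] split[of ?c'] split[of c] off p' by simp
qed

lemma near_local_optimum:
  assumes "near d E c" "v < n" "j < r" and E: "E \<subseteq> pairs n" and d: "d \<ge> 0"
  shows "real (deg_to E v (block n c (c v))) \<le> real (deg_to E v (block n c j)) + d"
proof (cases "j = c v")
  case False
  have c: "c \<in> colourings n r" using assms by (auto simp: near_def)
  note rc = recolour[OF c assms(2,3) False E]
  have "real (card (E \<inter> cut_pairs n (c(v := j)))) \<le> real (card (E \<inter> cut_pairs n c)) + d"
    using max_size_ge[OF rc(1), of E] assms(1) by (auto simp: near_def)
  then show ?thesis using rc(2) by linarith
qed (use d in auto)

lemma near_recolour:
  assumes "near 0 E c" "v < n" "j < r" "j \<noteq> c v" and E: "E \<subseteq> pairs n"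
    and "real (deg_to E v (block n c j)) \<le> real (deg_to E v (block n c (c v))) + d"
  shows "near d E (c(v := j))"
proof -
  have c: "c \<in> colourings n r" using assms by (auto simp: near_def)
  note rc = recolour[OF c assms(2,3,4) E]
  show ?thesis using rc assms(1,6) by (auto simp: near_def)
qed

end

section \<open>Uniform edge distribution\<close>

lemma deviation_edges_between:
  assumes X: "X \<subseteq> {..<n}" and Y: "Y \<subseteq> {..<n}" and E: "E \<subseteq> pairs n"
  shows "deviation (pairs n) p (\<lambda>e. real (card {(x, y). x \<in> X \<and> y \<in> Y \<and> {x, y} = e})) E
     = edges_between E X Y - p * (real (card X) * real (card Y) - real (card (X \<inter> Y)))"
proof -
  have fin: "finite X" "finite Y" using X Y finite_subset by blast+
  have c: "real (card {(x, y). x \<in> X \<and> y \<in> Y \<and> {x, y} = e}) = (\<Sum>z\<in>X \<times> Y. of_bool ({fst z, snd z} = e))" for e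
  proof -
    have "{(x, y). x \<in> X \<and> y \<in> Y \<and> {x, y} = e} = X \<times> Y \<inter> {z. {fst z, snd z} = e}" by auto
    then show ?thesis using fin by simp
  qed
  have "deviation (pairs n) p (\<lambda>e. real (card {(x, y). x \<in> X \<and> y \<in> Y \<and> {x, y} = e})) E
     = (\<Sum>e\<in>pairs n. \<Sum>z\<in>X \<times> Y. of_bool ({fst z, snd z} = e) * (of_bool (e \<in> E) - p))"
    unfolding deviation_def c sum_distrib_right ..
  also have "\<dots> = (\<Sum>z\<in>X \<times> Y. \<Sum>e\<in>pairs n. of_bool ({fst z, snd z} = e) * (of_bool (e \<in> E) - p))"
    by (rule sum.swap)
  also have "\<dots> = (\<Sum>z\<in>X \<times> Y. of_bool ({fst z, snd z} \<in> E) - p * of_bool (fst z \<noteq> snd z))"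
  proof (intro sum.cong refl)
    fix z assume z: "z \<in> X \<times> Y"
    have "(\<Sum>e\<in>pairs n. of_bool ({fst z, snd z} = e) * (of_bool (e \<in> E) - p))
       = (\<Sum>e\<in>pairs n. if e = {fst z, snd z} then of_bool ({fst z, snd z} \<in> E) - p else 0)"
      by (intro sum.cong) auto
    also have "\<dots> = (if {fst z, snd z} \<in> pairs n then of_bool ({fst z, snd z} \<in> E) - p else 0)"
      by (simp add: sum.delta)
    also have "\<dots> = of_bool ({fst z, snd z} \<in> E) - p * of_bool (fst z \<noteq> snd z)"
    proof -
      have "{fst z, snd z} \<notin> E" if "fst z = snd z" using that E pair_mem_pairs by blast
      then show ?thesis using z X Y by auto
    qed
    finally show "(\<Sum>e\<in>pairs n. of_bool ({fst z, snd z} = e) * (of_bool (e \<in> E) - p))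
      = of_bool ({fst z, snd z} \<in> E) - p * of_bool (fst z \<noteq> snd z)" .
  qed
  also have "\<dots> = (\<Sum>x\<in>X. \<Sum>y\<in>Y. of_bool ({x, y} \<in> E)) - p * (\<Sum>x\<in>X. \<Sum>y\<in>Y. of_bool (x \<noteq> y))"
    by (simp only: sum.cartesian_product' sum_subtractf sum_distrib_left[symmetric] fst_conv snd_conv)
  also have "(\<Sum>x\<in>X. \<Sum>y\<in>Y. of_bool ({x, y} \<in> E)) = edges_between E X Y"
  proof -
    have "(\<Sum>y\<in>Y. of_bool ({x, y} \<in> E)) = real (deg_to E x Y)" for x
    proof -
      have "Y \<inter> {y. {x, y} \<in> E} = {y \<in> Y. {x, y} \<in> E}" by auto
      then show ?thesis using fin by (simp add: deg_to_def)
    qed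
    then show ?thesis by (simp add: edges_between_def)
  qed
  also have "(\<Sum>x\<in>X. \<Sum>y\<in>Y. of_bool (x \<noteq> y)) = (\<Sum>x\<in>X. real (card Y) - of_bool (x \<in> Y))"
  proof (intro sum.cong refl)
    fix x
    have "(\<Sum>y\<in>Y. of_bool (x \<noteq> y)) = (\<Sum>y\<in>Y. 1 - (if x = y then 1 else 0 :: real))"
      by (intro sum.cong) auto
    then show "(\<Sum>y\<in>Y. of_bool (x \<noteq> y)) = real (card Y) - of_bool (x \<in> Y)"
      using fin by (simp add: sum_subtractf)
  qed
  also have "\<dots> = real (card X) * real (card Y) - real (card (X \<inter> Y))"
    using fin by (simp add: sum_subtractf)
  finally show ?thesis .
qed

text \<open>
  All edge counts between vertex sets are within \<open>t\<close> of their means; \<open>card (X \<inter> Y)\<close> accounts for the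
  missing loops.
\<close>

definition jumbled :: "nat \<Rightarrow> real \<Rightarrow> real \<Rightarrow> nat set set \<Rightarrow> bool" where
  "jumbled n p t E \<longleftrightarrow> (\<forall>X Y. X \<subseteq> {..<n} \<and> Y \<subseteq> {..<n} \<longrightarrow>
     \<bar>edges_between E X Y - p * (real (card X) * real (card Y) - real (card (X \<inter> Y)))\<bar> \<le> t)"

text \<open>
  A union bound over the \<open>4 ^ n\<close> pairs of vertex sets.
\<close>

lemma prob_not_jumbled:
  assumes p: "0 \<le> p" "p \<le> 1" and np: "real n * p \<ge> 1"
  shows "gnp_ex n p (\<lambda>E. of_bool (\<not> jumbled n p (8 * real n * sqrt (real n * p)) E)) \<le> 2 * exp (- real n)"
proof -
  define I where "I = Pow {..<n} \<times> Pow {..<n}"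
  define w where "w i e = real (card {(x, y). x \<in> fst i \<and> y \<in> snd i \<and> {x, y} = e})" for i :: "nat set \<times> nat set" and e :: "nat set"
  \<comment> \<open>The weights below are at most 2, and this choice makes the quadratic term of the exponent at most
    \<open>n / 2\<close>, against \<open>\<theta> * t = 4 n\<close>.\<close>
  define \<theta> where "\<theta> = 1 / (2 * sqrt (real n * p))"
  define t where "t = 8 * real n * sqrt (real n * p)"
  have sq: "sqrt (real n * p) \<ge> 1" using np by simp
  have \<theta>: "0 \<le> \<theta>" "\<theta> \<le> 1/2" using sq by (auto simp: \<theta>_def field_simps)
  have np0: "real n * p > 0" using np by linarith
  have quarter: "(1 / (2 * sqrt z))\<^sup>2 * z = 1/4" if "z > 0" for z :: real
  proof -
    have "(sqrt z)\<^sup>2 = z" using that by simp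
    then show ?thesis using that by (simp add: power_divide power_mult_distrib)
  qed
  have \<theta>2: "\<theta>\<^sup>2 * (real n * p) = 1/4" unfolding \<theta>_def by (rule quarter[OF np0])
  have w2: "0 \<le> w i e \<and> w i e \<le> 2" if "e \<in> pairs n" for i e
  proof -
    from that obtain a b where "e = {a, b}" by (auto elim: pairs_cases)
    then have sub: "{(x, y). x \<in> fst i \<and> y \<in> snd i \<and> {x, y} = e} \<subseteq> {(a, b), (b, a)}"
      by (auto simp: doubleton_eq_iff)
    have "card {(x, y). x \<in> fst i \<and> y \<in> snd i \<and> {x, y} = e} \<le> card {(a, b), (b, a)}"
      by (intro card_mono sub) auto
    also have "\<dots> \<le> 2" using card_insert_le_m1[of 2 "{(b, a)}" "(a, b)"] by simp
    finally show ?thesis by (simp add: w_def)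
  qed
  have "gnp_ex n p (\<lambda>E. of_bool (\<not> jumbled n p t E))
     \<le> gnp_ex n p (\<lambda>E. of_bool (\<exists>i\<in>I. \<bar>deviation (pairs n) p (w i) E\<bar> \<ge> t))"
  proof (intro bern_ex_mono)
    fix E assume E: "E \<subseteq> pairs n"
    have "\<exists>i\<in>I. \<bar>deviation (pairs n) p (w i) E\<bar> \<ge> t" if nd: "\<not> jumbled n p t E"
    proof -
      from nd obtain X Y where XY: "X \<subseteq> {..<n}" "Y \<subseteq> {..<n}"
        "\<not> \<bar>edges_between E X Y - p * (real (card X) * real (card Y) - real (card (X \<inter> Y)))\<bar> \<le> t"
        unfolding jumbled_def by blast
      have "deviation (pairs n) p (w (X, Y)) E = edges_between E X Y - p * (real (card X) * real (card Y) - real (card (X \<inter> Y)))"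
      proof -
        have "w (X, Y) = (\<lambda>e. real (card {(x, y). x \<in> X \<and> y \<in> Y \<and> {x, y} = e}))"
          by (intro ext) (simp only: w_def fst_conv snd_conv)
        then show ?thesis using deviation_edges_between[OF XY(1,2) E, of p] by (simp only:)
      qed
      then show ?thesis using XY by (intro bexI[of _ "(X, Y)"]) (auto simp: I_def)
    qed
    then show "of_bool (\<not> jumbled n p t E) \<le> (of_bool (\<exists>i\<in>I. \<bar>deviation (pairs n) p (w i) E\<bar> \<ge> t) :: real)"
      by auto
  qed (use p in auto)
  also have "\<dots> \<le> 2 * real (card I) * exp (real n / 2 - \<theta> * t)"
  proof (rule deviation_tail)
    fix i e assume "e \<in> pairs n"
    then show "\<bar>\<theta> * w i e\<bar> \<le> 1"
      using w2[of e i] \<theta> mult_mono[of \<theta> "1/2" "w i e" 2] by (simp add: abs_mult)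
  next
    fix i
    have "(\<Sum>e\<in>pairs n. (\<theta> * w i e)\<^sup>2) \<le> (\<Sum>e\<in>pairs n. \<theta>\<^sup>2 * 4)"
    proof (intro sum_mono)
      fix e assume "e \<in> pairs n"
      then have "(w i e)\<^sup>2 \<le> 2\<^sup>2" using w2[of e i] by (intro power_mono) auto
      then show "(\<theta> * w i e)\<^sup>2 \<le> \<theta>\<^sup>2 * 4" by (simp add: power_mult_distrib mult_left_mono)
    qed
    also have "\<dots> = real (card (pairs n)) * (\<theta>\<^sup>2 * 4)" by simp
    also have "\<dots> \<le> (real n ^ 2 / 2) * (\<theta>\<^sup>2 * 4)" by (intro mult_right_mono card_pairs) auto
    finally have "p * (\<Sum>e\<in>pairs n. (\<theta> * w i e)\<^sup>2) \<le> p * ((real n ^ 2 / 2) * (\<theta>\<^sup>2 * 4))"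
      using p by (intro mult_left_mono)
    also have "\<dots> = 2 * real n * (\<theta>\<^sup>2 * (real n * p))" by (simp add: power2_eq_square)
    also have "\<dots> = real n / 2" unfolding \<theta>2 by simp
    finally show "p * (\<Sum>e\<in>pairs n. (\<theta> * w i e)\<^sup>2) \<le> real n / 2" .
  qed (use p \<theta> in \<open>auto simp: I_def\<close>)
  also have "\<theta> * t = 4 * real n"
  proof -
    have "1 / (2 * q) * (8 * real n * q) = 4 * real n" if "q \<ge> 1" for q :: real
      using that by simp
    from this[OF sq] show ?thesis by (simp only: \<theta>_def t_def)
  qed
  also have "real (card I) = 2 ^ n * 2 ^ n" by (simp add: I_def card_cartesian_product card_Pow)
  also have "2 * (2 ^ n * 2 ^ n) * exp (real n / 2 - 4 * real n) \<le> 2 * (exp (real n) * exp (real n)) * exp (real n / 2 - 4 * real n)"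
  proof -
    have "(2::real) ^ n \<le> exp 1 ^ n" using exp_ge_add_one_self[of 1] by (intro power_mono) auto
    then have "(2::real) ^ n \<le> exp (real n)" by (simp add: exp_of_nat_mult[symmetric])
    then show ?thesis by (intro mult_right_mono mult_left_mono mult_mono) auto
  qed
  also have "\<dots> = 2 * exp (- (3/2) * real n)" by (simp add: exp_add[symmetric] algebra_simps)
  also have "\<dots> \<le> 2 * exp (- real n)" by simp
  finally show ?thesis by (simp add: t_def)
qed

context cuts
begin

text \<open>
  In a maximum cut no vertex of part \<open>j\<close> has more neighbours in its own part than in part \<open>i\<close>. Summed over
  part \<open>j\<close>, this bounds how much larger part \<open>j\<close> can be.
\<close>

lemma block_sizes:
  assumes ok: "jumbled n p t E" and E: "E \<subseteq> pairs n" and c: "near 0 E c" and ij: "i < r" "j < r"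
    and p: "0 \<le> p"
  shows "p * real (card (block n c j)) * (real (card (block n c j)) - 1 - real (card (block n c i))) \<le> 2 * t"
proof (cases "i = j")
  case True
  have "0 \<le> t" using ok unfolding jumbled_def by (metis abs_ge_zero empty_subsetI order_trans)
  moreover have "p * real (card (block n c j)) * (real (card (block n c j)) - 1 - real (card (block n c i))) \<le> 0"
    using True p by simp
  ultimately show ?thesis by linarith
next
  case False
  let ?P = "block n c j" and ?Q = "block n c i"
  have disj: "?P \<inter> ?Q = {}" using False by (auto simp: block_def)
  have "edges_between E ?P ?P \<le> edges_between E ?P ?Q"
    unfolding edges_between_def
  proof (intro sum_mono)
    fix x assume "x \<in> ?P"
    then have "x < n" "c x = j" by (auto simp: block_def)
    then show "real (deg_to E x ?P) \<le> real (deg_to E x ?Q)"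
      using near_local_optimum[OF c, of x i] ij E by auto
  qed
  moreover have "\<bar>edges_between E ?P ?P - p * (real (card ?P) * real (card ?P) - real (card (?P \<inter> ?P)))\<bar> \<le> t"
    "\<bar>edges_between E ?P ?Q - p * (real (card ?P) * real (card ?Q) - real (card (?P \<inter> ?Q)))\<bar> \<le> t"
    using ok[unfolded jumbled_def, rule_format, OF conjI[OF block_subset block_subset]] by blast+
  ultimately have "p * (real (card ?P) * real (card ?P) - real (card ?P)) \<le> p * (real (card ?P) * real (card ?Q)) + 2 * t"
    using disj by simp
  then show ?thesis by (simp add: algebra_simps)
qed

end

section \<open>Labelled cuts and colourings\<close>

lemma cut_size_eq:
  assumes "E \<subseteq> pairs n" "\<And>v i. v < n \<Longrightarrow> i < r \<Longrightarrow> v \<in> P i \<longleftrightarrow> c v = i" "\<And>v. v < n \<Longrightarrow> c v < r"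
    "\<And>i. i < r \<Longrightarrow> P i \<subseteq> {..<n}"
  shows "cut_size r E P = card (E \<inter> cut_pairs n c)"
proof -
  have "{e \<in> E. \<exists>i<r. \<exists>j<r. i \<noteq> j \<and> (\<exists>u\<in>P i. \<exists>v\<in>P j. e = {u, v})} = E \<inter> cut_pairs n c"
  proof (intro set_eqI iffI)
    fix e assume "e \<in> {e \<in> E. \<exists>i<r. \<exists>j<r. i \<noteq> j \<and> (\<exists>u\<in>P i. \<exists>v\<in>P j. e = {u, v})}"
    then obtain i j u v where *: "e \<in> E" "i < r" "j < r" "i \<noteq> j" "u \<in> P i" "v \<in> P j" "e = {u, v}" by auto
    then have "u < n" "v < n" using assms(4) by blast+
    then show "e \<in> E \<inter> cut_pairs n c" using * assms(2)[of u i] assms(2)[of v j] by (auto simp: mem_cut_pairs)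
  next
    fix e assume e: "e \<in> E \<inter> cut_pairs n c"
    then obtain x y where xy: "e = {x, y}" "x < n" "y < n" using assms(1) pairs_cases by blast
    then have ne: "c x \<noteq> c y" using e by (auto simp: mem_cut_pairs)
    show "e \<in> {e \<in> E. \<exists>i<r. \<exists>j<r. i \<noteq> j \<and> (\<exists>u\<in>P i. \<exists>v\<in>P j. e = {u, v})}"
      using e xy ne assms(2)[of x "c x"] assms(2)[of y "c y"] assms(3)[of x] assms(3)[of y] by blast
  qed
  then show ?thesis by (simp add: cut_size_def)
qed

lemma is_cut_colouring:
  assumes "is_cut r {..<n} P"
  shows "\<exists>c\<in>colourings n r. (\<forall>v<n. \<forall>i<r. v \<in> P i \<longleftrightarrow> c v = i) \<and> (\<forall>i<r. P i = block n c i)"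
proof -
  have un: "(\<Union>i<r. P i) = {..<n}" and dj: "disjoint_family_on P {..<r}" using assms by (auto simp: is_cut_def)
  have "\<forall>v\<in>{..<n}. \<exists>i<r. v \<in> P i" using un by blast
  then obtain f where f: "\<And>v. v < n \<Longrightarrow> f v < r \<and> v \<in> P (f v)" by (metis lessThan_iff)
  define c where "c = restrict f {..<n}"
  have c: "c \<in> colourings n r" using f by (auto simp: colourings_def c_def)
  have iff: "v \<in> P i \<longleftrightarrow> c v = i" if "v < n" "i < r" for v i
    using f[OF that(1)] that dj unfolding disjoint_family_on_def c_def by auto
  have "P i = block n c i" if "i < r" for i
    using un that iff by (auto simp: block_def)
  then show ?thesis using c iff by blast
qed

lemma is_cut_block:
  assumes "c \<in> colourings n r"
  shows "is_cut r {..<n} (block n c)"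
  using assms by (auto simp: is_cut_def disjoint_family_on_def block_def colourings_def)

context cuts
begin

lemma cut_size_block:
  assumes "E \<subseteq> pairs n" "c \<in> colourings n r"
  shows "cut_size r E (block n c) = card (E \<inter> cut_pairs n c)"
  using assms colouring_less by (intro cut_size_eq) (auto simp: block_def)

lemma max_cut_eq:
  assumes E: "E \<subseteq> pairs n"
  shows "max_cut r {..<n} E = max_size E"
proof -
  have "{cut_size r E P |P. is_cut r {..<n} P} = (\<lambda>c. card (E \<inter> cut_pairs n c)) ` colourings n r"
  proof (intro set_eqI iffI)
    fix x assume "x \<in> {cut_size r E P |P. is_cut r {..<n} P}"
    then obtain P where P: "x = cut_size r E P" "is_cut r {..<n} P" by auto
    from P(2) obtain c where c: "c \<in> colourings n r" "\<forall>v<n. \<forall>i<r. v \<in> P i \<longleftrightarrow> c v = i"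
      "\<forall>i<r. P i = block n c i" using is_cut_colouring by blast
    have "x = card (E \<inter> cut_pairs n c)"
      unfolding P(1) using c colouring_less block_subset by (intro cut_size_eq[OF E]) auto
    then show "x \<in> (\<lambda>c. card (E \<inter> cut_pairs n c)) ` colourings n r" using c by auto
  next
    fix x assume "x \<in> (\<lambda>c. card (E \<inter> cut_pairs n c)) ` colourings n r"
    then obtain c where "c \<in> colourings n r" "x = cut_size r E (block n c)" using cut_size_block[OF E] by auto
    then show "x \<in> {cut_size r E P |P. is_cut r {..<n} P}" using is_cut_block by blast
  qed
  then show ?thesis by (simp add: max_cut_def max_size_def)
qed

lemma near_of_deficit:
  assumes E: "E \<subseteq> pairs n" and P: "is_cut r {..<n} P" "deficit r {..<n} E P \<le> d"
  obtains c where "near (real d) E c" "\<And>i. i < r \<Longrightarrow> P i = block n c i"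
proof -
  from P(1) obtain c where c: "c \<in> colourings n r" "\<forall>v<n. \<forall>i<r. v \<in> P i \<longleftrightarrow> c v = i"
      "\<forall>i<r. P i = block n c i" using is_cut_colouring by blast
  have "cut_size r E P = card (E \<inter> cut_pairs n c)"
    using c colouring_less block_subset by (intro cut_size_eq[OF E]) auto
  then have "near (real d) E c"
    using P(2) c(1) by (auto simp: near_def deficit_def max_cut_eq[OF E])
  then show ?thesis using that c by blast
qed

lemma deficit_of_near:
  assumes E: "E \<subseteq> pairs n" and c: "near (real d) E c"
  shows "is_cut r {..<n} (block n c)" "deficit r {..<n} E (block n c) \<le> d"
  using c is_cut_block[of c n r] cut_size_block[OF E, of c]
  by (auto simp: near_def deficit_def max_cut_eq[OF E])

end

section \<open>Perturbing the star of one vertex\<close>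

text \<open>
  The non-edges of \<open>E\<close> that join \<open>v\<close> to a vertex of colour \<open>j\<close>.
\<close>

definition slab :: "nat \<Rightarrow> nat \<Rightarrow> nat set set \<Rightarrow> (nat \<Rightarrow> nat) \<Rightarrow> nat \<Rightarrow> nat set set" where
  "slab n v E c j = (\<lambda>w. {v, w}) ` {w \<in> block n c j. w \<noteq> v \<and> {v, w} \<notin> E}"

lemma slab_subset: "v < n \<Longrightarrow> slab n v E c j \<subseteq> star n v - E"
  by (auto simp: slab_def star_def block_def)

lemma star_subset: "star n v \<subseteq> pairs n"
  by (auto simp: star_def)

lemma card_star_le: "v < n \<Longrightarrow> card (star n v) \<le> n"
proof -
  assume v: "v < n"
  have "card {e \<in> star n v. True} = card {y \<in> {..<n}. y \<noteq> v \<and> True}" by (rule card_star_filter[OF v])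
  also have "\<dots> \<le> card {..<n}" by (intro card_mono) auto
  finally show ?thesis by simp
qed

lemma slab_disjoint: "i \<noteq> j \<Longrightarrow> slab n v E c i \<inter> slab n v E c j = {}"
  by (auto simp: slab_def block_def doubleton_eq_iff)

context cuts
begin

lemma slab_cover:
  assumes c: "c \<in> colourings n r" and v: "v < n"
  shows "(\<Union>j<r. slab n v E c j) = star n v - E"
proof
  show "(\<Union>j<r. slab n v E c j) \<subseteq> star n v - E" using slab_subset[OF v] by blast
  show "star n v - E \<subseteq> (\<Union>j<r. slab n v E c j)"
  proof
    fix e assume e: "e \<in> star n v - E"
    then obtain y where y: "e = {v, y}" "y < n" "v \<noteq> y" by (auto elim: star_cases)
    then have "e \<in> slab n v E c (c y)" using e by (auto simp: slab_def block_def)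
    then show "e \<in> (\<Union>j<r. slab n v E c j)" using colouring_less[OF c y(2)] by auto
  qed
qed

lemma sum_card_slab:
  assumes c: "c \<in> colourings n r" and v: "v < n" and X: "finite X"
  shows "(\<Sum>j<r. card (slab n v E c j \<inter> X)) = card ((star n v - E) \<inter> X)"
proof -
  have "card (\<Union>j<r. slab n v E c j \<inter> X) = (\<Sum>j<r. card (slab n v E c j \<inter> X))"
    using X slab_disjoint by (intro card_UN_disjoint) blast+
  moreover have "(\<Union>j<r. slab n v E c j \<inter> X) = (star n v - E) \<inter> X"
    unfolding slab_cover[OF c v, of E, symmetric] by blast
  ultimately show ?thesis by simp
qed

text \<open>
  How much the cuts of deficit at most \<open>d\<close> in \<open>H\<close>, chosen separately for each part \<open>j\<close> of \<open>opt F\<close>, improve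
  on \<open>opt H\<close> in separating \<open>v\<close> from the vertices that are adjacent to it neither in \<open>F\<close> nor in \<open>H\<close>.
\<close>

definition gain :: "real \<Rightarrow> nat \<Rightarrow> nat set set \<Rightarrow> nat set set \<Rightarrow> real" where
  "gain d v F H = real (\<Sum>j<r. miss d (slab n v F (opt F) j) H)
      - real (card (star n v \<inter> cut_pairs n (opt H) - H - F))"

text \<open>
  The expectation over the exchangeable pair \<open>(F, H)\<close>, where \<open>F\<close> is the random graph and \<open>H\<close> arises
  from \<open>F\<close> by resampling each pair at \<open>v\<close> with probability \<open>\<epsilon>\<close>.
\<close>

definition pair_ex :: "real \<Rightarrow> real \<Rightarrow> nat \<Rightarrow> (nat set set \<Rightarrow> nat set set \<Rightarrow> real) \<Rightarrow> real" where
  "pair_ex p \<epsilon> v h = gnp_ex n p (\<lambda>F. bern_ex (pairs n) (resampled p (\<lambda>e. \<epsilon> * of_bool (e \<in> star n v)) F) (h F))"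

lemma pair_ex_swap: "pair_ex p \<epsilon> v h = pair_ex p \<epsilon> v (\<lambda>F H. h H F)"
  unfolding pair_ex_def by (rule resampled_reversible)

lemma pair_ex_single: "pair_ex p \<epsilon> v (\<lambda>F H. h H) = gnp_ex n p h"
  unfolding pair_ex_def by (rule resampled_invariant) simp

lemma pair_ex_add: "pair_ex p \<epsilon> v (\<lambda>F H. g F H + h F H) = pair_ex p \<epsilon> v g + pair_ex p \<epsilon> v h"
  by (simp add: pair_ex_def bern_ex_add)

lemma pair_ex_diff: "pair_ex p \<epsilon> v (\<lambda>F H. g F H - h F H) = pair_ex p \<epsilon> v g - pair_ex p \<epsilon> v h"
  by (simp add: pair_ex_def bern_ex_diff)

lemma pair_ex_cmult: "pair_ex p \<epsilon> v (\<lambda>F H. a * h F H) = a * pair_ex p \<epsilon> v h"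
  by (simp add: pair_ex_def bern_ex_cmult)

lemma resampled_star_range:
  assumes "0 \<le> p" "p \<le> 1" "0 \<le> \<epsilon>" "\<epsilon> \<le> 1"
  shows "0 \<le> resampled p (\<lambda>e. \<epsilon> * of_bool (e \<in> S)) F e \<and> resampled p (\<lambda>e. \<epsilon> * of_bool (e \<in> S)) F e \<le> 1"
  using assms by (intro resampled_range) auto

lemma pair_ex_mono:
  assumes "0 \<le> p" "p \<le> 1" "0 \<le> \<epsilon>" "\<epsilon> \<le> 1"
    "\<And>F H. F \<subseteq> pairs n \<Longrightarrow> H \<subseteq> pairs n \<Longrightarrow> g F H \<le> h F H"
  shows "pair_ex p \<epsilon> v g \<le> pair_ex p \<epsilon> v h"
  unfolding pair_ex_def using assms(1,2,5) resampled_star_range[OF assms(1-4), of "star n v"] by (intro bern_ex_mono) auto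

text \<open>
  Given \<open>H\<close>, an edge of \<open>H\<close> at \<open>v\<close> is a non-edge of \<open>F\<close> with probability \<open>\<epsilon> (1 - p)\<close>.
\<close>

lemma pair_ex_star_edges:
  assumes "v < n"
  shows "pair_ex p \<epsilon> v (\<lambda>F H. real (card (H \<inter> (star n v \<inter> cut_pairs n (opt H)) - F)))
     = \<epsilon> * (1 - p) * gnp_ex n p (\<lambda>H. real (card (H \<inter> (star n v \<inter> cut_pairs n (opt H)))))"
proof -
  have "bern_ex (pairs n) (resampled p (\<lambda>e. \<epsilon> * of_bool (e \<in> star n v)) H) (\<lambda>F. real (card (H \<inter> (star n v \<inter> cut_pairs n (opt H)) - F)))
      = \<epsilon> * (1 - p) * real (card (H \<inter> (star n v \<inter> cut_pairs n (opt H))))" (is "?L = _") for H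
  proof -
    let ?Y = "H \<inter> (star n v \<inter> cut_pairs n (opt H))"
    have "?L = (\<Sum>e\<in>?Y. 1 - resampled p (\<lambda>e. \<epsilon> * of_bool (e \<in> star n v)) H e)"
      by (rule bern_ex_card_Diff) (auto simp: star_def)
    also have "\<dots> = (\<Sum>e\<in>?Y. \<epsilon> * (1 - p))"
      by (intro sum.cong) (auto simp: resampled_def algebra_simps)
    finally show ?thesis by (simp add: mult.commute)
  qed
  then show ?thesis by (subst pair_ex_swap) (simp add: pair_ex_def bern_ex_cmult)
qed

lemma pair_ex_star_non_edges:
  assumes "v < n"
  shows "pair_ex p \<epsilon> v (\<lambda>F H. real (card (star n v \<inter> cut_pairs n (opt H) - H - F)))
     = (1 - \<epsilon> * p) * gnp_ex n p (\<lambda>H. real (card (star n v \<inter> cut_pairs n (opt H) - H)))"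
proof -
  have "bern_ex (pairs n) (resampled p (\<lambda>e. \<epsilon> * of_bool (e \<in> star n v)) H) (\<lambda>F. real (card (star n v \<inter> cut_pairs n (opt H) - H - F)))
      = (1 - \<epsilon> * p) * real (card (star n v \<inter> cut_pairs n (opt H) - H))" (is "?L = _") for H
  proof -
    let ?Y = "star n v \<inter> cut_pairs n (opt H) - H"
    have "?L = (\<Sum>e\<in>?Y. 1 - resampled p (\<lambda>e. \<epsilon> * of_bool (e \<in> star n v)) H e)"
      by (rule bern_ex_card_Diff) (auto simp: star_def)
    also have "\<dots> = (\<Sum>e\<in>?Y. 1 - \<epsilon> * p)"
      by (intro sum.cong) (auto simp: resampled_def)
    finally show ?thesis by (simp add: mult.commute)
  qed
  then show ?thesis by (subst pair_ex_swap) (simp add: pair_ex_def bern_ex_cmult)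
qed

text \<open>
  The addition inequality, applied conditionally on \<open>F\<close> to each slab of each vertex. A slab consists of
  non-edges of \<open>F\<close>, where \<open>H\<close> has parameter \<open>\<epsilon> p\<close>. The main terms add up to the difference between the
  numbers of edges and of non-edges of \<open>H\<close> that \<open>opt H\<close> separates, suitably weighted, which is at most \<open>disc p H\<close>; summing over
  all \<open>v\<close> counts every pair twice.
\<close>

lemma sum_gain_le:
  assumes p: "0 < p" "p \<le> 1" and eps: "0 < \<epsilon>" "\<epsilon> \<le> 1/2" and rho: "0 < \<rho>" "\<rho> \<le> 1" and d: "d \<ge> 0"
  shows "(\<Sum>v<n. pair_ex p \<epsilon> v (gain d v))
    \<le> real n * real r * d / (\<epsilon> * p * \<rho>) + real r * (real n)\<^sup>2 * \<rho> * sqrt (8 * real n * (\<epsilon> * p))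
      + 2 * gnp_ex n p (disc p) / p + 2 * \<rho> * (real n)\<^sup>2"
proof -
  define a where "a = \<epsilon> * p"
  define \<kappa> where "\<kappa> = a * \<rho> / (1 - a * (1 - \<rho>))"
  define w where "w = real n * \<rho> * sqrt (8 * real n * a)"
  have a: "0 < a" "a \<le> 1/2" using p eps mult_mono[of \<epsilon> "1/2" p 1] by (auto simp: a_def)
  have ar: "0 \<le> a * (1 - \<rho>)" "a * (1 - \<rho>) \<le> 1/2" "0 < a * \<rho>"
    using a rho mult_mono[of a "1/2" "1 - \<rho>" 1] by auto
  have \<kappa>1: "\<kappa> * (1 - a * (1 - \<rho>)) = a * \<rho>" unfolding \<kappa>_def using ar by simp
  have \<kappa>ge: "\<kappa> \<ge> a * \<rho>" unfolding \<kappa>_def using ar by (simp add: le_divide_eq mult_left_le)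
  then have \<kappa>0: "0 < \<kappa>" using ar by linarith
  have \<kappa>le: "\<kappa> \<le> 2 * (a * \<rho>)"
  proof -
    have "\<kappa> * (1/2) \<le> \<kappa> * (1 - a * (1 - \<rho>))" using \<kappa>0 ar by (intro mult_left_mono) auto
    then show ?thesis using \<kappa>1 by linarith
  qed
  have \<kappa>a: "\<kappa> * (1 - a) \<ge> a * \<rho> - 2 * a * \<rho>\<^sup>2"
  proof -
    have "\<kappa> * (1 - a) = a * \<rho> - \<kappa> * (a * \<rho>)" using \<kappa>1 by (simp add: algebra_simps)
    moreover have "\<kappa> * (a * \<rho>) \<le> 2 * (a * \<rho>) * (1 * \<rho>)"
      using \<kappa>le \<kappa>0 a rho by (intro mult_mono) auto
    ultimately show ?thesis by (simp add: power2_eq_square)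
  qed
  define ea where "ea v = gnp_ex n p (\<lambda>H. real (card (H \<inter> (star n v \<inter> cut_pairs n (opt H)))))" for v
  define eb where "eb v = gnp_ex n p (\<lambda>H. real (card (star n v \<inter> cut_pairs n (opt H) - H)))" for v
  have step: "\<kappa> * pair_ex p \<epsilon> v (gain d v) \<le> real r * d + \<kappa> * (real r * w) + \<rho> * (\<epsilon> * (1 - p)) * ea v - (a * \<rho> - 2 * a * \<rho>\<^sup>2) * eb v"
    if v: "v < n" for v
  proof -
    define q where "q F = resampled p (\<lambda>e. \<epsilon> * of_bool (e \<in> star n v)) F" for F
    have qr: "0 \<le> q F e \<and> q F e \<le> 1" for F e unfolding q_def using p eps by (intro resampled_star_range) auto
    have F: "\<kappa> * bern_ex (pairs n) (q F) (\<lambda>H. real (\<Sum>j<r. miss d (slab n v F (opt F) j) H))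
        \<le> real r * d + \<kappa> * (real r * w) + \<rho> * bern_ex (pairs n) (q F) (\<lambda>H. real (card (H \<inter> (star n v \<inter> cut_pairs n (opt H)) - F)))" for F
    proof -
      let ?S = "slab n v F (opt F)"
      have Ssub: "?S j \<subseteq> pairs n" for j using slab_subset[OF v] star_subset by blast
      have Scard: "card (?S j) \<le> n" for j
        using slab_subset[OF v, of F "opt F" j] card_star_le[OF v] star_subset[of n v]
        by (meson Diff_subset card_mono finite_pairs finite_subset order_trans)
      have "\<kappa> * bern_ex (pairs n) (q F) (\<lambda>H. real (miss d (?S j) H))
          \<le> d + \<kappa> * w + \<rho> * bern_ex (pairs n) (q F) (\<lambda>H. real (card (H \<inter> (?S j \<inter> cut_pairs n (opt H)))))" for j
      proof -
        have "real (card (?S j)) * \<rho> * sqrt (8 * real (card (?S j)) * a) \<le> w"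
          unfolding w_def using Scard[of j] rho a by (intro mult_mono real_sqrt_le_mono) auto
        then have "\<kappa> * (bern_ex (pairs n) (q F) (\<lambda>H. real (miss d (?S j) H)) - w)
           \<le> \<kappa> * (bern_ex (pairs n) (q F) (\<lambda>H. real (miss d (?S j) H)) - real (card (?S j)) * \<rho> * sqrt (8 * real (card (?S j)) * a))"
          using \<kappa>0 by (intro mult_left_mono) auto
        also have "\<dots> \<le> d + \<rho> * bern_ex (pairs n) (q F) (\<lambda>H. real (card (H \<inter> (?S j \<inter> cut_pairs n (opt H)))))"
        proof (rule addition_inequality[OF Ssub qr])
          fix e assume "e \<in> ?S j"
          then have "e \<in> star n v" "e \<notin> F" using slab_subset[OF v] by blast+
          then show "q F e = a" by (simp add: q_def resampled_def a_def)
        qed (use a rho d \<kappa>_def in auto)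
        finally show ?thesis by (simp add: algebra_simps)
      qed
      then have "(\<Sum>j<r. \<kappa> * bern_ex (pairs n) (q F) (\<lambda>H. real (miss d (?S j) H)))
         \<le> (\<Sum>j<r. d + \<kappa> * w + \<rho> * bern_ex (pairs n) (q F) (\<lambda>H. real (card (H \<inter> (?S j \<inter> cut_pairs n (opt H))))))"
        by (intro sum_mono)
      also have "\<dots> = real r * d + \<kappa> * (real r * w) + \<rho> * bern_ex (pairs n) (q F) (\<lambda>H. \<Sum>j<r. real (card (H \<inter> (?S j \<inter> cut_pairs n (opt H)))))"
        by (simp add: sum.distrib bern_ex_sum sum_distrib_left) (simp add: algebra_simps)
      also have "bern_ex (pairs n) (q F) (\<lambda>H. \<Sum>j<r. real (card (H \<inter> (?S j \<inter> cut_pairs n (opt H)))))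
          = bern_ex (pairs n) (q F) (\<lambda>H. real (card (H \<inter> (star n v \<inter> cut_pairs n (opt H)) - F)))"
      proof (intro bern_ex_cong refl)
        fix H assume H: "H \<subseteq> pairs n"
        have "(\<Sum>j<r. card (?S j \<inter> (H \<inter> cut_pairs n (opt H)))) = card ((star n v - F) \<inter> (H \<inter> cut_pairs n (opt H)))"
          using opt[of F] H v by (intro sum_card_slab) (auto intro: finite_subset[OF _ finite_pairs])
        also have "(star n v - F) \<inter> (H \<inter> cut_pairs n (opt H)) = H \<inter> (star n v \<inter> cut_pairs n (opt H)) - F" by auto
        finally show "(\<Sum>j<r. real (card (H \<inter> (?S j \<inter> cut_pairs n (opt H))))) = real (card (H \<inter> (star n v \<inter> cut_pairs n (opt H)) - F))"
          by (simp only: of_nat_sum[symmetric] Int_left_commute)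
      qed
      finally show ?thesis by (simp add: bern_ex_sum sum_distrib_left)
    qed
    have "\<kappa> * pair_ex p \<epsilon> v (\<lambda>F H. real (\<Sum>j<r. miss d (slab n v F (opt F) j) H))
       \<le> gnp_ex n p (\<lambda>F. real r * d + \<kappa> * (real r * w) + \<rho> * bern_ex (pairs n) (q F) (\<lambda>H. real (card (H \<inter> (star n v \<inter> cut_pairs n (opt H)) - F))))"
      unfolding pair_ex_def q_def[symmetric] bern_ex_cmult[symmetric]
      using p F by (intro bern_ex_mono) (auto simp: bern_ex_cmult)
    also have "\<dots> = real r * d + \<kappa> * (real r * w) + \<rho> * pair_ex p \<epsilon> v (\<lambda>F H. real (card (H \<inter> (star n v \<inter> cut_pairs n (opt H)) - F)))"
      by (simp add: pair_ex_def q_def bern_ex_add bern_ex_const bern_ex_cmult)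
    finally have "\<kappa> * pair_ex p \<epsilon> v (\<lambda>F H. real (\<Sum>j<r. miss d (slab n v F (opt F) j) H))
       \<le> real r * d + \<kappa> * (real r * w) + \<rho> * (\<epsilon> * (1 - p)) * ea v"
      unfolding pair_ex_star_edges[OF v] ea_def[symmetric] by (simp add: mult.assoc)
    moreover have "\<kappa> * pair_ex p \<epsilon> v (gain d v) = \<kappa> * pair_ex p \<epsilon> v (\<lambda>F H. real (\<Sum>j<r. miss d (slab n v F (opt F) j) H))
        - \<kappa> * (1 - a) * eb v"
    proof -
      have "pair_ex p \<epsilon> v (gain d v) = pair_ex p \<epsilon> v (\<lambda>F H. real (\<Sum>j<r. miss d (slab n v F (opt F) j) H)) - (1 - a) * eb v"
        unfolding gain_def[abs_def] pair_ex_diff pair_ex_star_non_edges[OF v] a_def eb_def ..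
      then show ?thesis by (simp add: right_diff_distrib mult.assoc)
    qed
    moreover have "(a * \<rho> - 2 * a * \<rho>\<^sup>2) * eb v \<le> \<kappa> * (1 - a) * eb v"
      using \<kappa>a by (intro mult_right_mono) (auto simp: eb_def p less_imp_le intro!: bern_ex_nonneg)
    ultimately show ?thesis by linarith
  qed
  define A where "A = gnp_ex n p (\<lambda>H. real (max_size H))"
  define B where "B = gnp_ex n p (\<lambda>H. real (card (cut_pairs n (opt H) - H)))"
  define \<Delta> where "\<Delta> = gnp_ex n p (disc p)"
  have sub: "cut_pairs n c \<subseteq> pairs n" for c by (auto simp: cut_pairs_def)
  have sa: "(\<Sum>v<n. ea v) = 2 * A"
  proof -
    have "(\<Sum>v<n. card (H \<inter> (star n v \<inter> cut_pairs n (opt H)))) = 2 * max_size H" for H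
    proof -
      have "(\<Sum>v<n. card ((H \<inter> cut_pairs n (opt H)) \<inter> star n v)) = 2 * card (H \<inter> cut_pairs n (opt H))"
        using sub by (intro sum_card_star) auto
      then show ?thesis using opt[of H] by (simp add: Int_ac)
    qed
    then have "(\<Sum>v<n. real (card (H \<inter> (star n v \<inter> cut_pairs n (opt H))))) = 2 * real (max_size H)" for H
      unfolding of_nat_sum[symmetric] by simp
    then show ?thesis unfolding ea_def A_def bern_ex_sum[symmetric] bern_ex_cmult[symmetric] by simp
  qed
  have sb: "(\<Sum>v<n. eb v) = 2 * B"
  proof -
    have "(\<Sum>v<n. card (star n v \<inter> cut_pairs n (opt H) - H)) = 2 * card (cut_pairs n (opt H) - H)" for H
    proof -
      have "(\<Sum>v<n. card ((cut_pairs n (opt H) - H) \<inter> star n v)) = 2 * card (cut_pairs n (opt H) - H)"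
        using sub by (intro sum_card_star) auto
      moreover have "(cut_pairs n (opt H) - H) \<inter> star n v = star n v \<inter> cut_pairs n (opt H) - H" for v by auto
      ultimately show ?thesis by simp
    qed
    then have "(\<Sum>v<n. real (card (star n v \<inter> cut_pairs n (opt H) - H))) = 2 * real (card (cut_pairs n (opt H) - H))" for H
      unfolding of_nat_sum[symmetric] by simp
    then show ?thesis unfolding eb_def B_def bern_ex_sum[symmetric] bern_ex_cmult[symmetric] by simp
  qed
  \<comment> \<open>Here the main terms cancel up to the discrepancy.\<close>
  have AB: "(1 - p) * A - p * B \<le> \<Delta>"
  proof -
    have "(1 - p) * A - p * B = gnp_ex n p (\<lambda>H. (1 - p) * real (max_size H) - p * real (card (cut_pairs n (opt H) - H)))"
      by (simp add: A_def B_def bern_ex_diff bern_ex_cmult)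
    also have "\<dots> \<le> gnp_ex n p (disc p)"
    proof (intro bern_ex_mono)
      fix H
      have "card (cut_pairs n (opt H)) = card (H \<inter> cut_pairs n (opt H)) + card (cut_pairs n (opt H) - H)"
        using card_Int_Diff[OF finite_subset[OF sub finite_pairs], of "opt H" H] by (simp add: Int_commute)
      then have "(1 - p) * real (max_size H) - p * real (card (cut_pairs n (opt H) - H))
          = real (card (H \<inter> cut_pairs n (opt H))) - p * real (card (cut_pairs n (opt H)))"
        using opt[of H] by (simp add: algebra_simps)
      also have "\<dots> \<le> disc p H" using disc_ge[of "opt H" H p] opt[of H] by auto
      finally show "(1 - p) * real (max_size H) - p * real (card (cut_pairs n (opt H) - H)) \<le> disc p H" .
    qed (use p in auto)
    finally show ?thesis by (simp add: \<Delta>_def)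
  qed
  have B: "B \<le> (real n)\<^sup>2 / 2"
  proof -
    have "B \<le> gnp_ex n p (\<lambda>H. (real n)\<^sup>2 / 2)"
      unfolding B_def
    proof (intro bern_ex_mono)
      fix H
      have "card (cut_pairs n (opt H) - H) \<le> card (pairs n)" using sub by (intro card_mono) auto
      then show "real (card (cut_pairs n (opt H) - H)) \<le> (real n)\<^sup>2 / 2" using card_pairs[of n] by linarith
    qed (use p in auto)
    then show ?thesis by (simp add: bern_ex_const)
  qed
  have \<Delta>0: "0 \<le> \<Delta>" unfolding \<Delta>_def using p disc_nonneg by (intro bern_ex_nonneg) auto
  define X where "X = real n * real r * d + 2 * \<rho> * \<epsilon> * \<Delta> + 2 * a * \<rho>\<^sup>2 * (real n)\<^sup>2"
  define Z where "Z = (\<Sum>v<n. pair_ex p \<epsilon> v (gain d v))"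
  have "\<kappa> * Z = (\<Sum>v<n. \<kappa> * pair_ex p \<epsilon> v (gain d v))" by (simp add: Z_def sum_distrib_left)
  also have "\<dots> \<le> (\<Sum>v<n. real r * d + \<kappa> * (real r * w) + \<rho> * (\<epsilon> * (1 - p)) * ea v - (a * \<rho> - 2 * a * \<rho>\<^sup>2) * eb v)"
    using step by (intro sum_mono) auto
  also have "\<dots> = real n * (real r * d) + real n * (\<kappa> * (real r * w)) + \<rho> * (\<epsilon> * (1 - p)) * (2 * A) - (a * \<rho> - 2 * a * \<rho>\<^sup>2) * (2 * B)"
    by (simp only: sum_subtractf sum.distrib sum_distrib_left[symmetric] sa sb sum_constant card_lessThan)
      (simp add: mult.left_commute)
  also have "\<dots> = real n * (real r * d) + real n * (\<kappa> * (real r * w)) + 2 * \<rho> * \<epsilon> * ((1 - p) * A - p * B) + 4 * a * \<rho>\<^sup>2 * B"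
    by (simp add: a_def algebra_simps)
  also have "\<dots> \<le> real n * (real r * d) + real n * (\<kappa> * (real r * w)) + 2 * \<rho> * \<epsilon> * \<Delta> + 4 * a * \<rho>\<^sup>2 * ((real n)\<^sup>2 / 2)"
    using AB B rho eps a by (intro order_refl add_mono mult_left_mono) auto
  also have "\<dots> = X + \<kappa> * (real n * real r * w)" by (simp add: X_def algebra_simps)
  finally have "\<kappa> * (Z - real n * real r * w) \<le> X" by (simp add: algebra_simps)
  then have "Z - real n * real r * w \<le> X / \<kappa>" using \<kappa>0 by (simp add: le_divide_eq mult.commute)
  also have "\<dots> \<le> X / (a * \<rho>)"
  proof (rule divide_left_mono[OF \<kappa>ge])
    show "0 \<le> X" using \<Delta>0 d rho eps a by (auto simp: X_def)
    show "0 < \<kappa> * (a * \<rho>)" using \<kappa>0 ar(3) by (rule mult_pos_pos)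
  qed
  also have "\<dots> = real n * real r * d / (\<epsilon> * p * \<rho>) + 2 * \<Delta> / p + 2 * \<rho> * (real n)\<^sup>2"
    using p eps rho by (simp add: X_def a_def add_divide_distrib power2_eq_square)
  finally show ?thesis unfolding Z_def w_def \<Delta>_def a_def by (simp add: power2_eq_square algebra_simps)
qed

end

section \<open>From tight vertices to a core\<close>

lemma card_mult_le_pairs:
  assumes "finite M" "finite A" "finite B" "A \<inter> B = {}" "\<And>a b. a \<in> A \<Longrightarrow> b \<in> B \<Longrightarrow> {a, b} \<in> M"
  shows "card A * card B \<le> card M"
proof -
  have "card (A \<times> B) \<le> card M"
  proof (rule card_inj_on_le)
    show "inj_on (\<lambda>(a, b). {a, b}) (A \<times> B)"
      using assms(4) by (auto simp: inj_on_def doubleton_eq_iff)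
    show "(\<lambda>(a, b). {a, b}) ` (A \<times> B) \<subseteq> M" using assms(5) by auto
  qed fact
  then show ?thesis by (simp add: card_cartesian_product)
qed

context cuts
begin

text \<open>
  A pair with one end in the intersection of two parts, one from each cut, and the other end in their
  difference is separated by exactly one of the two cuts.
\<close>

lemma block_overlap:
  shows "card (block n c i \<inter> block n c' k) * card (block n c i - block n c' k)
      \<le> card (sym_diff (cut_pairs n c) (cut_pairs n c'))"
    and "card (block n c i \<inter> block n c' k) * card (block n c' k - block n c i)
      \<le> card (sym_diff (cut_pairs n c) (cut_pairs n c'))"
proof -
  have fin: "finite (sym_diff (cut_pairs n c) (cut_pairs n c'))"
    by (rule finite_subset[OF _ finite_pairs]) (auto simp: cut_pairs_def)
  show "card (block n c i \<inter> block n c' k) * card (block n c i - block n c' k)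
      \<le> card (sym_diff (cut_pairs n c) (cut_pairs n c'))"
    by (rule card_mult_le_pairs[OF fin]) (auto simp: mem_cut_pairs block_def)
  show "card (block n c i \<inter> block n c' k) * card (block n c' k - block n c i)
      \<le> card (sym_diff (cut_pairs n c) (cut_pairs n c'))"
    by (rule card_mult_le_pairs[OF fin]) (auto simp: mem_cut_pairs block_def)
qed

lemma sum_card_blocks:
  assumes "c \<in> colourings n r" "X \<subseteq> {..<n}"
  shows "(\<Sum>j<r. card (X \<inter> block n c j)) = card X"
proof -
  have fin: "finite X" using assms(2) finite_subset by blast
  have "card (\<Union>j<r. X \<inter> block n c j) = (\<Sum>j<r. card (X \<inter> block n c j))"
    using fin by (intro card_UN_disjoint) (auto simp: block_def)
  moreover have "(\<Union>j<r. X \<inter> block n c j) = X"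
    using assms colouring_less[OF assms(1)] by (auto simp: block_def)
  ultimately show ?thesis by simp
qed

lemma opt_degree:
  assumes H: "H \<subseteq> pairs n" and v: "v < n"
  shows "r * deg_to H v (block n (opt H) (opt H v)) \<le> deg_to H v {..<n}"
proof -
  let ?P = "opt H"
  have P: "near 0 H ?P" "?P \<in> colourings n r" using near_opt[of 0 H] opt[of H] by auto
  have "(\<Sum>j<r. deg_to H v (block n ?P (?P v))) \<le> (\<Sum>j<r. deg_to H v (block n ?P j))"
    using near_local_optimum[OF P(1) v _ H] by (intro sum_mono) auto
  also have "\<dots> = (\<Sum>j<r. card ({y \<in> {..<n}. {v, y} \<in> H} \<inter> block n ?P j))"
    unfolding deg_to_def by (intro sum.cong arg_cong[of _ _ card]) (auto simp: block_def)
  also have "\<dots> = deg_to H v {..<n}"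
    unfolding deg_to_def by (rule sum_card_blocks[OF P(2)]) auto
  finally show ?thesis by simp
qed

text \<open>
  In the definition of the gain, use the cut \<open>Q\<close> for part \<open>j\<close> and \<open>opt H\<close> for all other parts.
\<close>

lemma gain_ge:
  assumes v: "v < n" and j: "j < r" and d: "d \<ge> 0" and Q: "near d H Q"
  shows "gain d v F H \<ge> real (card (slab n v F (opt F) j \<inter> cut_pairs n Q - H))
      - real (card (slab n v F (opt F) j \<inter> cut_pairs n (opt H) - H))"
proof -
  let ?S = "slab n v F (opt F)" and ?A = "cut_pairs n"
  have W: "opt F \<in> colourings n r" using opt by auto
  have "card (star n v \<inter> ?A (opt H) - H - F) = (\<Sum>i<r. card (?S i \<inter> ?A (opt H) - H))"
  proof -
    have "(\<Sum>i<r. card (?S i \<inter> (?A (opt H) - H))) = card ((star n v - F) \<inter> (?A (opt H) - H))"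
      by (rule sum_card_slab[OF W v]) (rule finite_subset[OF _ finite_pairs], auto simp: cut_pairs_def)
    also have "(star n v - F) \<inter> (?A (opt H) - H) = star n v \<inter> ?A (opt H) - H - F" by auto
    finally show ?thesis by (simp add: Int_Diff)
  qed
  also have "\<dots> = card (?S j \<inter> ?A (opt H) - H) + (\<Sum>i\<in>{..<r} - {j}. card (?S i \<inter> ?A (opt H) - H))"
    using j by (intro sum.remove) auto
  also have "\<dots> \<le> card (?S j \<inter> ?A (opt H) - H) + (\<Sum>i\<in>{..<r} - {j}. miss d (?S i) H)"
    using near_opt[OF d] by (intro add_left_mono sum_mono miss_ge)
  finally have 1: "card (star n v \<inter> ?A (opt H) - H - F) \<le> card (?S j \<inter> ?A (opt H) - H) + (\<Sum>i\<in>{..<r} - {j}. miss d (?S i) H)" .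
  have "(\<Sum>i<r. miss d (?S i) H) = miss d (?S j) H + (\<Sum>i\<in>{..<r} - {j}. miss d (?S i) H)"
    using j by (intro sum.remove) auto
  then have "(\<Sum>i<r. miss d (?S i) H) + card (?S j \<inter> ?A (opt H) - H) \<ge> card (?S j \<inter> ?A Q - H) + card (star n v \<inter> ?A (opt H) - H - F)"
    using 1 miss_ge[OF Q, of "?S j"] by linarith
  then have "real ((\<Sum>i<r. miss d (?S i) H) + card (?S j \<inter> ?A (opt H) - H)) \<ge> real (card (?S j \<inter> ?A Q - H) + card (star n v \<inter> ?A (opt H) - H - F))"
    by (rule of_nat_mono)
  then show ?thesis unfolding gain_def by simp
qed

lemma gain_nonneg:
  assumes v: "v < n" and d: "d \<ge> 0"
  shows "gain d v F H \<ge> 0"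
  using gain_ge[OF v _ d near_opt[OF d], of 0 F H] r by simp

lemma gain_ge_overlap:
  assumes v: "v < n" and j: "j < r" and d: "d \<ge> 0" and Q: "near d H Q" and F: "F \<subseteq> pairs n"
  defines "X \<equiv> block n (opt H) (opt H v)" and "W \<equiv> block n (opt F) j"
  shows "gain d v F H \<ge> real (card X) - real (card (X - W)) - real (card (X \<inter> block n Q (Q v)))
     - real (deg_to H v X) - real (card (star n v \<inter> F - H)) - real (card (W - X))"
proof -
  let ?S = "slab n v F (opt F) j"
  \<comment> \<open>The other ends of those pairs of the slab that \<open>Q\<close> separates and \<open>H\<close> does not contain.\<close>
  define Y where "Y = {w \<in> W. w \<noteq> v \<and> {v, w} \<notin> F \<and> {v, w} \<notin> H \<and> Q w \<noteq> Q v}"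
  have fin: "finite X" "finite W" by (auto simp: X_def W_def)
  have "?S \<inter> cut_pairs n Q - H = (\<lambda>w. {v, w}) ` Y"
    using v by (auto simp: slab_def Y_def W_def mem_cut_pairs block_def)
  then have c1: "card (?S \<inter> cut_pairs n Q - H) = card Y"
    by (simp only:) (rule card_star_image, auto simp: Y_def W_def block_def)
  have "?S \<inter> cut_pairs n (opt H) - H \<subseteq> (\<lambda>w. {v, w}) ` (W - X)"
    using v by (auto simp: slab_def X_def W_def mem_cut_pairs block_def)
  then have c2: "card (?S \<inter> cut_pairs n (opt H) - H) \<le> card (W - X)"
    using fin by (meson card_image_le card_mono finite_Diff finite_imageI order_trans)
  have c3: "card {y \<in> {..<n}. y \<noteq> v \<and> {v, y} \<in> F - H} = card (star n v \<inter> F - H)"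
  proof -
    have "star n v \<inter> F - H = {e \<in> star n v. e \<in> F - H}" by auto
    then show ?thesis using card_star_filter[OF v, of "\<lambda>e. e \<in> F - H"] by simp
  qed
  let ?Z = "{y \<in> {..<n}. y \<noteq> v \<and> {v, y} \<in> F - H}"
  have "X \<subseteq> Y \<union> (X - W) \<union> (X \<inter> block n Q (Q v)) \<union> {y \<in> X. {v, y} \<in> H} \<union> ?Z"
    by (auto simp: Y_def block_def X_def)
  moreover have "finite (Y \<union> (X - W) \<union> (X \<inter> block n Q (Q v)) \<union> {y \<in> X. {v, y} \<in> H} \<union> ?Z)"
    using fin by (auto simp: Y_def)
  ultimately have "card X \<le> card (Y \<union> (X - W) \<union> (X \<inter> block n Q (Q v)) \<union> {y \<in> X. {v, y} \<in> H} \<union> ?Z)"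
    by (rule card_mono[rotated])
  also have "\<dots> \<le> card Y + card (X - W) + card (X \<inter> block n Q (Q v)) + card {y \<in> X. {v, y} \<in> H} + card ?Z"
    by (intro order_trans[OF card_Un_le] add_right_mono order_refl)
  finally have "card X \<le> card Y + card (X - W) + card (X \<inter> block n Q (Q v)) + deg_to H v X + card (star n v \<inter> F - H)"
    unfolding c3 deg_to_def .
  then show ?thesis using gain_ge[OF v j d Q, of F] c1 c2 by linarith
qed

text \<open>
  Some cut of deficit at most \<open>d\<close> gives \<open>v\<close> a part that meets the part of \<open>v\<close> in \<open>opt H\<close> in at most
  \<open>g\<close> vertices.
\<close>

definition loose :: "real \<Rightarrow> real \<Rightarrow> nat set set \<Rightarrow> nat \<Rightarrow> bool" where
  "loose d g H v \<longleftrightarrow> (\<exists>Q. near d H Q \<and> real (card (block n (opt H) (opt H v) \<inter> block n Q (Q v))) \<le> g)"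

text \<open>
  All parts of the chosen maximum cut have at least \<open>n / r - z n\<close> vertices.
\<close>

definition balanced :: "real \<Rightarrow> nat set set \<Rightarrow> bool" where
  "balanced z H \<longleftrightarrow> (\<forall>i<r. real (card (block n (opt H) i)) \<ge> real n / real r - z * real n)"

text \<open>
  If the cuts of deficit at most \<open>L\<close> in \<open>H\<close>, among them \<open>opt F\<close>, are macroscopically equal to \<open>opt H\<close>, then
  one part of \<open>opt F\<close> nearly coincides with the part of \<open>v\<close> in \<open>opt H\<close>. If moreover \<open>v\<close> is loose, some cut of
  deficit at most \<open>d\<close> separates \<open>v\<close> from nearly all of this part, whereas \<open>opt H\<close> separates it from almost none,
  and the gain is linear in \<open>n\<close>.
\<close>

lemma loose_gain:
  fixes c :: real
  assumes v: "v < n" and d: "0 \<le> d" "d \<le> L" and F: "F \<subseteq> pairs n" and H: "H \<subseteq> pairs n"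
    and c: "0 < c" "c \<le> 1" and p: "p \<le> 1 - c"
    and nf: "\<not> far L (c / (64 * real r ^ 3) * (real n)\<^sup>2) H"
    and bal: "balanced z H" and z: "z \<le> c / (8 * real r)"
    and dg: "real (deg_to H v {..<n}) \<le> (p + c / 4) * real n"
    and Def: "real (max_size H) - real (card (H \<inter> cut_pairs n (opt F))) \<le> L"
    and FH: "real (card (star n v \<inter> F - H)) \<le> c * real n / (16 * real r)"
    and loose: "loose d (c / (16 * real r) * real n) H v"
  shows "gain d v F H \<ge> c * real n / (4 * real r)"
proof -
  define N where "N = real n / real r"
  define X where "X = block n (opt H) (opt H v)"
  have r0: "real r \<ge> 2" using r by simp
  have n0: "real n > 0" using v by simp
  have N0: "N > 0" using n0 r0 by (simp add: N_def)
  obtain Q where Q: "near d H Q" "real (card (X \<inter> block n Q (Q v))) \<le> c / 16 * N"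
    using loose by (auto simp: loose_def X_def N_def)
  have W: "near L H (opt F)" "opt F \<in> colourings n r" using Def opt[of F] by (auto simp: near_def)
  have HI: "opt H \<in> colourings n r" using opt by auto
  have sd: "real (card (sym_diff (cut_pairs n (opt H)) (cut_pairs n (opt F)))) \<le> c / (64 * real r) * N\<^sup>2"
  proof -
    have "real (card (sym_diff (cut_pairs n (opt F)) (cut_pairs n (opt H)))) < c / (64 * real r ^ 3) * (real n)\<^sup>2"
      using nf W unfolding far_def by (meson not_le)
    also have "\<dots> = c / (64 * real r) * N\<^sup>2" using r0 by (simp add: N_def power2_eq_square power3_eq_cube)
    finally show ?thesis by (simp add: Un_commute)
  qed
  have X1: "real (card X) \<ge> N * (1 - c / 8)"
  proof -
    have "real (card X) \<ge> real n / real r - z * real n"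
      using bal colouring_less[OF HI v] by (auto simp: balanced_def X_def)
    moreover have "z * real n \<le> c / (8 * real r) * real n" using z n0 by (intro mult_right_mono) auto
    ultimately show ?thesis by (simp add: N_def algebra_simps)
  qed
  have X2: "real (card X) \<ge> N / 2"
  proof -
    have "N * (1/2) \<le> N * (1 - c / 8)" using N0 c by (intro mult_left_mono) auto
    then show ?thesis using X1 by linarith
  qed
  \<comment> \<open>Some part of \<open>opt F\<close> contains at least a fraction \<open>1 / r\<close> of \<open>X\<close>; by the overlap bound it then
    contains nearly all of \<open>X\<close> and little else.\<close>
  have "\<exists>j<r. real r * real (card (X \<inter> block n (opt F) j)) \<ge> real (card X)"
  proof (rule ccontr)
    assume "\<not> ?thesis"
    then have "(\<Sum>j<r. real r * real (card (X \<inter> block n (opt F) j))) < (\<Sum>j<r. real (card X))"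
      using r by (intro sum_strict_mono) (auto simp: not_le lessThan_empty_iff)
    moreover have "(\<Sum>j<r. real r * real (card (X \<inter> block n (opt F) j))) = real r * real (\<Sum>j<r. card (X \<inter> block n (opt F) j))"
      by (simp add: sum_distrib_left)
    moreover have "(\<Sum>j<r. card (X \<inter> block n (opt F) j)) = card X"
      by (rule sum_card_blocks[OF W(2)]) (auto simp: X_def block_def)
    ultimately show False by simp
  qed
  then obtain j where j: "j < r" "real r * real (card (X \<inter> block n (opt F) j)) \<ge> real (card X)" by blast
  define Wj where "Wj = block n (opt F) j"
  have big: "real (card (X \<inter> Wj)) \<ge> N / (2 * real r)"
    using j(2) X2 r0 by (simp add: Wj_def field_simps)
  have small: "real y \<le> c / 32 * N" if "card (X \<inter> Wj) * y \<le> card (sym_diff (cut_pairs n (opt H)) (cut_pairs n (opt F)))" for y :: nat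
  proof -
    have "N / (2 * real r) * real y \<le> real (card (X \<inter> Wj)) * real y" using big by (intro mult_right_mono) auto
    also have "\<dots> = real (card (X \<inter> Wj) * y)" by simp
    also have "\<dots> \<le> real (card (sym_diff (cut_pairs n (opt H)) (cut_pairs n (opt F))))"
      using that by (rule of_nat_mono)
    also have "\<dots> \<le> c / (64 * real r) * N\<^sup>2" by (rule sd)
    also have "\<dots> = N / (2 * real r) * (c / 32 * N)" by (simp add: power2_eq_square)
    finally have le: "N / (2 * real r) * real y \<le> N / (2 * real r) * (c / 32 * N)" .
    have "0 < N / (2 * real r)" using N0 r0 by simp
    then show ?thesis using le by (simp only: mult_le_cancel_left_pos)
  qed
  have s1: "real (card (X - Wj)) \<le> c / 32 * N" "real (card (Wj - X)) \<le> c / 32 * N"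
    using block_overlap[of "opt H" "opt H v" "opt F" j] unfolding X_def[symmetric] Wj_def[symmetric]
    by (blast intro: small)+
  have dX: "real (deg_to H v X) \<le> (1 - 3 * c / 4) * N"
  proof -
    have "real r * real (deg_to H v X) \<le> real (deg_to H v {..<n})"
      using of_nat_mono[OF opt_degree[OF H v], where 'a = real] by (simp add: X_def)
    also have "\<dots> \<le> (p + c / 4) * real n" by (rule dg)
    also have "\<dots> \<le> (1 - 3 * c / 4) * real n" using p n0 by (intro mult_right_mono) auto
    finally show ?thesis using r0 by (simp add: N_def field_simps)
  qed
  have FH': "real (card (star n v \<inter> F - H)) \<le> c / 16 * N" using FH by (simp add: N_def)
  have "gain d v F H \<ge> N * (1 - c / 8) - c / 32 * N - c / 16 * N - (1 - 3 * c / 4) * N - c / 16 * N - c / 32 * N"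
    using gain_ge_overlap[OF v j(1) d(1) Q(1) F, folded X_def Wj_def] X1 s1 dX FH' Q(2) by linarith
  moreover have "N * (1 - c / 8) - c / 32 * N - c / 16 * N - (1 - 3 * c / 4) * N - c / 16 * N - c / 32 * N = (c * N) * (7/16)"
    by (simp add: field_simps)
  moreover have "(c * N) * (1/4) \<le> (c * N) * (7/16)" using c N0 by (intro mult_left_mono) auto
  ultimately show ?thesis by (simp add: N_def)
qed

text \<open>
  If \<open>v\<close> is not loose, then by macroscopic stability its part in any cut of deficit at most \<open>d\<close> nearly
  coincides with its part in \<open>opt H\<close>. So two vertices that are not loose lie in the same part of such a cut
  if and only if they do so in \<open>opt H\<close>.
\<close>

lemma core_of_few_loose:
  fixes c z \<beta> \<alpha> :: real
  assumes n: "n > 0" and H: "H \<subseteq> pairs n" and c: "0 < c" "c \<le> 1"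
    and nf: "\<not> far (real d) (c / (64 * real r ^ 3) * (real n)\<^sup>2) H"
    and bal: "balanced z H" and z: "z + \<beta> < \<alpha>" "z + \<beta> < 1 / real r" "z \<le> 1 / (2 * real r)"
    and few: "real (card {v \<in> {..<n}. loose (real d) (c / (16 * real r) * real n) H v}) \<le> \<beta> * real n"
  shows "admits_core d r \<alpha> {..<n} H"
proof -
  define P where "P = opt H"
  define bad where "bad = {v \<in> {..<n}. loose (real d) (c / (16 * real r) * real n) H v}"
  define S where "S i = block n P i - bad" for i
  have r0: "real r \<ge> 2" using r by simp
  have n0: "real n > 0" using n by simp
  have PI: "P \<in> colourings n r" using opt by (auto simp: P_def)
  have parts: "real (card (block n P i)) \<ge> real n / real r - z * real n" if "i < r" for i
    using bal that by (auto simp: balanced_def P_def)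
  have cardS: "real (card (S i)) \<ge> real n / real r - (z + \<beta>) * real n" if "i < r" for i
  proof -
    have "card (block n P i) \<le> card (S i) + card bad"
      by (rule order_trans[OF _ card_Un_le]) (auto intro!: card_mono simp: S_def bad_def)
    then show ?thesis using parts[OF that] few by (simp add: bad_def algebra_simps)
  qed
  have S_ne: "S i \<noteq> {}" if "i < r" for i
  proof
    assume "S i = {}"
    then have "real n / real r - (z + \<beta>) * real n \<le> 0" using cardS[OF that] by simp
    moreover have "(z + \<beta>) * real n < 1 / real r * real n" using z n0 by (intro mult_strict_right_mono) auto
    ultimately show False by simp
  qed
  have half: "real (card (block n P i)) \<ge> real n / (2 * real r)" if "i < r" for i
  proof -
    have "z * real n \<le> 1 / (2 * real r) * real n" using z n0 by (intro mult_right_mono) auto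
    then show ?thesis using parts[OF that] by (simp add: field_simps)
  qed
  have tight: "real (card (block n P (P v) - block n Q (Q v))) < real n / (4 * real r)"
     "real (card (block n Q (Q v) - block n P (P v))) < real n / (4 * real r)"
    if v: "v < n" "v \<notin> bad" and Q: "near (real d) H Q" for v Q
  proof -
    define g where "g = c / (16 * real r) * real n"
    have g: "g > 0" using c r0 n0 by (simp add: g_def)
    let ?I = "block n P (P v) \<inter> block n Q (Q v)"
    have I: "real (card ?I) > g"
      using v Q unfolding bad_def loose_def g_def P_def by (force simp: not_le)
    have sd: "real (card (sym_diff (cut_pairs n P) (cut_pairs n Q))) < g * (real n / (4 * (real r)\<^sup>2))"
    proof -
      have "real (card (sym_diff (cut_pairs n Q) (cut_pairs n P))) < c / (64 * real r ^ 3) * (real n)\<^sup>2"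
        using nf Q unfolding far_def P_def by (meson not_le)
      then show ?thesis by (simp add: Un_commute g_def power2_eq_square power3_eq_cube)
    qed
    have fin: "real y < real n / (4 * real r)" if y: "card ?I * y \<le> card (sym_diff (cut_pairs n P) (cut_pairs n Q))" for y :: nat
    proof -
      have "g * real y \<le> real (card ?I) * real y" using I by (intro mult_right_mono) auto
      also have "\<dots> = real (card ?I * y)" by simp
      also have "\<dots> \<le> real (card (sym_diff (cut_pairs n P) (cut_pairs n Q)))" using y by (rule of_nat_mono)
      also have "\<dots> < g * (real n / (4 * (real r)\<^sup>2))" by (rule sd)
      finally have "real y < real n / (4 * (real r)\<^sup>2)" using g by (simp only: mult_less_cancel_left_pos)
      also have "\<dots> \<le> real n / (4 * real r)"
        using r0 n0 by (intro divide_left_mono) (auto simp: power2_eq_square)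
      finally show ?thesis .
    qed
    show "real (card (block n P (P v) - block n Q (Q v))) < real n / (4 * real r)"
     "real (card (block n Q (Q v) - block n P (P v))) < real n / (4 * real r)"
      using block_overlap[of P "P v" Q "Q v"] by (blast intro: fin)+
  qed
  show ?thesis unfolding admits_core_def
  proof (intro exI[of _ S] conjI allI impI)
    show "disjoint_family_on S {..<r}" by (auto simp: disjoint_family_on_def S_def block_def)
    show "S i \<subseteq> {..<n}" for i by (auto simp: S_def block_def)
    show "(1 / real r - \<alpha>) * real (card {..<n}) < real (card (S i))" if "i < r" for i
    proof -
      have "(z + \<beta>) * real n < \<alpha> * real n" using z n0 by (intro mult_strict_right_mono) auto
      then show ?thesis using cardS[OF that] by (simp add: algebra_simps)
    qed
    fix R assume R: "is_cut r {..<n} R \<and> deficit r {..<n} H R \<le> d"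
    then obtain Q where Q: "near (real d) H Q" and RQ: "\<And>i. i < r \<Longrightarrow> R i = block n Q i"
      using near_of_deficit[OF H] by blast
    have QI: "Q \<in> colourings n r" using Q by (auto simp: near_def)
    define \<sigma> where "\<sigma> i = Q (SOME v. v \<in> S i)" for i
    have rep: "\<exists>u\<in>S i. \<sigma> i = Q u" if "i < r" for i
      using someI_ex[of "\<lambda>v. v \<in> S i"] S_ne[OF that] by (auto simp: \<sigma>_def)
    have Sprop: "u < n \<and> u \<notin> bad \<and> P u = i" if "u \<in> S i" for u i using that by (auto simp: S_def block_def)
    have same: "Q u = Q w" if "u \<in> S i" "w \<in> S i" "i < r" for u w i
    proof (rule ccontr)
      assume ne: "Q u \<noteq> Q w"
      have "block n P i \<subseteq> (block n P i - block n Q (Q u)) \<union> (block n P i - block n Q (Q w))"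
        using ne by (auto simp: block_def)
      then have "card (block n P i) \<le> card (block n P i - block n Q (Q u)) + card (block n P i - block n Q (Q w))"
        by (intro order_trans[OF card_mono card_Un_le]) auto
      moreover have "real (card (block n P i - block n Q (Q u))) < real n / (4 * real r)"
        using tight(1)[of u Q] Sprop[OF that(1)] Q by auto
      moreover have "real (card (block n P i - block n Q (Q w))) < real n / (4 * real r)"
        using tight(1)[of w Q] Sprop[OF that(2)] Q by auto
      ultimately have "real (card (block n P i)) < real n / (4 * real r) + real n / (4 * real r)" by linarith
      then show False using half[OF that(3)] by simp
    qed
    have diff: "Q u \<noteq> Q w" if "u \<in> S i" "w \<in> S j" "i < r" "j < r" "i \<noteq> j" for u w i j
    proof
      assume eq: "Q u = Q w"
      have "block n P j \<subseteq> (block n P j - block n Q (Q w)) \<union> (block n Q (Q u) - block n P i)"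
        using eq that by (auto simp: block_def)
      then have "card (block n P j) \<le> card (block n P j - block n Q (Q w)) + card (block n Q (Q u) - block n P i)"
        by (intro order_trans[OF card_mono card_Un_le]) auto
      moreover have "real (card (block n Q (Q u) - block n P i)) < real n / (4 * real r)"
        using tight(2)[of u Q] Sprop[OF that(1)] Q by auto
      moreover have "real (card (block n P j - block n Q (Q w))) < real n / (4 * real r)"
        using tight(1)[of w Q] Sprop[OF that(2)] Q by auto
      ultimately have "real (card (block n P j)) < real n / (4 * real r) + real n / (4 * real r)" by linarith
      then show False using half[OF that(4)] by simp
    qed
    show "\<exists>\<sigma>. inj_on \<sigma> {..<r} \<and> (\<forall>i<r. \<sigma> i < r \<and> S i \<subseteq> R (\<sigma> i))"
    proof (intro exI[of _ \<sigma>] conjI allI impI)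
      show "inj_on \<sigma> {..<r}"
      proof (rule inj_onI)
        fix i j assume ij: "i \<in> {..<r}" "j \<in> {..<r}" "\<sigma> i = \<sigma> j"
        then obtain u w where "u \<in> S i" "\<sigma> i = Q u" "w \<in> S j" "\<sigma> j = Q w" using rep by (meson lessThan_iff)
        then show "i = j" using diff[of u i w j] ij by auto
      qed
      fix i assume i: "i < r"
      then obtain u where u: "u \<in> S i" "\<sigma> i = Q u" using rep by blast
      show s: "\<sigma> i < r" using u Sprop colouring_less[OF QI] by auto
      show "S i \<subseteq> R (\<sigma> i)"
      proof
        fix w assume w: "w \<in> S i"
        then have "Q w = \<sigma> i" "w < n" using same[OF w u(1) i] u(2) Sprop[OF w] by auto
        then show "w \<in> R (\<sigma> i)" unfolding RQ[OF s] by (simp add: block_def)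
      qed
    qed
  qed
qed

end

section \<open>Probability that there is no core\<close>

context cuts
begin

lemma far_mono: "far d m E \<Longrightarrow> d \<le> d' \<Longrightarrow> far d' m E"
  unfolding far_def using near_mono by blast

lemma card_high_degree:
  assumes ok: "jumbled n p t H" and n: "n > 0" and c: "c > 0" and p: "p \<ge> 0"
  shows "real (card {v \<in> {..<n}. real (deg_to H v {..<n}) > (p + c / 4) * real n}) \<le> 4 * t / (c * real n)"
proof -
  define X where "X = {v \<in> {..<n}. real (deg_to H v {..<n}) > (p + c / 4) * real n}"
  have "real (card X) * ((p + c / 4) * real n) = (\<Sum>v\<in>X. (p + c / 4) * real n)" by simp
  also have "\<dots> \<le> edges_between H X {..<n}"
    unfolding edges_between_def by (intro sum_mono) (auto simp: X_def)
  also have "\<dots> \<le> p * (real (card X) * real n - real (card (X \<inter> {..<n}))) + t"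
  proof -
    have "X \<subseteq> {..<n}" by (auto simp: X_def)
    then have "\<bar>edges_between H X {..<n} - p * (real (card X) * real (card {..<n}) - real (card (X \<inter> {..<n})))\<bar> \<le> t"
      using ok unfolding jumbled_def by blast
    then show ?thesis by simp
  qed
  also have "\<dots> \<le> p * (real (card X) * real n) + t"
    using p by (intro add_right_mono mult_left_mono) auto
  finally have "real (card X) * (c * real n) \<le> 4 * t" by (simp add: algebra_simps)
  then show ?thesis using n c by (simp add: X_def le_divide_eq)
qed

text \<open>
  A union bound over the ways in which the hypotheses of \<open>loose_gain\<close> can fail, with Markov's inequality
  for the deficit of \<open>opt F\<close>, for the number of lost edges at \<open>v\<close> and for the gain, summed over all
  vertices.
\<close>

lemma expected_loose:
  fixes c p \<epsilon> \<rho> d L t z :: real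
  assumes n: "n > 0" and p: "0 < p" "p \<le> 1 - c" and c: "0 < c" and d: "0 \<le> d" "d \<le> L" and L: "0 < L"
    and eps: "0 < \<epsilon>" "\<epsilon> \<le> 1/2" and rho: "0 < \<rho>" "\<rho> \<le> 1" and z: "z \<le> c / (8 * real r)"
    and bal: "\<And>H. H \<subseteq> pairs n \<Longrightarrow> jumbled n p t H \<Longrightarrow> balanced z H"
  defines "m \<equiv> c / (64 * real r ^ 3) * (real n)\<^sup>2" and "g \<equiv> c / (16 * real r) * real n"
  shows "gnp_ex n p (\<lambda>H. real (card {v \<in> {..<n}. loose d g H v}))
    \<le> real n * gnp_ex n p (\<lambda>H. of_bool (far L m H))
      + real n * gnp_ex n p (\<lambda>H. of_bool (\<not> jumbled n p t H))
      + \<bar>4 * t / (c * real n)\<bar> + 2 * \<epsilon> * gnp_ex n p (disc p) / L + 16 * real r * \<epsilon> * real n / c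
      + 4 * real r / (c * real n) * (\<Sum>v<n. pair_ex p \<epsilon> v (gain d v))"
proof -
  let ?E = "gnp_ex n p"
  have p1: "0 \<le> p" "p \<le> 1" "c \<le> 1" and n0: "real n > 0" and r0: "real r \<ge> 2" using p c n r by auto
  \<comment> \<open>Vertices of too large degree, counted only when \<open>jumbled\<close> bounds their number.\<close>
  define hi where "hi H v \<longleftrightarrow> jumbled n p t H \<and> real (deg_to H v {..<n}) > (p + c / 4) * real n" for H v
  define Def where "Def F H = real (max_size H) - real (card (H \<inter> cut_pairs n (opt F)))" for F H
  have Def0: "Def F H \<ge> 0" for F H using max_size_ge[of "opt F" H] opt[of F] by (simp add: Def_def)
  have point: "of_bool (loose d g H v) \<le> of_bool (far L m H) + of_bool (\<not> jumbled n p t H) + of_bool (hi H v)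
      + (1 / L) * Def F H + 16 * real r / (c * real n) * real (card (star n v \<inter> F - H)) + 4 * real r / (c * real n) * gain d v F H"
    if v: "v < n" and F: "F \<subseteq> pairs n" and H: "H \<subseteq> pairs n" for v F H
  proof -
    have g0: "gain d v F H \<ge> 0" using gain_nonneg[OF v d(1)] .
    have nn: "(1 / L) * Def F H \<ge> 0" "16 * real r / (c * real n) * real (card (star n v \<inter> F - H)) \<ge> 0"
        "4 * real r / (c * real n) * gain d v F H \<ge> 0"
      using Def0 g0 L c n0 r0 by auto
    show ?thesis
    proof (cases "loose d g H v \<and> \<not> far L m H \<and> jumbled n p t H \<and> \<not> hi H v")
      case False
      then show ?thesis using nn by (cases "loose d g H v"; cases "far L m H"; cases "jumbled n p t H"; cases "hi H v") simp_all
    next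
      case True
      show ?thesis
      proof (cases "Def F H \<le> L \<and> real (card (star n v \<inter> F - H)) \<le> c * real n / (16 * real r)")
        case D: True
        have "gain d v F H \<ge> c * real n / (4 * real r)"
        proof (rule loose_gain[OF v d F H c p1(3) p(2)])
          show "\<not> far L (c / (64 * real r ^ 3) * (real n)\<^sup>2) H" using True by (simp add: m_def)
          show "balanced z H" using bal[OF H] True by blast
          show "z \<le> c / (8 * real r)" by fact
          show "real (deg_to H v {..<n}) \<le> (p + c / 4) * real n" using True by (auto simp: hi_def)
          show "real (max_size H) - real (card (H \<inter> cut_pairs n (opt F))) \<le> L" using D by (simp add: Def_def)
          show "real (card (star n v \<inter> F - H)) \<le> c * real n / (16 * real r)" using D by simp
          show "loose d (c / (16 * real r) * real n) H v" using True by (simp add: g_def)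
        qed
        then have "4 * real r / (c * real n) * gain d v F H \<ge> 4 * real r / (c * real n) * (c * real n / (4 * real r))"
          using c n0 r0 by (intro mult_left_mono) auto
        also have "4 * real r / (c * real n) * (c * real n / (4 * real r)) = 1" using c n0 r0 by simp
        finally show ?thesis using nn by (simp add: add_increasing)
      next
        case D: False
        then consider "Def F H \<ge> L" | "real (card (star n v \<inter> F - H)) \<ge> c * real n / (16 * real r)" by linarith
        then show ?thesis
        proof cases
          case 1
          then have "(1 / L) * Def F H \<ge> 1" using L by simp
          then show ?thesis using nn by (simp add: add_increasing)
        next
          case 2
          then have "16 * real r / (c * real n) * real (card (star n v \<inter> F - H)) \<ge> 16 * real r / (c * real n) * (c * real n / (16 * real r))"
            using c n0 r0 by (intro mult_left_mono) auto
          also have "16 * real r / (c * real n) * (c * real n / (16 * real r)) = 1" using c n0 r0 by simp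
          finally show ?thesis using nn by (simp add: add_increasing)
        qed
      qed
    qed
  qed
  define sd where "sd v = ?E (\<lambda>H. real (card (H \<inter> (star n v \<inter> cut_pairs n (opt H)))) - p * real (card (star n v \<inter> cut_pairs n (opt H))))" for v
  have vertex: "?E (\<lambda>H. of_bool (loose d g H v)) \<le> ?E (\<lambda>H. of_bool (far L m H)) + ?E (\<lambda>H. of_bool (\<not> jumbled n p t H))
      + ?E (\<lambda>H. of_bool (hi H v)) + (1 / L) * (\<epsilon> * sd v) + 16 * real r * \<epsilon> / c + 4 * real r / (c * real n) * pair_ex p \<epsilon> v (gain d v)"
    if v: "v < n" for v
  proof -
    have "?E (\<lambda>H. of_bool (loose d g H v)) = pair_ex p \<epsilon> v (\<lambda>F H. of_bool (loose d g H v))"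
      by (rule pair_ex_single[symmetric])
    also have "\<dots> \<le> pair_ex p \<epsilon> v (\<lambda>F H. of_bool (far L m H) + of_bool (\<not> jumbled n p t H) + of_bool (hi H v)
      + (1 / L) * Def F H + 16 * real r / (c * real n) * real (card (star n v \<inter> F - H)) + 4 * real r / (c * real n) * gain d v F H)"
      using p1 eps point[OF v] by (intro pair_ex_mono) auto
    also have "\<dots> = ?E (\<lambda>H. of_bool (far L m H)) + ?E (\<lambda>H. of_bool (\<not> jumbled n p t H))
      + ?E (\<lambda>H. of_bool (hi H v)) + (1 / L) * pair_ex p \<epsilon> v Def
      + 16 * real r / (c * real n) * pair_ex p \<epsilon> v (\<lambda>F H. real (card (star n v \<inter> F - H))) + 4 * real r / (c * real n) * pair_ex p \<epsilon> v (gain d v)"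
      by (simp only: pair_ex_add pair_ex_single pair_ex_cmult)
    also have "pair_ex p \<epsilon> v Def = \<epsilon> * sd v"
      unfolding pair_ex_def Def_def[abs_def] sd_def by (rule opt_noise_stability[OF star_subset])
    also have "16 * real r / (c * real n) * pair_ex p \<epsilon> v (\<lambda>F H. real (card (star n v \<inter> F - H))) \<le> 16 * real r / (c * real n) * (\<epsilon> * real n)"
    proof (intro mult_left_mono)
      have "pair_ex p \<epsilon> v (\<lambda>F H. real (card (star n v \<inter> F - H))) \<le> ?E (\<lambda>F. \<epsilon> * real n)"
        unfolding pair_ex_def
      proof (intro bern_ex_mono)
        fix F assume F: "F \<subseteq> pairs n"
        have "bern_ex (pairs n) (resampled p (\<lambda>e. \<epsilon> * of_bool (e \<in> star n v)) F) (\<lambda>H. real (card (star n v \<inter> F - H)))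
            = (\<Sum>e\<in>star n v \<inter> F. 1 - resampled p (\<lambda>e. \<epsilon> * of_bool (e \<in> star n v)) F e)"
          using F by (intro bern_ex_card_Diff) auto
        also have "\<dots> = (\<Sum>e\<in>star n v \<inter> F. \<epsilon> * (1 - p))"
          by (intro sum.cong) (auto simp: resampled_def algebra_simps)
        also have "\<dots> = real (card (star n v \<inter> F)) * (\<epsilon> * (1 - p))" by simp
        also have "\<dots> \<le> real n * (\<epsilon> * 1)"
        proof (intro mult_mono)
          have "card (star n v \<inter> F) \<le> card (star n v)"
            by (intro card_mono finite_subset[OF star_subset finite_pairs]) auto
          then show "real (card (star n v \<inter> F)) \<le> real n" using card_star_le[OF v] by simp
        qed (use p1 eps in auto)
        finally show "bern_ex (pairs n) (resampled p (\<lambda>e. \<epsilon> * of_bool (e \<in> star n v)) F) (\<lambda>H. real (card (star n v \<inter> F - H))) \<le> \<epsilon> * real n"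
          by (simp add: mult.commute)
      qed (use p1 in auto)
      then show "pair_ex p \<epsilon> v (\<lambda>F H. real (card (star n v \<inter> F - H))) \<le> \<epsilon> * real n" by (simp add: bern_ex_const)
    qed (use c n0 in auto)
    also have "16 * real r / (c * real n) * (\<epsilon> * real n) = 16 * real r * \<epsilon> / c" using n0 by simp
    finally show ?thesis by simp
  qed
  have hi: "(\<Sum>v<n. ?E (\<lambda>H. of_bool (hi H v))) \<le> \<bar>4 * t / (c * real n)\<bar>"
  proof -
    have "(\<Sum>v<n. ?E (\<lambda>H. of_bool (hi H v))) = ?E (\<lambda>H. \<Sum>v<n. of_bool (hi H v))" by (simp only: bern_ex_sum)
    also have "\<dots> \<le> ?E (\<lambda>H. \<bar>4 * t / (c * real n)\<bar>)"
    proof (intro bern_ex_mono)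
      fix H
      show "(\<Sum>v<n. of_bool (hi H v)) \<le> \<bar>4 * t / (c * real n)\<bar>"
      proof (cases "jumbled n p t H")
        case True
        have "(\<Sum>v<n. of_bool (hi H v)) = real (card ({..<n} \<inter> {v. hi H v}))" by simp
        also have "{..<n} \<inter> {v. hi H v} = {v \<in> {..<n}. real (deg_to H v {..<n}) > (p + c / 4) * real n}"
          using True by (auto simp: hi_def)
        finally show ?thesis using card_high_degree[OF True n c p1(1)] by linarith
      qed (simp add: hi_def)
    qed (use p1 in auto)
    finally show ?thesis by (simp only: bern_ex_const[OF finite_pairs])
  qed
  have sd: "(\<Sum>v<n. sd v) \<le> 2 * ?E (disc p)"
  proof -
    have "(\<Sum>v<n. sd v) = ?E (\<lambda>H. \<Sum>v<n. real (card (H \<inter> (star n v \<inter> cut_pairs n (opt H)))) - p * real (card (star n v \<inter> cut_pairs n (opt H))))"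
      by (simp only: sd_def bern_ex_sum)
    also have "\<dots> \<le> ?E (\<lambda>H. 2 * disc p H)"
    proof (intro bern_ex_mono)
      fix H
      have sub: "cut_pairs n c \<subseteq> pairs n" for c by (auto simp: cut_pairs_def)
      have "(\<Sum>v<n. card ((H \<inter> cut_pairs n (opt H)) \<inter> star n v)) = 2 * card (H \<inter> cut_pairs n (opt H))"
        "(\<Sum>v<n. card (cut_pairs n (opt H) \<inter> star n v)) = 2 * card (cut_pairs n (opt H))"
        using sub by (intro sum_card_star; auto)+
      then have e: "(\<Sum>v<n. card (H \<inter> (star n v \<inter> cut_pairs n (opt H)))) = 2 * card (H \<inter> cut_pairs n (opt H))"
        "(\<Sum>v<n. card (star n v \<inter> cut_pairs n (opt H))) = 2 * card (cut_pairs n (opt H))"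
        by (simp_all add: Int_ac)
      have "(\<Sum>v<n. real (card (H \<inter> (star n v \<inter> cut_pairs n (opt H)))) - p * real (card (star n v \<inter> cut_pairs n (opt H))))
         = 2 * (real (card (H \<inter> cut_pairs n (opt H))) - p * real (card (cut_pairs n (opt H))))"
        unfolding sum_subtractf sum_distrib_left[symmetric] of_nat_sum[symmetric] e by (simp add: algebra_simps)
      also have "\<dots> \<le> 2 * disc p H" using disc_ge[of "opt H" H p] opt[of H] by auto
      finally show "(\<Sum>v<n. real (card (H \<inter> (star n v \<inter> cut_pairs n (opt H)))) - p * real (card (star n v \<inter> cut_pairs n (opt H)))) \<le> 2 * disc p H" .
    qed (use p1 in auto)
    finally show ?thesis by (simp only: bern_ex_cmult)
  qed
  have "?E (\<lambda>H. real (card {v \<in> {..<n}. loose d g H v})) = ?E (\<lambda>H. \<Sum>v<n. of_bool (loose d g H v))"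
    by (intro bern_ex_cong) (auto simp: Int_def)
  also have "\<dots> = (\<Sum>v<n. ?E (\<lambda>H. of_bool (loose d g H v)))" by (simp only: bern_ex_sum)
  also have "\<dots> \<le> (\<Sum>v<n. ?E (\<lambda>H. of_bool (far L m H)) + ?E (\<lambda>H. of_bool (\<not> jumbled n p t H))
      + ?E (\<lambda>H. of_bool (hi H v)) + (1 / L) * (\<epsilon> * sd v) + 16 * real r * \<epsilon> / c + 4 * real r / (c * real n) * pair_ex p \<epsilon> v (gain d v))"
    using vertex by (intro sum_mono) auto
  also have "\<dots> = real n * ?E (\<lambda>H. of_bool (far L m H)) + real n * ?E (\<lambda>H. of_bool (\<not> jumbled n p t H))
      + (\<Sum>v<n. ?E (\<lambda>H. of_bool (hi H v))) + (1 / L) * (\<epsilon> * (\<Sum>v<n. sd v)) + real n * (16 * real r * \<epsilon> / c)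
      + 4 * real r / (c * real n) * (\<Sum>v<n. pair_ex p \<epsilon> v (gain d v))"
    by (simp only: sum.distrib sum_distrib_left[symmetric] sum_constant card_lessThan)
  also have "\<dots> \<le> real n * ?E (\<lambda>H. of_bool (far L m H)) + real n * ?E (\<lambda>H. of_bool (\<not> jumbled n p t H))
      + \<bar>4 * t / (c * real n)\<bar> + (1 / L) * (\<epsilon> * (2 * ?E (disc p))) + real n * (16 * real r * \<epsilon> / c)
      + 4 * real r / (c * real n) * (\<Sum>v<n. pair_ex p \<epsilon> v (gain d v))"
    using hi sd L eps by (intro order_refl add_mono mult_left_mono) auto
  finally show ?thesis by (simp add: mult_ac)
qed

lemma core_failure:
  fixes c p \<epsilon> \<rho> L t z \<alpha> \<beta> :: real
  assumes n: "n > 0" and p: "0 < p" "p \<le> 1 - c" and c: "0 < c" and d: "real d \<le> L" and L: "0 < L"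
    and eps: "0 < \<epsilon>" "\<epsilon> \<le> 1/2" and rho: "0 < \<rho>" "\<rho> \<le> 1" and z: "z \<le> c / (8 * real r)"
    and zb: "z + \<beta> < \<alpha>" "z + \<beta> < 1 / real r" "z \<le> 1 / (2 * real r)" and \<beta>: "\<beta> > 0"
    and bal: "\<And>H. H \<subseteq> pairs n \<Longrightarrow> jumbled n p t H \<Longrightarrow> balanced z H"
  defines "m \<equiv> c / (64 * real r ^ 3) * (real n)\<^sup>2"
  shows "gnp_ex n p (\<lambda>H. of_bool (\<not> admits_core d r \<alpha> {..<n} H))
    \<le> gnp_ex n p (\<lambda>H. of_bool (far L m H))
      + gnp_ex n p (\<lambda>H. of_bool (\<not> jumbled n p t H))
      + (real n * gnp_ex n p (\<lambda>H. of_bool (far L m H))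
      + real n * gnp_ex n p (\<lambda>H. of_bool (\<not> jumbled n p t H))
      + \<bar>4 * t / (c * real n)\<bar> + 2 * \<epsilon> * gnp_ex n p (disc p) / L + 16 * real r * \<epsilon> * real n / c
      + 4 * real r / (c * real n) * (\<Sum>v<n. pair_ex p \<epsilon> v (gain d v))) / (\<beta> * real n)"
proof -
  let ?E = "gnp_ex n p"
  have p1: "0 \<le> p" "p \<le> 1" "c \<le> 1" using p c by auto
  have bn: "\<beta> * real n > 0" using \<beta> n by simp
  define bad where "bad H = real (card {v \<in> {..<n}. loose (real d) (c / (16 * real r) * real n) H v})" for H
  have "?E (\<lambda>H. of_bool (\<not> admits_core d r \<alpha> {..<n} H))
     \<le> ?E (\<lambda>H. of_bool (far L m H) + of_bool (\<not> jumbled n p t H) + bad H / (\<beta> * real n))"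
  proof (intro bern_ex_mono)
    fix H assume H: "H \<subseteq> pairs n"
    have b0: "0 \<le> bad H / (\<beta> * real n)" using bn by (simp add: bad_def)
    have "admits_core d r \<alpha> {..<n} H" if g: "\<not> far L m H" "jumbled n p t H" "bad H \<le> \<beta> * real n"
    proof (rule core_of_few_loose[OF n H c p1(3) _ _ zb])
      show "\<not> far (real d) (c / (64 * real r ^ 3) * (real n)\<^sup>2) H"
        using g(1) far_mono[OF _ d] unfolding m_def by blast
      show "balanced z H" using bal[OF H g(2)] .
      show "real (card {v \<in> {..<n}. loose (real d) (c / (16 * real r) * real n) H v}) \<le> \<beta> * real n"
        using g(3) by (simp add: bad_def)
    qed
    then have cs: "admits_core d r \<alpha> {..<n} H \<or> far L m H \<or> \<not> jumbled n p t H \<or> bad H > \<beta> * real n"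
      by linarith
    moreover have "bad H / (\<beta> * real n) \<ge> 1" if "bad H > \<beta> * real n" using that bn by (simp add: le_divide_eq)
    ultimately show "of_bool (\<not> admits_core d r \<alpha> {..<n} H) \<le> of_bool (far L m H) + of_bool (\<not> jumbled n p t H) + bad H / (\<beta> * real n)"
      using b0 by (cases "admits_core d r \<alpha> {..<n} H"; cases "far L m H"; cases "jumbled n p t H") auto
  qed (use p1 in auto)
  also have "\<dots> = ?E (\<lambda>H. of_bool (far L m H)) + ?E (\<lambda>H. of_bool (\<not> jumbled n p t H)) + ?E bad / (\<beta> * real n)"
    by (simp only: bern_ex_add bern_ex_cdivide)
  finally have "?E (\<lambda>H. of_bool (\<not> admits_core d r \<alpha> {..<n} H))
     \<le> ?E (\<lambda>H. of_bool (far L m H)) + ?E (\<lambda>H. of_bool (\<not> jumbled n p t H)) + ?E bad / (\<beta> * real n)" .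
  also have "\<dots> \<le> ?E (\<lambda>H. of_bool (far L m H)) + ?E (\<lambda>H. of_bool (\<not> jumbled n p t H))
      + (real n * ?E (\<lambda>H. of_bool (far L m H)) + real n * ?E (\<lambda>H. of_bool (\<not> jumbled n p t H))
      + \<bar>4 * t / (c * real n)\<bar> + 2 * \<epsilon> * ?E (disc p) / L + 16 * real r * \<epsilon> * real n / c
      + 4 * real r / (c * real n) * (\<Sum>v<n. pair_ex p \<epsilon> v (gain d v))) / (\<beta> * real n)"
    unfolding bad_def[abs_def] m_def using bn
    by (intro add_left_mono divide_right_mono expected_loose[OF n p c _ d L eps rho z bal]) auto
  finally show ?thesis .
qed

lemma balanced_of_jumbled:
  assumes ok: "jumbled n p t H" and H: "H \<subseteq> pairs n" and p: "0 < p" and n: "n > 0"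
    and z: "1 + 2 * t * real r / (p * real n) \<le> z * real n"
  shows "balanced z H"
  unfolding balanced_def
proof (intro allI impI)
  fix i assume i: "i < r"
  let ?c = "\<lambda>j. real (card (block n (opt H) j))"
  have r0: "real r \<ge> 2" and n0: "real n > 0" using r n by auto
  have HI: "opt H \<in> colourings n r" using opt by auto
  have "\<exists>j<r. ?c j \<ge> real n / real r"
  proof (rule ccontr)
    assume "\<not> ?thesis"
    then have "(\<Sum>j<r. ?c j) < (\<Sum>j<r. real n / real r)"
      using r by (intro sum_strict_mono) (auto simp: not_le lessThan_empty_iff)
    moreover have "(\<Sum>j<r. ?c j) = real n"
    proof -
      have "(\<Sum>j<r. card ({..<n} \<inter> block n (opt H) j)) = card {..<n}" by (rule sum_card_blocks[OF HI]) simp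
      moreover have "{..<n} \<inter> block n (opt H) j = block n (opt H) j" for j by (auto simp: block_def)
      ultimately show ?thesis by (simp only: of_nat_sum[symmetric]) simp
    qed
    ultimately show False using r0 by simp
  qed
  then obtain j where j: "j < r" "?c j \<ge> real n / real r" by blast
  have t0: "0 \<le> t" using ok unfolding jumbled_def by (metis abs_ge_zero empty_subsetI order_trans)
  have cj: "?c j > 0" using j(2) n0 r0 by (smt (verit) divide_pos_pos)
  have "p * ?c j * (?c j - 1 - ?c i) \<le> 2 * t"
    using block_sizes[OF ok H near_opt[of 0 H] i j(1)] p by auto
  then have "?c j - 1 - ?c i \<le> 2 * t / (p * ?c j)" using p cj by (simp add: le_divide_eq mult.commute)
  also have "\<dots> \<le> 2 * t / (p * (real n / real r))"
    using p j(2) t0 n0 r0 cj by (intro divide_left_mono mult_left_mono) auto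
  also have "\<dots> = 2 * t * real r / (p * real n)" by simp
  finally show "real n / real r - z * real n \<le> ?c i" using z j(2) by linarith
qed

end

context cuts
begin

lemma expected_disc_le:
  assumes n: "n > 0" and p: "0 < p" "p \<le> 1" and np: "real n * p \<ge> 1"
  shows "gnp_ex n p (disc p) \<le> (ln (real r) + 2) * real n * sqrt (real n * p)"
proof -
  define x where "x = sqrt (real n * p)"
  have x: "x \<ge> 1" "x\<^sup>2 = real n * p" using np p by (auto simp: x_def)
  have n1: "real n \<ge> 1" using n by simp
  have "gnp_ex n p (disc p) \<le> (ln (2 * real (card (colourings n r))) + p * (1 / x)\<^sup>2 * real (card (pairs n))) / (1 / x)"
    using x p by (intro bern_ex_disc_le) auto
  also have "\<dots> \<le> ((1 + real n * ln (real r)) + real n / 2) / (1 / x)"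
  proof (intro divide_right_mono add_mono)
    have "ln (2 * real (card (colourings n r))) = ln 2 + real n * ln (real r)"
      using r by (simp add: card_colourings ln_mult ln_realpow)
    then show "ln (2 * real (card (colourings n r))) \<le> 1 + real n * ln (real r)" using ln_2_less_1 by simp
    have "p * (1 / x)\<^sup>2 * real (card (pairs n)) \<le> p * (1 / x)\<^sup>2 * ((real n)\<^sup>2 / 2)"
      using p card_pairs by (intro mult_left_mono) auto
    also have "\<dots> = real n / 2"
      using x(2) p n by (simp add: power_divide power2_eq_square)
    finally show "p * (1 / x)\<^sup>2 * real (card (pairs n)) \<le> real n / 2" .
  qed (use x in auto)
  also have "\<dots> = ((1 + real n * ln (real r)) + real n / 2) * x" by simp
  also have "\<dots> \<le> ((ln (real r) + 2) * real n) * x"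
    using x n1 by (intro mult_right_mono) (auto simp: algebra_simps)
  finally show ?thesis by (simp add: x_def)
qed

text \<open>
  The parameters of the argument: \<open>L = \<tau> x\<close> is the deficit for macroscopic stability, obtained with
  \<open>s = \<tau> / n\<close>; a fraction \<open>\<epsilon>\<close> of a star is resampled; and \<open>\<rho> = \<mu> / x\<close> is the rate of thinning.
\<close>

lemma core_failure_numeric:
  fixes c p \<epsilon> \<mu> \<tau> z \<alpha> \<beta> x K :: real
  assumes n: "n > 0" and p: "0 < p" "p \<le> 1 - c" and c: "0 < c"
    and x: "x = sqrt (real n * p)" "x \<ge> 1" and K: "K = ln (real r) + 2"
    and lam: "0 < \<tau>" "\<tau> \<le> real n / 2" and d: "real d \<le> \<tau> * x"
    and eps: "0 < \<epsilon>" "\<epsilon> \<le> 1/2" and mu: "0 < \<mu>" "\<mu> \<le> x"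
    and big: "\<tau> * (c * (c / (64 * real r ^ 3)) / 2) * x\<^sup>2 \<ge> 1"
    and z: "z \<le> c / (8 * real r)" "z + \<beta> < \<alpha>" "z + \<beta> < 1 / real r" "z \<le> 1 / (2 * real r)" and \<beta>: "\<beta> > 0"
    and zx: "1 + 16 * real r * real n / x \<le> z * real n"
  shows "gnp_ex n p (\<lambda>H. of_bool (\<not> admits_core d r \<alpha> {..<n} H))
    \<le> (1 + 1 / \<beta>) * (10 * (1 + K) * sqrt \<tau> / sqrt (c * (c / (64 * real r ^ 3)) / 2))
      + (1 + 1 / \<beta>) * (2 * exp (- real n))
      + (1 / \<beta>) * (32 / (c * x) + 2 * \<epsilon> * K / \<tau> + 16 * real r * \<epsilon> / c
         + 4 * real r / c * (real r * d / (\<epsilon> * \<mu> * x) + real r * \<mu> * sqrt (8 * \<epsilon>) + 2 * K / x + 2 * \<mu> / x))"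
proof -
  let ?E = "gnp_ex n p"
  define N where "N = real n"
  define \<delta> where "\<delta> = c / (64 * real r ^ 3)"
  define a where "a = c * \<delta> / 2"
  define L where "L = \<tau> * x"
  define \<rho> where "\<rho> = \<mu> / x"
  define t where "t = 8 * real n * x"
  define m where "m = \<delta> * (real n)\<^sup>2"
  define \<Delta> where "\<Delta> = ?E (disc p)"
  define Pf where "Pf = ?E (\<lambda>H. of_bool (far L m H))"
  define Pd where "Pd = ?E (\<lambda>H. of_bool (\<not> jumbled n p t H))"
  define G where "G = (\<Sum>v<n. pair_ex p \<epsilon> v (gain (real d) v))"
  have r0: "real r \<ge> 2" using r by simp
  have N: "N > 0" "N \<ge> 1" using n by (auto simp: N_def)
  have p1: "p \<le> 1" using p c by linarith
  have x2: "x\<^sup>2 = N * p" using x p by (simp add: N_def)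
  have xN: "x\<^sup>2 \<le> N" using x2 p1 N by (simp add: mult_left_le)
  have x0: "x > 0" using x by linarith
  have pe: "p = x\<^sup>2 / N" using x2 N by simp
  have np: "real n * p \<ge> 1" using x by (metis real_sqrt_ge_1_iff)
  have K0: "K \<ge> 2" using r0 K by simp
  have a0: "a > 0" using c r0 by (simp add: a_def \<delta>_def)
  have \<Delta>: "\<Delta> \<le> K * N * x" using expected_disc_le[OF n p(1) p1 np] by (simp add: \<Delta>_def K x N_def)
  have \<Delta>0: "0 \<le> \<Delta>" unfolding \<Delta>_def using p p1 disc_nonneg by (intro bern_ex_nonneg) auto
  have Pd: "Pd \<le> 2 * exp (- real n)"
    using prob_not_jumbled[of p n] p p1 np by (simp add: Pd_def t_def x)
  have Pf: "Pf \<le> 10 * (1 + K) * sqrt \<tau> / sqrt a"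
  proof -
    define s where "s = \<tau> / N"
    have sm: "s * p * c * m / 2 = (\<tau> * a) * x\<^sup>2"
      using N by (simp add: s_def m_def a_def pe power2_eq_square N_def)
    have "Pf * (sqrt (s * p * c * m / 2) / 5) \<le> 2 * L + 2 * s * \<Delta>"
      unfolding Pf_def \<Delta>_def
    proof (rule macro_stability)
      show "1 \<le> s * p * c * m / 2" unfolding sm using big by (simp add: a_def \<delta>_def mult_ac)
      show "s \<le> 1 / 2" using lam N by (simp add: s_def N_def field_simps)
    qed (use p c lam N x0 in \<open>auto simp: s_def L_def\<close>)
    also have "\<dots> \<le> 2 * L + 2 * s * (K * N * x)"
      using \<Delta> lam N by (intro add_left_mono mult_left_mono) (auto simp: s_def)
    also have "\<dots> = 2 * (1 + K) * \<tau> * x" using N by (simp add: s_def L_def algebra_simps)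
    also have "sqrt (s * p * c * m / 2) = sqrt \<tau> * sqrt a * x"
      unfolding sm using x0 by (simp add: real_sqrt_mult)
    finally have Pfx: "Pf * (sqrt \<tau> * sqrt a * x / 5) \<le> 2 * (1 + K) * \<tau> * x" .
    have "(sqrt \<tau> * sqrt a * x) * Pf \<le> (sqrt \<tau> * sqrt a * x) * (10 * (1 + K) * sqrt \<tau> / sqrt a)"
    proof -
      have "(u * q * x) * (10 * (1 + K) * u / q) = 5 * (2 * (1 + K) * (u * u) * x)" if "q \<noteq> 0" for u q :: real
        using that by simp
      from this[of "sqrt a" "sqrt \<tau>"] have "(sqrt \<tau> * sqrt a * x) * (10 * (1 + K) * sqrt \<tau> / sqrt a) = 5 * (2 * (1 + K) * \<tau> * x)"
        using lam a0 by simp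
      moreover have "(sqrt \<tau> * sqrt a * x) * Pf = 5 * (Pf * (sqrt \<tau> * sqrt a * x / 5))" by simp
      ultimately show ?thesis using Pfx by linarith
    qed
    moreover have "0 < sqrt \<tau> * sqrt a * x" using lam a0 x0 by simp
    ultimately show ?thesis by (simp only: mult_le_cancel_left_pos)
  qed
  have rho: "0 < \<rho>" "\<rho> \<le> 1" using mu x0 by (auto simp: \<rho>_def)
  have G: "G \<le> N\<^sup>2 * (real r * d / (\<epsilon> * \<mu> * x) + real r * \<mu> * sqrt (8 * \<epsilon>) + 2 * K / x + 2 * \<mu> / x)"
  proof -
    have "G \<le> real n * real r * real d / (\<epsilon> * p * \<rho>) + real r * (real n)\<^sup>2 * \<rho> * sqrt (8 * real n * (\<epsilon> * p))
      + 2 * \<Delta> / p + 2 * \<rho> * (real n)\<^sup>2"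
      unfolding G_def \<Delta>_def by (intro sum_gain_le p p1 eps rho) simp
    also have "real n * real r * real d / (\<epsilon> * p * \<rho>) = N\<^sup>2 * (real r * d / (\<epsilon> * \<mu> * x))"
      using N x0 by (simp add: pe \<rho>_def power2_eq_square N_def mult_ac)
    also have "sqrt (8 * real n * (\<epsilon> * p)) = sqrt (8 * \<epsilon>) * x"
    proof -
      have "8 * real n * (\<epsilon> * p) = 8 * \<epsilon> * x\<^sup>2" using x2 by (simp add: N_def)
      then have "sqrt (8 * real n * (\<epsilon> * p)) = sqrt (8 * \<epsilon>) * sqrt (x\<^sup>2)"
        by (simp only: real_sqrt_mult)
      then show ?thesis using x0 by (simp only: real_sqrt_abs abs_of_pos)
    qed
    also have "real r * (real n)\<^sup>2 * \<rho> * (sqrt (8 * \<epsilon>) * x) = N\<^sup>2 * (real r * \<mu> * sqrt (8 * \<epsilon>))"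
      using x0 by (simp add: \<rho>_def N_def)
    also have "2 * \<Delta> / p \<le> 2 * (K * N * x) / p" using \<Delta> p by (intro divide_right_mono) auto
    also have "2 * (K * N * x) / p = N\<^sup>2 * (2 * K / x)"
      using N x0 by (simp add: pe power2_eq_square)
    also have "2 * \<rho> * (real n)\<^sup>2 = N\<^sup>2 * (2 * \<mu> / x)" by (simp add: \<rho>_def N_def)
    finally show ?thesis by (simp add: algebra_simps)
  qed
  define g where "g = real r * d / (\<epsilon> * \<mu> * x) + real r * \<mu> * sqrt (8 * \<epsilon>) + 2 * K / x + 2 * \<mu> / x"
  define T where "T = N * Pf + N * Pd + \<bar>4 * t / (c * N)\<bar> + 2 * \<epsilon> * \<Delta> / L + 16 * real r * \<epsilon> * N / c + 4 * real r / (c * N) * G"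
  have "?E (\<lambda>H. of_bool (\<not> admits_core d r \<alpha> {..<n} H)) \<le> Pf + Pd + T / (\<beta> * N)"
    unfolding T_def Pf_def Pd_def \<Delta>_def G_def N_def m_def \<delta>_def
  proof (rule core_failure[OF n p c _ _ eps rho z \<beta>])
    show "real d \<le> L" "0 < L" using d lam x0 by (auto simp: L_def)
    fix H assume H: "H \<subseteq> pairs n" "jumbled n p t H"
    show "balanced z H"
    proof (rule balanced_of_jumbled[OF H(2,1) p(1) n])
      have "2 * t * real r / (p * real n) = 16 * real r * real n / x"
        using N x0 by (simp add: t_def pe power2_eq_square N_def)
      then show "1 + 2 * t * real r / (p * real n) \<le> z * real n" using zx by simp
    qed
  qed
  also have "T / (\<beta> * N) \<le> (N * (Pf + Pd + 32 / (c * x) + 2 * \<epsilon> * K / \<tau> + 16 * real r * \<epsilon> / c + 4 * real r / c * g)) / (\<beta> * N)"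
  proof (rule divide_right_mono)
    have "\<bar>4 * t / (c * N)\<bar> = 32 * x / c" using c N x0 by (simp add: t_def N_def)
    also have "\<dots> \<le> N * (32 / (c * x))"
    proof -
      have "32 * x / c = 32 * x\<^sup>2 / (c * x)" using x0 by (simp add: power2_eq_square)
      also have "\<dots> \<le> 32 * N / (c * x)" using xN c x0 by (intro divide_right_mono mult_left_mono) auto
      finally show ?thesis by (simp add: mult.commute)
    qed
    finally have 1: "\<bar>4 * t / (c * N)\<bar> \<le> N * (32 / (c * x))" .
    have "2 * \<epsilon> * \<Delta> / L \<le> 2 * \<epsilon> * (K * N * x) / L"
      using \<Delta> eps lam x0 by (intro divide_right_mono mult_left_mono) (auto simp: L_def)
    also have "\<dots> = N * (2 * \<epsilon> * K / \<tau>)" using x0 by (simp add: L_def)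
    finally have 2: "2 * \<epsilon> * \<Delta> / L \<le> N * (2 * \<epsilon> * K / \<tau>)" .
    have "4 * real r / (c * N) * G \<le> 4 * real r / (c * N) * (N\<^sup>2 * g)"
      using G c N by (intro mult_left_mono) (auto simp: g_def)
    also have "\<dots> = N * (4 * real r / c * g)" using N by (simp add: power2_eq_square)
    finally have 3: "4 * real r / (c * N) * G \<le> N * (4 * real r / c * g)" .
    have 4: "16 * real r * \<epsilon> * N / c = N * (16 * real r * \<epsilon> / c)" by simp
    show "T \<le> N * (Pf + Pd + 32 / (c * x) + 2 * \<epsilon> * K / \<tau> + 16 * real r * \<epsilon> / c + 4 * real r / c * g)"
      unfolding T_def distrib_left by (intro add_mono order_refl 1 2 3 eq_refl[OF 4])
  qed (use \<beta> N in auto)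
  also have "(N * (Pf + Pd + 32 / (c * x) + 2 * \<epsilon> * K / \<tau> + 16 * real r * \<epsilon> / c + 4 * real r / c * g)) / (\<beta> * N)
     = (1 / \<beta>) * Pf + (1 / \<beta>) * Pd + (1 / \<beta>) * (32 / (c * x) + 2 * \<epsilon> * K / \<tau> + 16 * real r * \<epsilon> / c + 4 * real r / c * g)"
    using N by (simp add: add_divide_distrib)
  also have "Pf + Pd + ((1 / \<beta>) * Pf + (1 / \<beta>) * Pd + (1 / \<beta>) * (32 / (c * x) + 2 * \<epsilon> * K / \<tau> + 16 * real r * \<epsilon> / c + 4 * real r / c * g))
     = (1 + 1 / \<beta>) * Pf + (1 + 1 / \<beta>) * Pd + (1 / \<beta>) * (32 / (c * x) + 2 * \<epsilon> * K / \<tau> + 16 * real r * \<epsilon> / c + 4 * real r / c * g)"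
    by (simp add: algebra_simps)
  also have "\<dots> \<le> (1 + 1 / \<beta>) * (10 * (1 + K) * sqrt \<tau> / sqrt a) + (1 + 1 / \<beta>) * (2 * exp (- real n))
     + (1 / \<beta>) * (32 / (c * x) + 2 * \<epsilon> * K / \<tau> + 16 * real r * \<epsilon> / c + 4 * real r / c * g)"
    using Pf Pd \<beta> by (intro add_mono mult_left_mono order_refl) auto
  finally show ?thesis by (simp only: a_def \<delta>_def g_def)
qed

end

section \<open>Limits\<close>

lemma whp_gnpI:
  assumes p: "\<And>n. 0 \<le> p n \<and> p n \<le> 1"
    and fail: "\<And>\<eta>. \<eta> > 0 \<Longrightarrow> \<forall>\<^sub>F n in sequentially. gnp_ex n (p n) (\<lambda>E. of_bool (\<not> Q n {..<n} E)) \<le> \<eta>"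
  shows "whp_gnp p Q"
proof -
  have eq: "measure_pmf.prob (gnp n (p n)) {E. Q n {..<n} E} = 1 - gnp_ex n (p n) (\<lambda>E. of_bool (\<not> Q n {..<n} E))" for n
  proof -
    have "measure_pmf.prob (gnp n (p n)) {E. Q n {..<n} E} = gnp_ex n (p n) (\<lambda>E. 1 - of_bool (\<not> Q n {..<n} E))"
      using prob_gnp[of "p n" n "Q n {..<n}"] p by (simp add: pairs_def of_bool_not_iff)
    then show ?thesis by (simp only: bern_ex_diff bern_ex_const[OF finite_pairs])
  qed
  show ?thesis unfolding whp_gnp_def tendsto_iff
  proof (intro allI impI)
    fix e :: real assume e: "e > 0"
    from fail[of "e / 2"] e have "\<forall>\<^sub>F n in sequentially. gnp_ex n (p n) (\<lambda>E. of_bool (\<not> Q n {..<n} E)) \<le> e / 2" by simp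
    then show "\<forall>\<^sub>F n in sequentially. dist (measure_pmf.prob (gnp n (p n)) {E. Q n {..<n} E}) 1 < e"
    proof eventually_elim
      case (elim n)
      have "0 \<le> gnp_ex n (p n) (\<lambda>E. of_bool (\<not> Q n {..<n} E))" using p by (intro bern_ex_nonneg) auto
      then show ?case using elim e unfolding eq dist_real_def by linarith
    qed
  qed
qed

lemma admissible_sqrt_at_top:
  assumes "admissible_prob p"
  shows "filterlim (\<lambda>n. sqrt (real n * p n)) at_top sequentially"
proof -
  have o: "(\<lambda>n. 1 / real n) \<in> o(p)" and p: "\<And>n. 0 \<le> p n" using assms by (auto simp: admissible_prob_def)
  have "filterlim (\<lambda>n. real n * p n) at_top sequentially"
    unfolding filterlim_at_top_gt[where c = 0]
  proof (intro allI impI)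
    fix Z :: real assume Z: "Z > 0"
    have "\<forall>\<^sub>F n in sequentially. norm (1 / real n) \<le> (1 / Z) * norm (p n)"
      using landau_o.smallD[OF o, of "1 / Z"] Z by simp
    then show "\<forall>\<^sub>F n in sequentially. Z \<le> real n * p n"
      using eventually_gt_at_top[of 0]
    proof eventually_elim
      case (elim n)
      then show ?case using Z p[of n] by (simp add: field_simps)
    qed
  qed
  then show ?thesis by (rule filterlim_compose[OF sqrt_at_top])
qed

lemma admissible_pos:
  assumes "admissible_prob p"
  shows "\<forall>\<^sub>F n in sequentially. 0 < p n"
proof -
  have "\<forall>\<^sub>F n in sequentially. 1 \<le> sqrt (real n * p n)"
    using admissible_sqrt_at_top[OF assms] unfolding filterlim_at_top by blast
  then show ?thesis
  proof eventually_elim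
    case (elim n)
    have "p n \<ge> 0" using assms by (auto simp: admissible_prob_def)
    moreover have "p n \<noteq> 0" using elim by auto
    ultimately show ?case by simp
  qed
qed

lemma whp_core:
  fixes \<alpha> :: real
  assumes \<alpha>: "\<alpha> > 0" and r: "r \<ge> 2" and adm: "admissible_prob p"
    and d: "(\<lambda>n. real (d n)) \<in> o(\<lambda>n. sqrt (real n * p n))"
  shows "whp_gnp p (\<lambda>n V E. admits_core (d n) r \<alpha> V E)"
proof (rule whp_gnpI)
  show p01: "0 \<le> p n \<and> p n \<le> 1" for n using adm by (auto simp: admissible_prob_def)
  from adm obtain c where c: "c > 0" "\<forall>\<^sub>F n in sequentially. 1 - p n \<ge> c" by (auto simp: admissible_prob_def)
  fix \<eta> :: real assume \<eta>: "\<eta> > 0"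
  define x where "x n = sqrt (real n * p n)" for n
  have xtop: "filterlim x at_top sequentially" using admissible_sqrt_at_top[OF adm] by (simp add: x_def[abs_def])
  have r0: "real r \<ge> 2" using r by simp
  define K where "K = ln (real r) + 2"
  define \<beta> where "\<beta> = min (\<alpha> / 4) (1 / (4 * real r))"
  define z where "z = min \<beta> (c / (8 * real r))"
  define a where "a = c * (c / (64 * real r ^ 3)) / 2"
  have K0: "K > 0" using r0 by (simp add: K_def add_nonneg_pos)
  have \<beta>0: "\<beta> > 0" using \<alpha> r0 by (simp add: \<beta>_def)
  have z0: "z > 0" using \<beta>0 c r0 by (simp add: z_def)
  have a0: "a > 0" using c r0 by (simp add: a_def)
  have zle: "z \<le> c / (8 * real r)" "z \<le> \<beta>" by (auto simp: z_def)
  have \<beta>le: "\<beta> \<le> \<alpha> / 4" "\<beta> \<le> 1 / (4 * real r)" unfolding \<beta>_def by (rule min.cobounded1, rule min.cobounded2)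
  have q: "1 / (4 * real r) + 1 / (4 * real r) < 1 / real r" "1 / (4 * real r) \<le> 1 / (2 * real r)"
    using r0 by (auto simp: field_simps)
  have zb: "z + \<beta> < \<alpha>" "z + \<beta> < 1 / real r" "z \<le> 1 / (2 * real r)"
    using zle \<beta>le \<alpha> q by linarith+
  \<comment> \<open>The constants are chosen in the order \<open>\<tau>\<close>, \<open>\<epsilon>\<close>, \<open>\<mu>\<close>, each making one term of the bound at most
    \<open>\<eta> / 4\<close>; the remaining terms, collected in \<open>R\<close>, tend to zero.\<close>
  define \<tau> where "\<tau> = (\<eta> / 4 / ((1 + 1 / \<beta>) * (10 * (1 + K) / sqrt a)))\<^sup>2"
  have den1: "(1 + 1 / \<beta>) * (10 * (1 + K) / sqrt a) > 0" using \<beta>0 K0 a0 by (intro mult_pos_pos divide_pos_pos add_pos_pos) auto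
  have \<tau>0: "\<tau> > 0" unfolding \<tau>_def using \<eta> den1 by (intro zero_less_power divide_pos_pos) auto
  have cancel: "D * (\<eta> / 4 / D) = \<eta> / 4" if "D > 0" for D using that by simp
  have t1: "(1 + 1 / \<beta>) * (10 * (1 + K) * sqrt \<tau> / sqrt a) = \<eta> / 4"
  proof -
    have "sqrt \<tau> = \<eta> / 4 / ((1 + 1 / \<beta>) * (10 * (1 + K) / sqrt a))"
      unfolding \<tau>_def real_sqrt_abs using \<eta> den1 by (intro abs_of_nonneg divide_nonneg_nonneg) auto
    then have "((1 + 1 / \<beta>) * (10 * (1 + K) / sqrt a)) * sqrt \<tau> = \<eta> / 4"
      by (simp only: cancel[OF den1])
    then show ?thesis by (simp only: mult_ac times_divide_eq_right times_divide_eq_left)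
  qed
  define w where "w = (1 / \<beta>) * (2 * K / \<tau> + 16 * real r / c)"
  have w0: "w > 0" unfolding w_def using \<beta>0 K0 \<tau>0 r0 c by (intro mult_pos_pos add_pos_pos divide_pos_pos) auto
  define \<epsilon> where "\<epsilon> = min (1/2) (\<eta> / 4 / w)"
  have eps: "0 < \<epsilon>" "\<epsilon> \<le> 1/2" "\<epsilon> * w \<le> \<eta> / 4"
  proof -
    show "0 < \<epsilon>" "\<epsilon> \<le> 1/2" using \<eta> w0 by (auto simp: \<epsilon>_def)
    have "\<epsilon> \<le> \<eta> / 4 / w" unfolding \<epsilon>_def by (rule min.cobounded2)
    then show "\<epsilon> * w \<le> \<eta> / 4" using w0 by (simp only: pos_le_divide_eq)
  qed
  define \<mu> where "\<mu> = \<eta> / 4 / ((1 / \<beta>) * (4 * real r / c * (real r * sqrt (8 * \<epsilon>))))"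
  have den2: "(1 / \<beta>) * (4 * real r / c * (real r * sqrt (8 * \<epsilon>))) > 0"
    using \<beta>0 r0 c eps by (intro mult_pos_pos divide_pos_pos) auto
  have \<mu>0: "\<mu> > 0" unfolding \<mu>_def using \<eta> den2 by (intro divide_pos_pos) auto
  have t3: "(1 / \<beta>) * (4 * real r / c * (real r * \<mu> * sqrt (8 * \<epsilon>))) = \<eta> / 4"
  proof -
    have "((1 / \<beta>) * (4 * real r / c * (real r * sqrt (8 * \<epsilon>)))) * \<mu> = \<eta> / 4"
      unfolding \<mu>_def by (rule cancel[OF den2])
    then show ?thesis by (simp only: mult_ac)
  qed
  define R where "R n = (1 + 1 / \<beta>) * (2 * exp (- real n))
      + (1 / \<beta>) * (32 / c * (1 / x n) + 4 * real r / c * (real r / (\<epsilon> * \<mu>) * (real (d n) / x n) + 2 * K * (1 / x n) + 2 * \<mu> * (1 / x n)))" for n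
  have xinv: "(\<lambda>n. 1 / x n) \<longlonglongrightarrow> 0"
    using tendsto_inverse_0_at_top[OF xtop] by (simp add: inverse_eq_divide)
  have dx: "(\<lambda>n. real (d n) / x n) \<longlonglongrightarrow> 0"
    using smalloD_tendsto[OF d] by (simp add: x_def)
  have expn: "(\<lambda>n. exp (- real n)) \<longlonglongrightarrow> 0"
    by (rule filterlim_compose[OF exp_at_bot]) (simp add: filterlim_uminus_at_bot filterlim_real_sequentially)
  have "R \<longlonglongrightarrow> (1 + 1 / \<beta>) * (2 * 0) + (1 / \<beta>) * (32 / c * 0 + 4 * real r / c * (real r / (\<epsilon> * \<mu>) * 0 + 2 * K * 0 + 2 * \<mu> * 0))"
    unfolding R_def[abs_def] by (intro tendsto_intros xinv dx expn)
  then have R0: "R \<longlonglongrightarrow> 0" by simp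
  have e1: "\<forall>\<^sub>F n in sequentially. R n \<le> \<eta> / 4"
    using order_tendstoD(2)[OF R0, of "\<eta> / 4"] \<eta> by (auto elim: eventually_mono)
  have e2: "\<forall>\<^sub>F n in sequentially. x n \<ge> max (max 1 \<mu>) (max (sqrt (1 / (\<tau> * a))) (32 * real r / z))"
    using xtop by (simp only: filterlim_at_top)
  have e3: "\<forall>\<^sub>F n in sequentially. real n \<ge> max (2 * \<tau>) (2 / z)"
    using filterlim_real_sequentially by (simp only: filterlim_at_top)
  have e4: "\<forall>\<^sub>F n in sequentially. real (d n) \<le> \<tau> * x n"
    using landau_o.smallD[OF d \<tau>0] p01 by (simp add: x_def)
  show "\<forall>\<^sub>F n in sequentially. gnp_ex n (p n) (\<lambda>E. of_bool (\<not> admits_core (d n) r \<alpha> {..<n} E)) \<le> \<eta>"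
    using e1 e2 e3 e4 c(2) admissible_pos[OF adm] eventually_gt_at_top[of 0]
  proof eventually_elim
    case (elim n)
    interpret cuts n r by standard (rule r)
    have x1: "x n \<ge> 1" "\<mu> \<le> x n" "sqrt (1 / (\<tau> * a)) \<le> x n" "32 * real r / z \<le> x n" using elim(2) by auto
    have n1: "2 * \<tau> \<le> real n" "2 / z \<le> real n" using elim(3) by auto
    have big: "\<tau> * a * (x n)\<^sup>2 \<ge> 1"
    proof -
      have la: "\<tau> * a > 0" using \<tau>0 a0 by simp
      have "1 / (\<tau> * a) \<le> (x n)\<^sup>2"
        using x1 la power_mono[of "sqrt (1 / (\<tau> * a))" "x n" 2] by simp
      then show ?thesis using la by (simp only: pos_divide_le_eq mult.commute)
    qed
    have zx: "1 + 16 * real r * real n / x n \<le> z * real n"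
    proof -
      have "1 \<le> z * real n / 2" using n1(2) z0 by (simp add: pos_divide_le_eq mult.commute)
      moreover have "16 * real r * real n / x n \<le> z * real n / 2"
      proof -
        have "32 * real r \<le> x n * z" using x1(4) z0 by (simp only: pos_divide_le_eq)
        then have "(32 * real r) * real n \<le> (x n * z) * real n" by (intro mult_right_mono) auto
        then show ?thesis using x1(1) by (simp add: pos_divide_le_eq mult_ac)
      qed
      ultimately show ?thesis by linarith
    qed
    have "gnp_ex n (p n) (\<lambda>H. of_bool (\<not> admits_core (d n) r \<alpha> {..<n} H))
    \<le> (1 + 1 / \<beta>) * (10 * (1 + K) * sqrt \<tau> / sqrt (c * (c / (64 * real r ^ 3)) / 2))
      + (1 + 1 / \<beta>) * (2 * exp (- real n))
      + (1 / \<beta>) * (32 / (c * x n) + 2 * \<epsilon> * K / \<tau> + 16 * real r * \<epsilon> / c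
         + 4 * real r / c * (real r * d n / (\<epsilon> * \<mu> * x n) + real r * \<mu> * sqrt (8 * \<epsilon>) + 2 * K / x n + 2 * \<mu> / x n))"
      using elim x1 n1 big \<tau>0 \<mu>0
      by (intro core_failure_numeric[OF _ _ _ c(1) x_def x1(1) K_def _ _ _ eps(1,2) _ _ _ zle(1) zb \<beta>0 zx]) (auto simp: a_def)
    also have "\<dots> = (1 + 1 / \<beta>) * (10 * (1 + K) * sqrt \<tau> / sqrt a) + R n + \<epsilon> * w
        + (1 / \<beta>) * (4 * real r / c * (real r * \<mu> * sqrt (8 * \<epsilon>)))"
      unfolding R_def w_def a_def by (simp add: distrib_left) (simp add: mult_ac)
    also have "\<dots> \<le> \<eta> / 4 + \<eta> / 4 + \<eta> / 4 + \<eta> / 4"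
      unfolding t1 t3 using elim(1) eps(3) by (intro add_mono order_refl)
    finally show ?case by simp
  qed
qed

section \<open>Large sets are split by some near-maximum cut\<close>

context cuts
begin

text \<open>
  The constant \<open>2 + 32 / \<alpha>\<close> does not involve \<open>r\<close>: the inequality for block sizes is used only when
  part \<open>j\<close> is larger than the part that contains \<open>S\<close>, and then it has at least \<open>\<alpha> n\<close> vertices.
\<close>

lemma not_in_single_part:
  fixes \<alpha> p x :: real
  assumes E: "E \<subseteq> pairs n" and p: "0 < p" "p \<le> 1" and x: "x \<ge> 1" and ok: "jumbled n p (8 * real n * x) E"
    and S: "S \<subseteq> {..<n}" "real (card S) \<ge> \<alpha> * real n" and \<alpha>: "\<alpha> > 0" "\<alpha> * real n \<ge> 2"
    and d: "real d \<ge> (2 + 32 / \<alpha>) * x"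
  shows "\<not> in_single_part d r {..<n} E S"
proof
  assume sp: "in_single_part d r {..<n} E S"
  define c where "c = opt E"
  define t where "t = 8 * real n * x"
  have c: "near 0 E c" "near (real d) E c" using near_opt by (auto simp: c_def)
  have CI: "c \<in> colourings n r" using c by (auto simp: near_def)
  have n0: "real n > 0" using \<alpha> by (cases "n = 0") auto
  obtain i where i: "i < r" "S \<subseteq> block n c i"
    using sp deficit_of_near[OF E c(2)] unfolding in_single_part_def by blast
  obtain j where j: "j < r" "j \<noteq> i"
  proof (cases "i = 0")
    case True
    then show ?thesis using that[of 1] r by auto
  next
    case False
    then show ?thesis using that[of 0] r by auto
  qed
  let ?P = "block n c"
  have finS: "finite S" using S finite_subset by blast
  have S2: "real (card S) \<ge> 2" using S \<alpha> by linarith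
  have SP: "real (card S) \<le> real (card (?P i))" using i by (auto intro: card_mono)
  have t0: "0 \<le> t" using x by (simp add: t_def)
  have size: "p * (real (card (?P j)) - real (card (?P i))) \<le> p + 2 * t / (\<alpha> * real n)"
  proof (cases "card (?P j) \<le> card (?P i)")
    case True
    then have "p * (real (card (?P j)) - real (card (?P i))) \<le> 0" using p by (intro mult_nonneg_nonpos) auto
    moreover have "0 \<le> p + 2 * t / (\<alpha> * real n)" using p t0 \<alpha> by simp
    ultimately show ?thesis by linarith
  next
    case False
    then have b: "\<alpha> * real n \<le> real (card (?P j))" using SP S by linarith
    have "real (card (?P j)) * (p * (real (card (?P j)) - 1 - real (card (?P i)))) \<le> 2 * t"
      using block_sizes[OF ok E c(1) i(1) j(1)] p by (simp add: t_def mult_ac)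
    then have "p * (real (card (?P j)) - 1 - real (card (?P i))) \<le> 2 * t / real (card (?P j))"
      using b \<alpha> by (simp add: pos_le_divide_eq mult.commute)
    also have "\<dots> \<le> 2 * t / (\<alpha> * real n)" using b \<alpha> t0 n0 by (intro divide_left_mono) auto
    finally show ?thesis by (simp add: algebra_simps)
  qed
  have "edges_between E S (?P j) - edges_between E S (?P i) \<le> real (card S) * (2 + 4 * t / (\<alpha> * real n))"
  proof -
    have disj: "S \<inter> ?P j = {}" "S \<inter> ?P i = S" using i j by (auto simp: block_def)
    have "\<bar>edges_between E S (?P j) - p * (real (card S) * real (card (?P j)) - real (card (S \<inter> ?P j)))\<bar> \<le> t"
      "\<bar>edges_between E S (?P i) - p * (real (card S) * real (card (?P i)) - real (card (S \<inter> ?P i)))\<bar> \<le> t"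
      using ok[unfolded jumbled_def, rule_format, OF conjI[OF S(1) block_subset]] by (simp_all add: t_def)
    then have "edges_between E S (?P j) - edges_between E S (?P i)
        \<le> real (card S) * (p * (real (card (?P j)) - real (card (?P i)))) + real (card S) * p + 2 * t"
      using disj by (simp add: algebra_simps)
    also have "\<dots> \<le> real (card S) * (p + 2 * t / (\<alpha> * real n)) + real (card S) * p + real (card S) * (2 * t / (\<alpha> * real n))"
    proof (intro add_mono mult_left_mono size order_refl)
      have "2 * t = (\<alpha> * real n) * (2 * t / (\<alpha> * real n))" using \<alpha> n0 by simp
      also have "\<dots> \<le> real (card S) * (2 * t / (\<alpha> * real n))" using S t0 \<alpha> by (intro mult_right_mono) auto
      finally show "2 * t \<le> real (card S) * (2 * t / (\<alpha> * real n))" .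
    qed auto
    also have "\<dots> = real (card S) * (2 * p + 4 * t / (\<alpha> * real n))" by (simp add: algebra_simps)
    also have "\<dots> \<le> real (card S) * (2 + 4 * t / (\<alpha> * real n))" using p by (intro mult_left_mono) auto
    finally show ?thesis .
  qed
  also have "4 * t / (\<alpha> * real n) = 32 / \<alpha> * x" using n0 by (simp add: t_def)
  also have "real (card S) * (2 + 32 / \<alpha> * x) \<le> real (card S) * real d"
    using d x by (intro mult_left_mono) (auto simp: algebra_simps)
  finally have tot: "(\<Sum>v\<in>S. real (deg_to E v (?P j)) - real (deg_to E v (?P i))) \<le> (\<Sum>v\<in>S. real d)"
    by (simp add: edges_between_def sum_subtractf)
  have "\<exists>v\<in>S. real (deg_to E v (?P j)) - real (deg_to E v (?P i)) \<le> real d"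
  proof (rule ccontr)
    assume "\<not> ?thesis"
    then have "(\<Sum>v\<in>S. real d) < (\<Sum>v\<in>S. real (deg_to E v (?P j)) - real (deg_to E v (?P i)))"
      using finS S2 by (intro sum_strict_mono) auto
    then show False using tot by simp
  qed
  then obtain v where v: "v \<in> S" "real (deg_to E v (?P j)) - real (deg_to E v (?P i)) \<le> real d" by blast
  have vn: "v < n" "c v = i" using v S i by (auto simp: block_def)
  have "near (real d) E (c(v := j))"
    by (rule near_recolour[OF c(1) vn(1) j(1) _ E]) (use vn j v in auto)
  then obtain k where k: "S \<subseteq> block n (c(v := j)) k"
    using sp deficit_of_near[OF E] unfolding in_single_part_def by blast
  have "\<not> S \<subseteq> {v}"
  proof
    assume "S \<subseteq> {v}"
    then have "card S \<le> card {v}" by (intro card_mono) auto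
    then show False using S2 by simp
  qed
  then obtain w where w: "w \<in> S" "w \<noteq> v" by auto
  have "c w = i" using w i by (auto simp: block_def)
  moreover have "c w = k" using w k by (auto simp: block_def)
  moreover have "j = k" using v k by (auto simp: block_def)
  ultimately show False using j by simp
qed

end

lemma whp_no_single_part:
  fixes \<alpha> :: real
  assumes \<alpha>: "\<alpha> > 0" and r: "r \<ge> 2" and adm: "admissible_prob p"
    and d: "\<forall>\<^sub>F n in sequentially. real (d n) \<ge> (2 + 32 / \<alpha>) * sqrt (real n * p n)"
  shows "whp_gnp p (\<lambda>n V E. \<not> (\<exists>S\<subseteq>V. real (card S) \<ge> \<alpha> * real n \<and> in_single_part (d n) r V E S))"
proof (rule whp_gnpI)
  show p01: "0 \<le> p n \<and> p n \<le> 1" for n using adm by (auto simp: admissible_prob_def)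
  fix \<eta> :: real assume \<eta>: "\<eta> > 0"
  have expn: "(\<lambda>n. 2 * exp (- real n)) \<longlonglongrightarrow> 2 * 0"
    by (intro tendsto_intros filterlim_compose[OF exp_at_bot])
       (simp add: filterlim_uminus_at_bot filterlim_real_sequentially)
  have e1: "\<forall>\<^sub>F n in sequentially. 2 * exp (- real n) \<le> \<eta>"
    using order_tendstoD(2)[OF expn, of \<eta>] \<eta> by (auto elim: eventually_mono)
  have e2: "\<forall>\<^sub>F n in sequentially. sqrt (real n * p n) \<ge> 1"
    using admissible_sqrt_at_top[OF adm] by (simp only: filterlim_at_top)
  have e3: "\<forall>\<^sub>F n in sequentially. real n \<ge> 2 / \<alpha>"
    using filterlim_real_sequentially by (simp only: filterlim_at_top)
  show "\<forall>\<^sub>F n in sequentially. gnp_ex n (p n)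
      (\<lambda>E. of_bool (\<not> \<not> (\<exists>S\<subseteq>{..<n}. real (card S) \<ge> \<alpha> * real n \<and> in_single_part (d n) r {..<n} E S))) \<le> \<eta>"
    using e1 e2 e3 d admissible_pos[OF adm]
  proof eventually_elim
    case (elim n)
    interpret cuts n r by standard (rule r)
    have np: "real n * p n \<ge> 1" using elim(2) by simp
    have an: "\<alpha> * real n \<ge> 2" using elim(3) \<alpha> by (simp add: pos_divide_le_eq mult.commute)
    have "gnp_ex n (p n)
      (\<lambda>E. of_bool (\<not> \<not> (\<exists>S\<subseteq>{..<n}. real (card S) \<ge> \<alpha> * real n \<and> in_single_part (d n) r {..<n} E S)))
      \<le> gnp_ex n (p n) (\<lambda>E. of_bool (\<not> jumbled n (p n) (8 * real n * sqrt (real n * p n)) E))"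
    proof (intro bern_ex_mono p01)
      fix E assume E: "E \<subseteq> pairs n"
      have "\<not> (\<exists>S\<subseteq>{..<n}. real (card S) \<ge> \<alpha> * real n \<and> in_single_part (d n) r {..<n} E S)"
        if "jumbled n (p n) (8 * real n * sqrt (real n * p n)) E"
        using not_in_single_part[OF E elim(5) _ elim(2) that _ _ \<alpha> an elim(4)] p01 by blast
      then show "of_bool (\<not> \<not> (\<exists>S\<subseteq>{..<n}. real (card S) \<ge> \<alpha> * real n \<and> in_single_part (d n) r {..<n} E S))
        \<le> (of_bool (\<not> jumbled n (p n) (8 * real n * sqrt (real n * p n)) E) :: real)"
        by auto
    qed
    also have "\<dots> \<le> 2 * exp (- real n)" using p01[of n] by (intro prob_not_jumbled np) auto
    also have "\<dots> \<le> \<eta>" by (rule elim(1))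
    finally show ?case .
  qed
qed

theorem theorem1p1:
  fixes \<alpha> :: real
  assumes "\<alpha> > 0"
  shows
    "(\<forall>(r::nat) (p :: nat \<Rightarrow> real) (d :: nat \<Rightarrow> nat).
        r \<ge> 2 \<and> admissible_prob p \<and>
        (\<lambda>n. real (d n)) \<in> o(\<lambda>n. sqrt (real n * p n)) \<longrightarrow>
        whp_gnp p (\<lambda>n V E. admits_core (d n) r \<alpha> V E))
     \<and>
     (\<exists>C>0. \<forall>(r::nat) (p :: nat \<Rightarrow> real) (d :: nat \<Rightarrow> nat).
        r \<ge> 2 \<and> admissible_prob p \<and>
        (\<forall>\<^sub>F n in sequentially. real (d n) \<ge> C * sqrt (real n * p n)) \<longrightarrow>
        whp_gnp p (\<lambda>n V E.
          \<not> (\<exists>S \<subseteq> V. real (card S) \<ge> \<alpha> * real n \<and> in_single_part (d n) r V E S)))"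
proof (intro conjI exI[of _ "2 + 32 / \<alpha>"] allI impI)
  show "2 + 32 / \<alpha> > 0" using assms by (simp add: add_pos_pos)
qed (use whp_core[OF assms] whp_no_single_part[OF assms] in blast)+

end
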